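(* Let $n>1$ be a square-free integer, and let $n'$, $d$, $F_n$, $C_n$, $D_n$ be as defined in the context. Set $$q_k=\begin{cases}(n\,|\,k), & k \text{ odd},\\ \mu(n'/g_k')\,\phi(g_k')\,\cos\big((n-1)k\pi/4\big), & k\text{ even},\end{cases}\qquad g_k'=\gcd(k,n').$$ Consider the following algorithm. 1. Evaluate $q_k$ for $k=1,\dots,d$. 2. Set $\gamma_0=1$ and $\delta_0=1$. 3. Evaluate, for $k=1,2,\dots$ in increasing order, $\gamma_k$ (for $1\le k\le\lfloor d/2\rfloor$) and then $\delta_k$ (for $1\le k\le\lfloor (d-1)/2\rfloor$) by $$\gamma_k=\frac1{2k}\sum_{j=0}^{k-1}\big(n\,q_{2k-2j-1}\,\delta_j-q_{2k-2j}\,\gamma_j\big),$$ $$\delta_k=\frac1{2k+1}\Big(\gamma_k+\sum_{j=0}^{k-1}\big(q_{2k+1-2j}\,\gamma_j-q_{2k-2j}\,\delta_j\big)\Big).$$ 4. Set $\gamma_k=\gamma_{d-k}$ for $\lfloor d/2\rfloor+1\le k\le d$. 5. Set $\delta_k=\delta_{d-1-k}$ for $\lfloor (d+1)/2\rfloor\le k\le d-1$. Then all the $q_k,\gamma_k,\delta_k$ are integers (so that the divisions in step 3 are exact), the algorithm uses $O(n^2)$ arithmetic operations, and its output gives the coefficients of $C_n$ and $D_n$: $$C_n(x)=\sum_{j=0}^{d}\gamma_j x^{d-j},\qquad D_n(x)=\sum_{j=0}^{d-1}\delta_j x^{d-1-j}.$$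
   Context: $\mu$ is the Möbius function and $\phi$ is Euler's totient function. $(a\,|\,b)$, for odd $b>0$, is the Jacobi symbol, with $(a\,|\,b)=0$ if $\gcd(a,b)>1$ and $(a\,|\,1)=1$. $n'=n$ if $n\equiv1\pmod 4$ and $n'=2n$ otherwise; $d=\phi(n')/2$. $\Phi_m$ denotes the $m$-th cyclotomic polynomial. For square-free $n>1$ let $s=-1$ if $n\equiv 3\pmod 4$ and $s=+1$ otherwise, and define $$F_n(x)=\begin{cases}\Phi_n(sx), & n\text{ odd},\\ (-1)^{\phi(n/2)}\,\Phi_{n/2}(-x^2), & n\text{ even}.\end{cases}$$ $C_n(x)$ and $D_n(x)$ are the monic polynomials with integer coefficients satisfying the identity of Aurifeuille, Le Lasseur and Lucas, $F_n(x)=C_n(x)^2-n\,x\,D_n(x)^2$. *)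

theory Defs
  imports
    Complex_Main
    "HOL-Computational_Algebra.Computational_Algebra"
    "HOL-Number_Theory.Number_Theory"
    "HOL-Library.Landau_Symbols"
    "HOL-Library.State_Monad"
begin

section \<open>Arithmetic functions\<close>

definition moebius :: "nat \<Rightarrow> int" where
  "moebius m = (if squarefree m then (- 1) ^ card (prime_factors m) else 0)"

text \<open>Only meaningful for odd positive \<open>b\<close>. If \<open>gcd a b > 1\<close>, some factor
  \<^const>\<open>Legendre\<close> vanishes, so the value is 0; for \<open>b = 1\<close> the product is empty.\<close>

definition jacobi :: "int \<Rightarrow> nat \<Rightarrow> int" where
  "jacobi a b = (\<Prod>p\<in>#prime_factorization b. Legendre a (int p))"


section \<open>The polynomials\<close>

definition cyclotomic :: "nat \<Rightarrow> complex poly" where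
  "cyclotomic m = (\<Prod>k\<in>totatives m. [:- cis (2 * pi * real k / real m), 1:])"

definition aur_F :: "nat \<Rightarrow> complex poly" where
  "aur_F n =
     (if odd n
      then pcompose (cyclotomic n) [:0, if n mod 4 = 3 then - 1 else 1:]
      else Polynomial.smult ((- 1) ^ totient (n div 2)) (pcompose (cyclotomic (n div 2)) [:0, 0, - 1:]))"

definition aur_pair :: "nat \<Rightarrow> int poly \<Rightarrow> int poly \<Rightarrow> bool" where
  "aur_pair n C D \<longleftrightarrow>
     lead_coeff C = 1 \<and> lead_coeff D = 1 \<and>
     aur_F n = (map_poly of_int C)\<^sup>2 - [:0, of_nat n:] * (map_poly of_int D)\<^sup>2"

definition aur_C :: "nat \<Rightarrow> int poly" where
  "aur_C n = (THE C. \<exists>D. aur_pair n C D)"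

definition aur_D :: "nat \<Rightarrow> int poly" where
  "aur_D n = (THE D. \<exists>C. aur_pair n C D)"


section \<open>The sequences\<close>

definition aur_n' :: "nat \<Rightarrow> nat" where
  "aur_n' n = (if n mod 4 = 1 then n else 2 * n)"

definition aur_d :: "nat \<Rightarrow> nat" where
  "aur_d n = totient (aur_n' n) div 2"

definition aur_q :: "nat \<Rightarrow> nat \<Rightarrow> real" where
  "aur_q n k =
     (if odd k then of_int (jacobi (int n) k)
      else (let g = gcd k (aur_n' n) in
        of_int (moebius (aur_n' n div g)) * real (totient g)
          * cos ((real n - 1) * real k * pi / 4)))"

text \<open>The indices not covered by the algorithm (\<open>k > d\<close> for \<open>\<gamma>\<close> and \<open>k \<ge> d\<close> for \<open>\<delta>\<close>)
  get the value 0.\<close>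

function aur_gamma :: "nat \<Rightarrow> nat \<Rightarrow> real" and aur_delta :: "nat \<Rightarrow> nat \<Rightarrow> real" where
  "aur_gamma n k =
     (if k = 0 then 1
      else if k \<le> aur_d n div 2 then
        1 / (2 * real k) *
          (\<Sum>j<k. real n * aur_q n (2 * k - 2 * j - 1) * aur_delta n j
                   - aur_q n (2 * k - 2 * j) * aur_gamma n j)
      else if k \<le> aur_d n then aur_gamma n (aur_d n - k)
      else 0)"
| "aur_delta n k =
     (if k = 0 then 1
      else if k \<le> (aur_d n - 1) div 2 then
        1 / (2 * real k + 1) *
          (aur_gamma n k +
           (\<Sum>j<k. aur_q n (2 * k + 1 - 2 * j) * aur_gamma n j
                    - aur_q n (2 * k - 2 * j) * aur_delta n j))
      else if k < aur_d n then aur_delta n (aur_d n - 1 - k)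
      else 0)"
  by pat_completeness auto
termination
  by (relation "measure (case_sum (\<lambda>(n, k). 2 * k) (\<lambda>(n, k). 2 * k + 1))") auto

declare aur_gamma.simps [simp del] aur_delta.simps [simp del]


section \<open>The algorithm with a count of its arithmetic operations\<close>

text \<open>The state is the number of operations performed so far. Each binary operation on integers
  (\<open>+\<close>, \<open>-\<close>, \<open>*\<close>, \<open>div\<close>, \<open>mod\<close>, comparison) is applied through \<open>arith\<close> and costs one unit. Loop
  control, array addressing and assignments are free. Arrays are functions that are updated
  pointwise.\<close>

type_synonym 'a counted = "(nat, 'a) state"

definition arith :: "('a \<Rightarrow> 'b \<Rightarrow> 'c) \<Rightarrow> 'a \<Rightarrow> 'b \<Rightarrow> 'c counted" where
  "arith f x y = State (\<lambda>c. (f x y, Suc c))"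

abbreviation ret :: "'a \<Rightarrow> 'a counted" where
  "ret \<equiv> State_Monad.return"

primrec for_each :: "'i list \<Rightarrow> ('i \<Rightarrow> 'a \<Rightarrow> 'a counted) \<Rightarrow> 'a \<Rightarrow> 'a counted" where
  "for_each [] body a = ret a"
| "for_each (i # is) body a = do { b \<leftarrow> body i a; for_each is body b }"

text \<open>Trial division; \<open>m\<close> rounds suffice for \<open>m > 0\<close>. The result lists the prime factors of \<open>m\<close>
  with multiplicity, in descending order.\<close>

definition prime_factors_c :: "nat \<Rightarrow> nat list counted" where
  "prime_factors_c m = do {
     (p, r, ps) \<leftarrow> for_each [0..<m] (\<lambda>_ (p, r, ps). do {
         t \<leftarrow> arith (mod) r p;
         b \<leftarrow> arith (=) t 0;
         if b then do { r' \<leftarrow> arith (div) r p; ret (p, r', p # ps) }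
         else do { p' \<leftarrow> arith (+) p 1; ret (p', r, ps) }
       }) (2, m, []);
     ret ps
   }"

definition totient_c :: "nat \<Rightarrow> nat counted" where
  "totient_c m = do {
     ps \<leftarrow> prime_factors_c m;
     (prev, v) \<leftarrow> for_each ps (\<lambda>p (prev, v). do {
         b \<leftarrow> arith (=) p prev;
         if b then do { v' \<leftarrow> arith (*) v p; ret (p, v') }
         else do { t \<leftarrow> arith (-) p 1; v' \<leftarrow> arith (*) v t; ret (p, v') }
       }) (0, 1);
     ret v
   }"

definition moebius_c :: "nat \<Rightarrow> int counted" where
  "moebius_c m = do {
     ps \<leftarrow> prime_factors_c m;
     (prev, v) \<leftarrow> for_each ps (\<lambda>p (prev, v). do {
         b \<leftarrow> arith (=) p prev;
         if b then ret (p, 0)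
         else do { v' \<leftarrow> arith (-) 0 v; ret (p, v') }
       }) (0, 1);
     ret v
   }"

text \<open>Euclid's algorithm; \<open>b\<close> rounds suffice because the second argument strictly decreases.\<close>

definition gcd_c :: "nat \<Rightarrow> nat \<Rightarrow> nat counted" where
  "gcd_c a b = do {
     (x, y) \<leftarrow> for_each [0..<b] (\<lambda>_ (x, y). do {
         z \<leftarrow> arith (=) y 0;
         if z then ret (x, y) else do { r \<leftarrow> arith (mod) x y; ret (y, r) }
       }) (a, b);
     ret x
   }"

definition legendre_c :: "nat \<Rightarrow> nat \<Rightarrow> int counted" where
  "legendre_c n p = do {
     a \<leftarrow> arith (mod) n p;
     z \<leftarrow> arith (=) a 0;
     if z then ret 0
     else for_each [1..<p] (\<lambda>x v. do {
         s \<leftarrow> arith (*) x x;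
         t \<leftarrow> arith (mod) s p;
         b \<leftarrow> arith (=) t a;
         ret (if b then 1 else v)
       }) (- 1)
   }"

definition jacobi_c :: "nat \<Rightarrow> nat \<Rightarrow> int counted" where
  "jacobi_c n k = do {
     ps \<leftarrow> prime_factors_c k;
     for_each ps (\<lambda>p v. do { l \<leftarrow> legendre_c n p; arith (*) v l }) 1
   }"

text \<open>\<open>cos ((n - 1) k \<pi> / 4)\<close> for even \<open>k\<close>, read off from \<open>(n - 1) (k / 2)\<close> modulo 4.\<close>

definition cos_c :: "nat \<Rightarrow> nat \<Rightarrow> int counted" where
  "cos_c n k = do {
     m \<leftarrow> arith (-) n 1;
     h \<leftarrow> arith (div) k 2;
     t \<leftarrow> arith (*) m h;
     r \<leftarrow> arith (mod) t 4;
     b0 \<leftarrow> arith (=) r 0;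
     b2 \<leftarrow> arith (=) r 2;
     ret (if b0 then 1 else if b2 then - 1 else 0)
   }"

definition n'_c :: "nat \<Rightarrow> nat counted" where
  "n'_c n = do {
     r \<leftarrow> arith (mod) n 4;
     b \<leftarrow> arith (=) r 1;
     if b then ret n else arith (*) 2 n
   }"

definition q_c :: "nat \<Rightarrow> nat \<Rightarrow> nat \<Rightarrow> int counted" where
  "q_c n n' k = do {
     r \<leftarrow> arith (mod) k 2;
     b \<leftarrow> arith (=) r 1;
     if b then jacobi_c n k
     else do {
       g \<leftarrow> gcd_c n' k;
       h \<leftarrow> arith (div) n' g;
       m \<leftarrow> moebius_c h;
       f \<leftarrow> totient_c g;
       c \<leftarrow> cos_c n k;
       x \<leftarrow> arith (*) m (int f);
       arith (*) x c
     }
   }"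

definition gamma_c ::
    "nat \<Rightarrow> (nat \<Rightarrow> int) \<Rightarrow> (nat \<Rightarrow> int) \<Rightarrow> (nat \<Rightarrow> int) \<Rightarrow> nat \<Rightarrow> int counted" where
  "gamma_c n q \<gamma> \<delta> k = do {
     s \<leftarrow> for_each [0..<k] (\<lambda>j s. do {
         u \<leftarrow> arith (*) (int n) (q (2 * k - 2 * j - 1));
         v \<leftarrow> arith (*) u (\<delta> j);
         w \<leftarrow> arith (*) (q (2 * k - 2 * j)) (\<gamma> j);
         t \<leftarrow> arith (-) v w;
         arith (+) s t
       }) 0;
     c \<leftarrow> arith (*) 2 (int k);
     arith (div) s c
   }"

definition delta_c ::
    "(nat \<Rightarrow> int) \<Rightarrow> (nat \<Rightarrow> int) \<Rightarrow> (nat \<Rightarrow> int) \<Rightarrow> nat \<Rightarrow> int counted" where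
  "delta_c q \<gamma> \<delta> k = do {
     s \<leftarrow> for_each [0..<k] (\<lambda>j s. do {
         v \<leftarrow> arith (*) (q (2 * k + 1 - 2 * j)) (\<gamma> j);
         w \<leftarrow> arith (*) (q (2 * k - 2 * j)) (\<delta> j);
         t \<leftarrow> arith (-) v w;
         arith (+) s t
       }) 0;
     s' \<leftarrow> arith (+) (\<gamma> k) s;
     c \<leftarrow> arith (*) 2 (int k);
     c' \<leftarrow> arith (+) c 1;
     arith (div) s' c'
   }"

text \<open>The result consists of \<open>d\<close> and the arrays \<open>q\<close>, \<open>\<gamma>\<close>, \<open>\<delta>\<close>. In step 3 the loop over \<open>k\<close> runs to
  \<open>d div 2\<close>, which is at least \<open>(d - 1) div 2\<close>.\<close>

definition aur_algorithm :: "nat \<Rightarrow> (nat \<times> (nat \<Rightarrow> int) \<times> (nat \<Rightarrow> int) \<times> (nat \<Rightarrow> int)) counted" where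
  "aur_algorithm n = do {
     n' \<leftarrow> n'_c n;
     t \<leftarrow> totient_c n';
     d \<leftarrow> arith (div) t 2;
     q \<leftarrow> for_each [1..<Suc d] (\<lambda>k q. do { x \<leftarrow> q_c n n' k; ret (q(k := x)) }) (\<lambda>_. 0);
     (\<gamma>, \<delta>) \<leftarrow> for_each [1..<Suc (d div 2)] (\<lambda>k (\<gamma>, \<delta>). do {
         x \<leftarrow> gamma_c n q \<gamma> \<delta> k;
         let \<gamma>' = \<gamma>(k := x);
         if k \<le> (d - 1) div 2 then do { y \<leftarrow> delta_c q \<gamma>' \<delta> k; ret (\<gamma>', \<delta>(k := y)) }
         else ret (\<gamma>', \<delta>)
       }) ((\<lambda>_. 0)(0 := 1), (\<lambda>_. 0)(0 := 1));
     \<gamma> \<leftarrow> for_each [d div 2 + 1..<Suc d] (\<lambda>k \<gamma>. ret (\<gamma>(k := \<gamma> (d - k)))) \<gamma>;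
     \<delta> \<leftarrow> for_each [(d + 1) div 2..<d] (\<lambda>k \<delta>. ret (\<delta>(k := \<delta> (d - 1 - k)))) \<delta>;
     ret (d, q, \<gamma>, \<delta>)
   }"

definition aur_output :: "nat \<Rightarrow> nat \<times> (nat \<Rightarrow> int) \<times> (nat \<Rightarrow> int) \<times> (nat \<Rightarrow> int)" where
  "aur_output n = fst (run_state (aur_algorithm n) 0)"

definition aur_ops :: "nat \<Rightarrow> nat" where
  "aur_ops n = snd (run_state (aur_algorithm n) 0)"

end

theory Submission
  imports Defs
begin

text \<open>The polynomial \<open>F\<close> is the cyclotomic polynomial of order \<open>n'\<close>. Let \<open>\<chi>\<close> be the even primitive
  quadratic character with \<open>\<chi>(k) = (n | k)\<close> for odd \<open>k\<close>, of conductor \<open>m = n\<close> or \<open>m = 4n\<close>. The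
  numbers \<open>r\<^sub>j = \<chi>(j) \<zeta>\<^sup>j\<close>, with \<open>\<zeta> = exp(2\<pi>i/m)\<close> and \<open>j\<close> prime to \<open>n'\<close>, are square roots of
  the roots of \<open>F\<close>. Their \<open>k\<close>-th power sum is \<open>g q\<^sub>k\<close> for odd \<open>k\<close> (a Gauss sum, \<open>g\<^sup>2 = n\<close>) and \<open>q\<^sub>k\<close>
  for even \<open>k\<close> (a Ramanujan sum), so by Newton's identities the polynomial with roots \<open>r\<^sub>j\<close> is
  \<open>C(y\<^sup>2) - g y D(y\<^sup>2)\<close>, where \<open>C\<close> and \<open>D\<close> have the coefficients that the algorithm computes. The sign
  of \<open>g\<close> does not matter. Multiplying with the same polynomial in \<open>-y\<close> gives \<open>F(y\<^sup>2)\<close>. The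
  coefficients are integers because they are rational and lie in \<open>\<int>[\<zeta>]\<close> up to the factor \<open>g\<close>, and
  \<open>C\<close>, \<open>D\<close> are unique because the roots of \<open>F\<close> are conjugate.\<close>

section \<open>Evaluation of integer polynomials\<close>

text \<open>The main obstacle is that \<open>(n | k)\<close> must be seen to be a character in
  \<open>k\<close>, which is quadratic reciprocity. A character is therefore built with the right
  conductor, parity and primitivity, and Frobenius applied to its Gauss sum forces its values at
  primes. Evenness gives g^2 the positive sign. For conductor \<open>4 * n\<close> the indices run
  only through the totatives of \<open>2 * n\<close>; the sign change of the character under
  \<open>k + 2 * n\<close> compensates, at the price of halving the Gauss sum. Arithmetic in
  Z[\<zeta>] enters three times: in this congruence, in the integrality of the coefficients and in
  the conjugacy of the roots of F. The ring is never constructed: its elements are values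
  \<open>ev w z\<close> of integer polynomials, and \<open>root_of_unity_int_dvd\<close> is the one
  integrality principle. Replacing g by -g exchanges the factors C(y^2) - g y D(y^2) and C(y^2) + g
  y D(y^2) of F(y^2), so the sign of the Gauss sum can stay open. Steps 4 and 5 of the algorithm
  reflect that these factors are palindromic. Uniqueness is part of the task because
  \<open>aur_C\<close> and \<open>aur_D\<close> are given by definite descriptions.\<close>

definition ev :: "int poly \<Rightarrow> complex \<Rightarrow> complex" where
  "ev w z = poly (map_poly of_int w) z"

lemma ev_pCons [simp]: "ev (pCons a p) z = of_int a + z * ev p z"
  by (simp add: ev_def map_poly_pCons)

lemma ev_0 [simp]: "ev 0 z = 0" by (simp add: ev_def)

lemma ev_1 [simp]: "ev 1 z = 1" by (simp add: one_pCons)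

lemma ev_add [simp]: "ev (p + q) z = ev p z + ev q z"
  by (induction p q rule: poly_induct2) (auto simp: algebra_simps)

lemma ev_minus [simp]: "ev (- p) z = - ev p z"
  by (induction p) auto

lemma ev_diff [simp]: "ev (p - q) z = ev p z - ev q z"
  using ev_add[of p "- q" z] by simp

lemma ev_smult [simp]: "ev (Polynomial.smult c p) z = of_int c * ev p z"
  by (induction p) (auto simp: algebra_simps)

lemma ev_mult [simp]: "ev (p * q) z = ev p z * ev q z"
  by (induction p) (auto simp: algebra_simps)

lemma ev_power [simp]: "ev (p ^ k) z = ev p z ^ k"
  by (induction k) auto

lemma ev_monom [simp]: "ev (Polynomial.monom c k) z = of_int c * z ^ k"
  by (simp add: ev_def map_poly_monom poly_monom)

lemma ev_sum [simp]: "ev (\<Sum>i\<in>A. p i) z = (\<Sum>i\<in>A. ev (p i) z)"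
  by (induction A rule: infinite_finite_induct) auto

lemma ev_pcompose [simp]: "ev (pcompose p q) z = ev p (ev q z)"
  by (induction p) (auto simp: pcompose_pCons)

lemma map_poly_of_int_inj:
  "map_poly (of_int :: int \<Rightarrow> complex) p = map_poly of_int q \<Longrightarrow> p = q"
  by (rule poly_eqI) (metis coeff_map_poly of_int_0 of_int_eq_iff)

lemma ev_zero_finite:
  assumes "w \<noteq> 0"
  shows "finite {z. ev w z = 0}" "card {z. ev w z = 0} \<le> degree w"
proof -
  have nz: "map_poly (of_int :: int \<Rightarrow> complex) w \<noteq> 0"
    using map_poly_of_int_inj[of w 0] assms by auto
  have dg: "degree (map_poly (of_int :: int \<Rightarrow> complex) w) = degree w"
    by (rule degree_map_poly) auto
  show "finite {z. ev w z = 0}" "card {z. ev w z = 0} \<le> degree w"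
    using poly_roots_finite[OF nz] card_poly_roots_bound[OF nz] by (auto simp: ev_def dg)
qed

section \<open>Frobenius\<close>

lemma freshmans_dream:
  fixes a b :: "'a :: comm_ring_1"
  assumes "prime p"
  shows "of_nat p dvd (a + b) ^ p - a ^ p - b ^ p"
proof -
  have p: "p > 0" using assms prime_gt_0_nat by auto
  have "(a + b) ^ p = (\<Sum>k\<le>p. of_nat (p choose k) * a ^ k * b ^ (p - k))"
    by (rule binomial_ring)
  also have "{..p} = insert 0 (insert p {0<..<p})" using p by auto
  also have "(\<Sum>k\<in>\<dots>. of_nat (p choose k) * a ^ k * b ^ (p - k)) =
     b ^ p + a ^ p + (\<Sum>k\<in>{0<..<p}. of_nat (p choose k) * a ^ k * b ^ (p - k))"
    using p by simp
  finally have eq: "(a + b) ^ p - a ^ p - b ^ p =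
      (\<Sum>k\<in>{0<..<p}. of_nat (p choose k) * a ^ k * b ^ (p - k))"
    by (simp add: algebra_simps)
  have "of_nat p dvd (of_nat (p choose k) :: 'a)" if "k \<in> {0<..<p}" for k
  proof -
    have "p dvd (p choose k)"
      by (rule dvd_choose_prime) (use that assms in auto)
    then show ?thesis by (auto elim!: dvdE)
  qed
  then show ?thesis
    unfolding eq by (intro dvd_sum) (auto intro: dvd_mult2)
qed

lemma int_fermat_dvd:
  assumes "prime p"
  shows "int p dvd a ^ p - a"
proof (cases "int p dvd a")
  case True
  then show ?thesis using assms
    by (metis dvd_diff dvd_power dvd_trans prime_gt_0_nat)
next
  case False
  \<comment> \<open>Fermat's theorem is about natural numbers, so \<open>a\<close> is replaced by
    its residue.\<close>
  define b where "b = nat (a mod int p)"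
  have p0: "p > 0" using assms prime_gt_0_nat by auto
  have ab: "[a = int b] (mod int p)" using p0 by (simp add: b_def cong_def)
  have "\<not> p dvd b" using False ab
    by (metis cong_dvd_iff int_dvd_int_iff)
  then have "[b ^ (p - 1) = 1] (mod p)" using fermat_theorem assms by blast
  then have "[b ^ (p - 1) * b = 1 * b] (mod p)" by (rule cong_mult) simp
  then have "[b ^ p = b] (mod p)" using power_minus_mult[OF p0, of b] by simp
  then have "[int b ^ p = int b] (mod int p)"
    by (metis cong_int_iff of_nat_power)
  moreover have "[a ^ p = int b ^ p] (mod int p)" using ab by (rule cong_pow)
  ultimately have "[a ^ p = a] (mod int p)" using ab by (metis cong_sym cong_trans)
  then show ?thesis by (simp add: cong_iff_dvd_diff)
qed

text \<open>Coefficient by coefficient: the binomial theorem splits the power of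
  \<open>a + x * f\<close>, Fermat's little theorem treats the constant, and \<open>x\<close> passes
  through composition with \<open>x ^ p\<close>.\<close>

lemma poly_frobenius:
  fixes f :: "int poly"
  assumes p: "prime p"
  shows "of_nat p dvd f ^ p - pcompose f (Polynomial.monom 1 p)"
proof (induction f)
  case 0
  then show ?case using p prime_gt_0_nat[OF p] by (simp add: zero_power)
next
  case (pCons a f)
  have eq: "pCons a f = [:a:] + Polynomial.monom 1 1 * f"
    by (simp add: monom_altdef)
  have 1: "of_nat p dvd (pCons a f) ^ p - [:a:] ^ p - (Polynomial.monom 1 1 * f) ^ p"
    unfolding eq by (rule freshmans_dream[OF p])
  obtain k where k: "a ^ p - a = int p * k" using int_fermat_dvd[OF p, of a] by (auto elim: dvdE)
  have "[:a:] ^ p - [:a:] = of_nat p * [:k:]"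
    using k by (simp add: poly_const_pow of_nat_poly)
  then have 2: "of_nat p dvd [:a:] ^ p - [:a:]" by (metis dvd_triv_left)
  have "(Polynomial.monom 1 1 * f) ^ p - Polynomial.monom 1 p * pcompose f (Polynomial.monom 1 p)
      = Polynomial.monom (1::int) p * (f ^ p - pcompose f (Polynomial.monom 1 p))"
    by (simp add: power_mult_distrib monom_power algebra_simps)
  then have 3: "of_nat p dvd (Polynomial.monom 1 1 * f) ^ p - Polynomial.monom 1 p * pcompose f (Polynomial.monom 1 p)"
    using pCons by simp
  have "(pCons a f) ^ p - pcompose (pCons a f) (Polynomial.monom 1 p) =
     ((pCons a f) ^ p - [:a:] ^ p - (Polynomial.monom 1 1 * f) ^ p) + ([:a:] ^ p - [:a:])
      + ((Polynomial.monom 1 1 * f) ^ p - Polynomial.monom 1 p * pcompose f (Polynomial.monom 1 p))"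
    by (simp add: pcompose_pCons)
  then show ?case using 1 2 3 by (simp only: dvd_add)
qed

text \<open>The congruence holds between polynomials, so one cofactor \<open>h\<close> serves every
  point \<open>z\<close>.\<close>

lemma ev_frobenius:
  assumes "prime p"
  obtains h where "\<And>z. ev f z ^ p - ev f (z ^ p) = of_nat p * ev h z"
proof -
  obtain h where h: "f ^ p - pcompose f (Polynomial.monom 1 p) = of_nat p * h"
    using poly_frobenius[OF assms, of f] by (auto elim: dvdE)
  have "ev f z ^ p - ev f (z ^ p) = of_nat p * ev h z" for z
    using arg_cong[OF h, of "\<lambda>w. ev w z"] by (simp add: of_nat_poly)
  then show ?thesis using that by blast
qed

section \<open>Minimal polynomials of roots of unity\<close>

text \<open>A primitive integer polynomial of minimal degree vanishing at \<open>z\<close> plays the role of the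
  minimal polynomial; Gauss's lemma is what makes it divide over the integers.\<close>

lemma min_poly_root_of_unity:
  assumes z: "z ^ N = 1" and N: "N > 0"
  shows "\<exists>f. ev f z = 0 \<and> f \<noteq> 0 \<and> (\<forall>w. ev w z = 0 \<longrightarrow> f dvd w) \<and>
    (\<forall>w. \<exists>v. ev v z = ev w z \<and> f dvd w - v \<and> (v = 0 \<or> degree v < degree f)) \<and>
    f dvd Polynomial.monom 1 N - 1"
proof -
  define X :: "int poly" where "X = Polynomial.monom 1 N - 1"
  have X: "ev X z = 0" "X \<noteq> 0"
  proof -
    show "ev X z = 0" using z by (simp add: X_def)
    have "poly X 0 \<noteq> 0" using N by (simp add: X_def poly_monom zero_power)
    then show "X \<noteq> 0" by auto
  qed
  define P where "P = (\<lambda>f::int poly. f \<noteq> 0 \<and> ev f z = 0)"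
  define f0 where "f0 = arg_min degree P"
  have PX: "P X" using X by (simp add: P_def)
  have f0: "P f0" "\<And>w. P w \<Longrightarrow> degree f0 \<le> degree w"
    using arg_min_natI[of P X degree] arg_min_nat_le[of P _ degree] PX by (auto simp: f0_def)
  define f where "f = primitive_part f0"
  have f0nz: "f0 \<noteq> 0" using f0 by (simp add: P_def)
  have cf: "content f = 1" using f0nz by (simp add: f_def)
  have f0f: "f0 = Polynomial.smult (content f0) f" by (simp add: f_def)
  have fz: "ev f z = 0"
  proof -
    have "of_int (content f0) * ev f z = 0" using f0(1) f0f unfolding P_def by (metis ev_smult)
    then show ?thesis using f0nz by simp
  qed
  have fnz: "f \<noteq> 0" using f0nz f0f by auto
  have dmin: "degree f \<le> degree w" if "w \<noteq> 0" "ev w z = 0" for w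
    using f0(2)[of w] that by (simp add: P_def f_def)
  have div: "f dvd w" if w: "ev w z = 0" for w
  proof -
    obtain a q where aq: "a \<noteq> 0" "Polynomial.smult a w = f * q + pseudo_mod w f"
      using pseudo_mod(1)[OF fnz] by blast
    have "ev (pseudo_mod w f) z = 0"
      using arg_cong[OF aq(2), of "\<lambda>u. ev u z"] w fz by simp
    then have r0: "pseudo_mod w f = 0"
      using dmin[of "pseudo_mod w f"] pseudo_mod(2)[OF fnz, of w] by fastforce
    \<comment> \<open>Gauss's lemma: \<open>f\<close> is primitive, so the factor \<open>a\<close>
      left by pseudo-division sits in the content of \<open>q\<close> and cancels.\<close>
    have "content (Polynomial.smult a w) = content q"
      using aq(2) r0 cf by (simp add: content_mult del: content_smult)
    then have "normalize a * content w = content q" by simp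
    then have "a dvd content q" by (metis dvd_triv_left normalize_dvd_iff)
    then obtain q' where q': "q = [:a:] * q'" by (metis const_poly_dvd_iff_dvd_content dvdE)
    have "Polynomial.smult a w = Polynomial.smult a (f * q')" using aq(2) r0 q' by simp
    then have "Polynomial.smult a (w - f * q') = 0" by (simp add: smult_diff_right)
    then have "w = f * q'" using aq(1) by simp
    then show ?thesis by simp
  qed
  have fX: "f dvd X" using div X(1) by blast
  have lc: "lead_coeff f dvd 1"
  proof -
    obtain g where g: "X = f * g" using fX by (auto elim: dvdE)
    have "degree (Polynomial.monom (1::int) N) = N" by (simp add: degree_monom_eq)
    have "lead_coeff X = 1" "degree X = N"
    proof -
      have d: "degree X = N" unfolding X_def
        using N degree_add_eq_left[of "- 1 :: int poly" "Polynomial.monom 1 N"]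
        by (simp add: degree_monom_eq)
      show "degree X = N" by (rule d)
      show "lead_coeff X = 1" unfolding d using N by (simp add: X_def)
    qed
    then show ?thesis using g by (metis dvd_triv_left lead_coeff_mult)
  qed
  have red: "\<exists>v. ev v z = ev w z \<and> f dvd w - v \<and> (v = 0 \<or> degree v < degree f)" for w
  proof -
    have "lead_coeff f * lead_coeff f = 1" using lc by (auto simp: zdvd1_eq abs_if split: if_splits)
    moreover obtain q r where qr: "pseudo_divmod w f = (q, r)" by force
    define c where "c = lead_coeff f ^ (Suc (degree w) - degree f)"
    have pd: "Polynomial.smult c w = f * q + r" "r = 0 \<or> degree r < degree f"
      using pseudo_divmod[OF fnz qr] by (auto simp: c_def)
    \<comment> \<open>As a divisor of a monic polynomial, \<open>f\<close> has leading coefficient 1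
      or -1, so multiplying by \<open>c\<close> once more undoes the scaling.\<close>
    have cc: "c * c = 1" using calculation by (simp add: c_def flip: power_mult_distrib)
    have "w = f * Polynomial.smult c q + Polynomial.smult c r"
      using arg_cong[OF pd(1), of "Polynomial.smult c"] cc by (simp add: smult_add_right)
    moreover have "Polynomial.smult c r = 0 \<or> degree (Polynomial.smult c r) < degree f"
      using pd(2) cc by auto
    ultimately show ?thesis using fz
      by (intro exI[of _ "Polynomial.smult c r"]) (auto simp: algebra_simps intro: dvd_smult)
  qed
  have "\<forall>w. ev w z = 0 \<longrightarrow> f dvd w" using div by blast
  moreover have "\<forall>w. \<exists>v. ev v z = ev w z \<and> f dvd w - v \<and> (v = 0 \<or> degree v < degree f)"
    using red by blast
  ultimately show ?thesis
    using fz fnz fX[unfolded X_def] by (intro exI[of _ f] conjI)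
qed

text \<open>Below the degree of the minimal polynomial an element of Z[z] has only one
  representation, so constant coefficients may be compared. Hence a rational number in Z[z] is an
  integer, and a divisibility between integers that holds in Z[z] holds in Z.\<close>

lemma root_of_unity_int_dvd:
  assumes z: "z ^ N = 1" "N > 0" and eq: "of_int b * ev w z = of_int a"
  shows "b dvd a"
proof -
  obtain f :: "int poly" where f: "ev f z = 0" "f \<noteq> 0"
    "\<forall>w. ev w z = 0 \<longrightarrow> f dvd w"
    "\<forall>w. \<exists>v. ev v z = ev w z \<and> f dvd w - v \<and> (v = 0 \<or> degree v < degree f)"
    "f dvd Polynomial.monom 1 N - 1"
    using min_poly_root_of_unity[OF z] by (elim exE conjE) (rule that)
  obtain v where v: "ev v z = ev w z" "v = 0 \<or> degree v < degree f" using f(4) by blast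
  have "degree f \<noteq> 0"
  proof
    assume "degree f = 0"
    then obtain c where "f = [:c:]" by (metis degree_0_id degree_eq_zeroE)
    then show False using f(1,2) by simp
  qed
  have "ev (Polynomial.smult b v - [:a:]) z = 0" using eq v by simp
  then have d: "f dvd Polynomial.smult b v - [:a:]" using f(3) by blast
  have "degree (Polynomial.smult b v - [:a:]) < degree f"
  proof (rule degree_diff_less)
    show "degree (Polynomial.smult b v) < degree f"
      using v(2) \<open>degree f \<noteq> 0\<close> degree_smult_le[of b v] by auto
    show "degree [:a:] < degree f" using \<open>degree f \<noteq> 0\<close> by simp
  qed
  then have "Polynomial.smult b v - [:a:] = 0" using d
    by (meson dvd_imp_degree_le leD)
  then have "Polynomial.coeff (Polynomial.smult b v) 0 = a" by simp
  then show ?thesis by (metis coeff_smult dvd_triv_left)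
qed

text \<open>Over \<open>x\<^sup>N - 1 = f g\<close>, differentiation at \<open>z\<^sup>p\<close> would make \<open>f(z\<^sup>p)\<close>, which Frobenius shows to be
  divisible by \<open>p\<close>, a divisor of \<open>N\<close>.\<close>

lemma ev_root_prime_power:
  assumes z: "z ^ N = 1" "N > 0" and p: "prime p" "\<not> p dvd N" and B: "ev B z = 0"
  shows "ev B (z ^ p) = 0"
proof -
  obtain f :: "int poly" where f: "ev f z = 0" "f \<noteq> 0"
    "\<forall>w. ev w z = 0 \<longrightarrow> f dvd w"
    "\<forall>w. \<exists>v. ev v z = ev w z \<and> f dvd w - v \<and> (v = 0 \<or> degree v < degree f)"
    "f dvd Polynomial.monom 1 N - 1"
    using min_poly_root_of_unity[OF z] by (elim exE conjE) (rule that)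
  obtain g where g: "Polynomial.monom 1 N - 1 = f * g" using f(5) by (auto elim: dvdE)
  obtain h where h: "\<And>z. ev f z ^ p - ev f (z ^ p) = of_nat p * ev h z"
    using ev_frobenius[OF p(1)] by metis
  define x where "x = z ^ p"
  have "ev f x = 0"
  proof (rule ccontr)
    assume nz: "ev f x \<noteq> 0"
    have "x ^ N = 1" using z by (simp add: x_def flip: power_mult) (simp add: mult.commute power_mult)
    then have "ev f x * ev g x = 0" using arg_cong[OF g, of "\<lambda>w. ev w x"] by simp
    then have g0: "ev g x = 0" using nz by simp
    have "pderiv (Polynomial.monom (1::int) N - 1) = Polynomial.monom (int N) (N - 1)"
      by (simp add: pderiv_diff pderiv_monom)
    then have "ev (Polynomial.monom (int N) (N - 1)) x = ev (pderiv (f * g)) x" using g by simp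
    then have "of_nat N * x ^ (N - 1) = ev f x * ev (pderiv g) x"
      using g0 by (simp add: pderiv_mult)
    then have "(of_nat N * x ^ (N - 1)) * x = (ev f x * ev (pderiv g) x) * x" by (rule arg_cong)
    then have "of_nat N * (x ^ (N - 1) * x) = x * ev f x * ev (pderiv g) x"
      by (simp only: ac_simps)
    moreover have "x ^ (N - 1) * x = 1" using \<open>x ^ N = 1\<close> power_minus_mult[OF z(2), of x] by simp
    ultimately have 1: "of_nat N = x * ev f x * ev (pderiv g) x" by (simp only: mult_1_right)
    have "ev f x = - of_nat p * ev h z"
    proof -
      have "ev f x = ev f z ^ p - of_nat p * ev h z" using h[of z] by (simp add: x_def algebra_simps)
      also have "ev f z ^ p = 0" using f(1) prime_gt_0_nat[OF p(1)] by simp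
      finally show ?thesis by simp
    qed
    \<comment> \<open>With \<open>x = z ^ p\<close> written out, the right-hand side is
      \<open>p\<close> times an element of Z[z].\<close>
    then have "of_int (int p) * ev (- (Polynomial.monom 1 p * h * pcompose (pderiv g) (Polynomial.monom 1 p))) z
      = of_int (int N)"
      using 1 by (simp add: x_def algebra_simps)
    then have "int p dvd int N" by (rule root_of_unity_int_dvd[OF z])
    then show False using p(2) by simp
  qed
  moreover have "f dvd B" using f(3) B by blast
  ultimately show ?thesis by (auto simp: x_def elim!: dvdE)
qed

text \<open>One prime factor of \<open>a\<close> at a time, each applied to the root of unity
  reached so far. This is the irreducibility of cyclotomic polynomials in the form that uniqueness
  will use.\<close>

lemma ev_root_coprime_power:
  assumes z: "z ^ N = 1" "N > 0" and a: "coprime a N" "a > 0" and B: "ev B z = 0"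
  shows "ev B (z ^ a) = 0"
  using a
proof (induction a rule: prime_divisors_induct)
  case (factor p a)
  have p: "prime p" "coprime p N" "coprime a N" "a > 0"
    using factor by (auto simp: coprime_mult_left_iff)
  then have "\<not> p dvd N" by (metis coprime_absorb_left not_prime_unit)
  have za: "(z ^ a) ^ N = 1" using z by (metis mult.commute power_mult power_one)
  have "ev B ((z ^ a) ^ p) = 0"
    by (rule ev_root_prime_power[OF za z(2) p(1) \<open>\<not> p dvd N\<close>]) (use factor p in auto)
  then show ?case by (simp add: mult.commute flip: power_mult)
next
  case (unit a)
  then show ?case using B by simp
qed simp

section \<open>Roots of unity\<close>

definition zeta :: "nat \<Rightarrow> int \<Rightarrow> complex" where
  "zeta m k = cis (2 * pi * of_int k / of_nat m)"

lemma zeta_0 [simp]: "zeta m 0 = 1"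
  by (simp add: zeta_def)

lemma zeta_add: "zeta m (j + k) = zeta m j * zeta m k"
  by (simp add: zeta_def cis_mult algebra_simps add_divide_distrib)

lemma zeta_mult_nat: "zeta m (j * int k) = zeta m j ^ k"
  by (simp add: zeta_def DeMoivre algebra_simps)

lemma zeta_neq_0 [simp]: "zeta m k \<noteq> 0"
  by (simp add: zeta_def)

lemma zeta_cancel: "c > 0 \<Longrightarrow> zeta (m * c) (k * int c) = zeta m k"
  by (simp add: zeta_def field_simps)

lemma zeta_eq_1_iff:
  assumes "m > 0"
  shows "zeta m k = 1 \<longleftrightarrow> int m dvd k"
proof
  assume "zeta m k = 1"
  then have "cos (2 * pi * of_int k / of_nat m) = 1" by (simp add: zeta_def complex_eq_iff)
  then obtain i :: int where "2 * pi * of_int k / of_nat m = of_int i * (2 * pi)"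
    using cos_one_2pi_int by auto
  then have "real_of_int k = of_int (i * int m)" using assms by (simp add: field_simps)
  then have "k = i * int m" by (simp only: of_int_eq_iff)
  then show "int m dvd k" by simp
next
  assume "int m dvd k"
  then obtain i where i: "k = int m * i" by (auto elim: dvdE)
  have "2 * pi * of_int k / of_nat m = 2 * pi * of_int i" using assms i by simp
  then show "zeta m k = 1" by (simp add: zeta_def cis_multiple_2pi)
qed

lemma zeta_eq_iff:
  assumes "m > 0"
  shows "zeta m j = zeta m k \<longleftrightarrow> [j = k] (mod int m)"
proof -
  have "zeta m j = zeta m k * zeta m (j - k)" by (simp flip: zeta_add)
  then have "zeta m j = zeta m k \<longleftrightarrow> zeta m (j - k) = 1" by simp
  then show ?thesis using zeta_eq_1_iff[OF assms] by (simp add: cong_iff_dvd_diff)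
qed

lemma zeta_cong: "[j = k] (mod int m) \<Longrightarrow> zeta m j = zeta m k"
  by (cases "m = 0") (auto simp: zeta_eq_iff cong_def)

text \<open>An injective map of a finite set of residues into itself is a permutation, so
  cancellation modulo \<open>m\<close> is all that translations and multiplication by units have to
  supply.\<close>

lemma sum_residues_reindex:
  fixes f :: "int \<Rightarrow> 'a :: comm_monoid_add" and m :: nat
  assumes m: "m > 0" and f: "\<And>i j. [i = j] (mod int m) \<Longrightarrow> f i = f j"
    and h: "\<And>i j. [h i = h j] (mod int m) \<Longrightarrow> [i = j] (mod int m)"
  shows "(\<Sum>j\<in>{0..<int m}. f (h j)) = (\<Sum>j\<in>{0..<int m}. f j)"
proof -
  let ?g = "\<lambda>j. h j mod int m"
  have "inj_on ?g {0..<int m}"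
  proof (rule inj_onI)
    fix i j assume ij: "i \<in> {0..<int m}" "j \<in> {0..<int m}" "?g i = ?g j"
    have "[i = j] (mod int m)" by (rule h) (use ij(3) in \<open>simp add: cong_def\<close>)
    then show "i = j" using cong_less_imp_eq_int ij(1,2) by auto
  qed
  moreover have "?g ` {0..<int m} \<subseteq> {0..<int m}" using m by auto
  ultimately have "bij_betw ?g {0..<int m} {0..<int m}"
    by (simp add: bij_betw_def endo_inj_surj)
  then have "(\<Sum>j\<in>{0..<int m}. f (?g j)) = (\<Sum>j\<in>{0..<int m}. f j)"
    by (rule sum.reindex_bij_betw)
  moreover have "f (?g j) = f (h j)" for j by (rule f) (simp add: cong_def)
  ultimately show ?thesis by simp
qed

lemma sum_zeta:
  assumes "m > 0"
  shows "(\<Sum>j\<in>{0..<int m}. zeta m (j * k)) = (if int m dvd k then of_nat m else 0)"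
proof (cases "int m dvd k")
  case True
  then have "zeta m (j * k) = 1" for j using zeta_eq_1_iff[OF assms] by simp
  then show ?thesis using True by simp
next
  case False
  \<comment> \<open>The shift permutes the residues, yet multiplies the sum by
    \<open>zeta m k\<close>, which is not 1.\<close>
  have "(\<Sum>j\<in>{0..<int m}. zeta m ((j + 1) * k)) = (\<Sum>j\<in>{0..<int m}. zeta m (j * k))"
    by (rule sum_residues_reindex[OF assms, of "\<lambda>j. zeta m (j * k)" "\<lambda>j. j + 1"])
      (auto intro!: zeta_cong cong_scalar_right simp: cong_add_rcancel)
  moreover have "(\<Sum>j\<in>{0..<int m}. zeta m ((j + 1) * k)) = (\<Sum>j\<in>{0..<int m}. zeta m (j * k)) * zeta m k"
    by (simp add: distrib_right zeta_add sum_distrib_right)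
  ultimately have "(\<Sum>j\<in>{0..<int m}. zeta m (j * k)) * (zeta m k - 1) = 0"
    by (simp add: algebra_simps)
  then show ?thesis using False zeta_eq_1_iff[OF assms] by simp
qed

section \<open>Primitive quadratic characters\<close>

text \<open>The last assumption is primitivity. In this form it is inherited by products with coprime
  moduli and directly makes the Gauss sum vanish at non-units.\<close>

locale prim_char =
  fixes m :: nat and \<chi> :: "int \<Rightarrow> int"
  assumes m_pos: "m > 0"
    and cong: "[j = k] (mod int m) \<Longrightarrow> \<chi> j = \<chi> k"
    and mult: "\<chi> (j * k) = \<chi> j * \<chi> k"
    and unit: "coprime k (int m) \<Longrightarrow> \<chi> k = 1 \<or> \<chi> k = - 1"
    and non_unit: "\<not> coprime k (int m) \<Longrightarrow> \<chi> k = 0"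
    and primitive: "\<not> coprime k (int m) \<Longrightarrow> \<exists>a. \<chi> a = - 1 \<and> [a * k = k] (mod int m)"
begin

definition gauss_sum :: "int \<Rightarrow> complex" where
  "gauss_sum k = (\<Sum>j\<in>{0..<int m}. of_int (\<chi> j) * zeta m (j * k))"

lemma chi_1 [simp]: "\<chi> 1 = 1"
  using unit[of 1] mult[of 1 1] by auto

lemma sq_unit: "coprime k (int m) \<Longrightarrow> \<chi> k * \<chi> k = 1"
  using unit[of k] by auto

lemma chi_uminus: "\<chi> (- k) = \<chi> (- 1) * \<chi> k"
  using mult[of "- 1" k] by simp

lemma gauss_sum_mult:
  assumes "coprime a (int m)"
  shows "gauss_sum k = of_int (\<chi> a) * gauss_sum (a * k)"
proof -
  have "(\<Sum>j\<in>{0..<int m}. of_int (\<chi> (a * j)) * zeta m (a * j * k)) = gauss_sum k"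
    unfolding gauss_sum_def
  proof (rule sum_residues_reindex[OF m_pos])
    fix i j assume ij: "[i = j] (mod int m)"
    then show "of_int (\<chi> i) * zeta m (i * k) = of_int (\<chi> j) * zeta m (j * k)"
      using cong[OF ij] zeta_cong[OF cong_scalar_right[OF ij, of k]] by simp
  next
    fix i j assume "[a * i = a * j] (mod int m)"
    then show "[i = j] (mod int m)" using assms by (simp add: cong_mult_lcancel)
  qed
  then show ?thesis
    by (simp add: gauss_sum_def mult sum_distrib_left mult_ac)
qed

text \<open>For a unit, substitute in the sum. For a non-unit, some \<open>a\<close> with \<chi>(a)
  = -1 fixes \<open>k\<close> modulo \<open>m\<close>, so the sum equals its own negative.\<close>

lemma gauss_sum_eq: "gauss_sum k = of_int (\<chi> k) * gauss_sum 1"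
proof (cases "coprime k (int m)")
  case True
  have "of_int (\<chi> k) * gauss_sum 1 = of_int (\<chi> k * \<chi> k) * gauss_sum k"
    using gauss_sum_mult[OF True, of 1] by simp
  then show ?thesis using sq_unit[OF True] by simp
next
  case False
  then obtain a where a: "\<chi> a = - 1" "[a * k = k] (mod int m)" using primitive by blast
  have "coprime a (int m)" using a(1) non_unit[of a] by fastforce
  then have "gauss_sum k = - gauss_sum (a * k)" using gauss_sum_mult[of a k] a by simp
  also have "gauss_sum (a * k) = gauss_sum k"
    unfolding gauss_sum_def
    using zeta_cong[OF cong_scalar_left[OF a(2)]] by simp
  finally show ?thesis using non_unit[OF False] by simp
qed

text \<open>The sum of all squares \<open>gauss_sum k ^ 2\<close> is computed twice: by
  \<open>gauss_sum_eq\<close> it is the number of units times the square wanted, and by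
  orthogonality only index pairs with \<open>j + i\<close> divisible by \<open>m\<close>
  survive.\<close>

lemma gauss_sum_sq: "gauss_sum 1 ^ 2 = of_int (\<chi> (- 1) * int m)"
proof -
  define S where "S = (\<Sum>j\<in>{0..<int m}. \<chi> j * \<chi> j)"
  have "S = (\<Sum>j\<in>{0..<int m}. if coprime j (int m) then 1 else 0)"
    unfolding S_def by (rule sum.cong) (auto simp: sq_unit non_unit)
  also have "\<dots> \<noteq> 0"
  proof -
    \<comment> \<open>For \<open>m = 1\<close> the unit residue is 0, hence not simply 1.\<close>
    have "1 mod int m \<in> {j\<in>{0..<int m}. coprime j (int m)}"
      using m_pos by (auto simp: coprime_mod_left_iff)
    then have "{j\<in>{0..<int m}. coprime j (int m)} \<noteq> {}" by blast
    then show ?thesis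
      by (auto simp: sum.If_cases Int_def card_eq_0_iff intro: finite_subset[of _ "{0..<int m}"])
  qed
  finally have S: "S \<noteq> 0" .
  have inner: "(\<Sum>i\<in>{0..<int m}. of_int (\<chi> i) * (if int m dvd j + i then of_nat m else 0))
      = (of_int (\<chi> (- 1) * \<chi> j * int m) :: complex)" for j
  proof -
    \<comment> \<open>Shifting by \<open>j\<close> moves the only surviving term from
      \<open>- j\<close> to 0.\<close>
    have "(\<Sum>i\<in>{0..<int m}. of_int (\<chi> (i - j)) * (if int m dvd j + (i - j) then of_nat m else 0))
      = (\<Sum>i\<in>{0..<int m}. of_int (\<chi> i) * (if int m dvd j + i then of_nat m else (0::complex)))"
    proof (rule sum_residues_reindex[OF m_pos])
      fix a b assume ab: "[a = b] (mod int m)"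
      then have "int m dvd j + a \<longleftrightarrow> int m dvd j + b"
        by (metis cong_add_lcancel cong_dvd_iff)
      then show "of_int (\<chi> a) * (if int m dvd j + a then of_nat m else (0::complex)) =
         of_int (\<chi> b) * (if int m dvd j + b then of_nat m else 0)"
        using cong[OF ab] by simp
    next
      fix a b assume "[a - j = b - j] (mod int m)"
      then show "[a = b] (mod int m)" by (simp add: cong_iff_dvd_diff)
    qed
    also have "(\<Sum>i\<in>{0..<int m}. of_int (\<chi> (i - j)) * (if int m dvd j + (i - j) then of_nat m else 0))
       = (\<Sum>i\<in>{0..<int m}. if i = 0 then of_int (\<chi> (- j)) * of_nat m else (0::complex))"
    proof (rule sum.cong)
      fix i assume "i \<in> {0..<int m}"
      then have "int m dvd i \<longleftrightarrow> i = 0" using zdvd_not_zless[of i "int m"] by (cases "i = 0") auto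
      then show "of_int (\<chi> (i - j)) * (if int m dvd j + (i - j) then of_nat m else 0) =
         (if i = 0 then of_int (\<chi> (- j)) * of_nat m else (0::complex))" by simp
    qed simp
    finally show ?thesis using m_pos by (simp add: chi_uminus[of j])
  qed
  have "of_int S * gauss_sum 1 ^ 2 = (\<Sum>k\<in>{0..<int m}. gauss_sum k * gauss_sum k)"
  proof -
    have "gauss_sum k * gauss_sum k = of_int (\<chi> k * \<chi> k) * gauss_sum 1 ^ 2" for k
      unfolding gauss_sum_eq[of k] by (simp add: power2_eq_square)
    then show ?thesis by (simp add: S_def sum_distrib_right)
  qed
  also have "\<dots> = (\<Sum>k\<in>{0..<int m}. \<Sum>j\<in>{0..<int m}. \<Sum>i\<in>{0..<int m}.
      of_int (\<chi> j) * (of_int (\<chi> i) * zeta m (k * (j + i))))"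
    unfolding gauss_sum_def sum_product
    by (simp add: zeta_add distrib_left mult_ac)
  also have "\<dots> = (\<Sum>j\<in>{0..<int m}. \<Sum>i\<in>{0..<int m}. \<Sum>k\<in>{0..<int m}.
      of_int (\<chi> j) * (of_int (\<chi> i) * zeta m (k * (j + i))))"
    by (subst sum.swap, rule sum.cong[OF refl], rule sum.swap)
  also have "\<dots> = (\<Sum>j\<in>{0..<int m}. of_int (\<chi> j) * (\<Sum>i\<in>{0..<int m}.
      of_int (\<chi> i) * (if int m dvd j + i then of_nat m else 0)))"
    by (simp add: sum_zeta[OF m_pos] flip: sum_distrib_left)
  also have "\<dots> = of_int S * of_int (\<chi> (- 1) * int m)"
    by (simp add: inner S_def sum_distrib_left sum_distrib_right mult_ac)
  finally have "of_int S * gauss_sum 1 ^ 2 = of_int S * of_int (\<chi> (- 1) * int m)" .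
  note eq = this
  have "(of_int S :: complex) \<noteq> 0" using S by simp
  from iffD1[OF mult_left_cancel[OF this] eq] show ?thesis .
qed

text \<open>Euler's evaluation of \<open>g\<^sup>q\<^sup>+\<^sup>1\<close> modulo \<open>q\<close> for the Gauss sum \<open>g\<close>, which is quadratic
  reciprocity for all these characters at once.\<close>

lemma chi_prime:
  assumes q: "prime q" "odd q" "\<not> q dvd m"
  shows "\<chi> (int q) = Legendre (\<chi> (- 1) * int m) (int q)"
proof -
  define M where "M = \<chi> (- 1) * int m"
  define z where "z = zeta m 1"
  \<comment> \<open>The Gauss sum as an integer polynomial: its value at \<open>z ^ k\<close> is
    \<open>gauss_sum k\<close>, so Frobenius applies.\<close>
  define w where "w = (\<Sum>j\<in>{0..<int m}. Polynomial.monom (\<chi> j) (nat j))"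
  have zm: "z ^ m = 1"
  proof -
    have "zeta m 1 ^ m = zeta m (int m)" using zeta_mult_nat[of m 1 m] by simp
    also have "\<dots> = 1" by (subst zeta_eq_1_iff[OF m_pos]) simp
    finally show ?thesis by (simp add: z_def)
  qed
  have evw: "ev w (z ^ k) = gauss_sum (int k)" for k
    unfolding w_def gauss_sum_def ev_sum
  proof (rule sum.cong)
    fix j assume "j \<in> {0..<int m}"
    then have "zeta m (j * int k) = zeta m (1 * int (k * nat j))" by (simp add: mult.commute)
    also have "\<dots> = (z ^ k) ^ nat j" by (simp only: zeta_mult_nat z_def power_mult)
    finally show "ev (Polynomial.monom (\<chi> j) (nat j)) (z ^ k) = of_int (\<chi> j) * zeta m (j * int k)"
      by simp
  qed simp
  obtain h where h: "\<And>z. ev w z ^ q - ev w (z ^ q) = of_nat q * ev h z"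
    using ev_frobenius[OF q(1)] by metis
  have q2: "q > 2" using q prime_ge_2_nat[of q] by (cases "q = 2") auto
  define r where "r = (q - 1) div 2"
  have qr: "q + 1 = 2 * (r + 1)" using q(2) by (auto simp: r_def elim!: oddE)
  have g: "ev w z = gauss_sum 1" using evw[of 1] by simp
  \<comment> \<open>The extra factor \<open>ev w z\<close> makes the exponent \<open>q + 1\<close>
    even, so that only the integer \<open>M\<close>, the square of the Gauss sum, remains.\<close>
  have "of_int (int q) * ev (h * w) z = (ev w z ^ q - ev w (z ^ q)) * ev w z"
    using h[of z] by simp
  also have "\<dots> = gauss_sum 1 ^ (q + 1) - of_int (\<chi> (int q)) * gauss_sum 1 ^ 2"

  proof -
    have eq: "(a - c * b) * b = a * b - c * b ^ 2" for a b c :: complex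
      by (simp add: algebra_simps power2_eq_square)
    show ?thesis unfolding evw g gauss_sum_eq[of "int q"] eq by simp
  qed
  also have "gauss_sum 1 ^ (q + 1) = (gauss_sum 1 ^ 2) ^ (r + 1)"
    by (simp only: qr power_mult)
  also have "\<dots> - of_int (\<chi> (int q)) * gauss_sum 1 ^ 2 = of_int (M * (M ^ r - \<chi> (int q)))"
    unfolding gauss_sum_sq by (simp add: M_def algebra_simps)
  finally have "int q dvd M * (M ^ r - \<chi> (int q))"
    by (rule root_of_unity_int_dvd[OF zm m_pos])
  moreover have "coprime (int q) M"
  proof -
    have "\<not> int q dvd M" using q(3) unit[of "- 1"] by (auto simp: M_def)
    then show ?thesis using q(1) prime_imp_coprime[of "int q" M] by simp
  qed
  ultimately have "int q dvd M ^ r - \<chi> (int q)" by (simp add: coprime_dvd_mult_right_iff)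
  moreover have "[Legendre M (int q) = M ^ r] (mod int q)"
    using euler_criterion[OF q(1) q2, of M] by (simp add: r_def)
  ultimately have "int q dvd Legendre M (int q) - \<chi> (int q)"
    by (metis cong_iff_dvd_diff cong_trans)
  \<comment> \<open>Both values are at most 1 in absolute value and \<open>q > 2\<close>, so
    congruence modulo \<open>q\<close> is equality.\<close>
  moreover have "\<bar>Legendre M (int q) - \<chi> (int q)\<bar> < int q"
  proof -
    have "coprime (int q) (int m)" using q(1,3) by (simp add: prime_imp_coprime)
    then have "\<bar>\<chi> (int q)\<bar> \<le> 1" using unit[of "int q"] by auto
    moreover have "\<bar>Legendre M (int q)\<bar> \<le> 1" by (simp add: Legendre_def)
    ultimately show ?thesis using q2 by linarith
  qed
  ultimately have "Legendre M (int q) - \<chi> (int q) = 0"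
    using dvd_imp_le_int[of "Legendre M (int q) - \<chi> (int q)" "int q"] by (cases "Legendre M (int q) = \<chi> (int q)") auto
  then show ?thesis by (simp add: M_def)
qed

end

section \<open>Legendre symbols as primitive characters\<close>

lemma Legendre_cong: "[a = b] (mod p) \<Longrightarrow> Legendre a p = Legendre b p"
  by (simp add: Legendre_def QuadRes_def cong_def)

text \<open>Elements of \<open>{- 1, 0, 1}\<close> differ by at most 2, so for \<open>p > 2\<close>
  Euler's criterion determines the symbol.\<close>

lemma Legendre_eqI:
  assumes "prime p" "p > 2" "[Legendre a (int p) = b] (mod int p)" "b \<in> {- 1, 0, 1}"
  shows "Legendre a (int p) = b"
proof -
  have "int p dvd Legendre a (int p) - b" using assms by (simp add: cong_iff_dvd_diff)
  moreover have "\<bar>Legendre a (int p) - b\<bar> < int p"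
  proof -
    have "\<bar>Legendre a (int p)\<bar> \<le> 1" by (simp add: Legendre_def)
    moreover have "\<bar>b\<bar> \<le> 1" using assms(4) by auto
    ultimately show ?thesis using assms(2) by linarith
  qed
  ultimately have "Legendre a (int p) - b = 0"
    using dvd_imp_le_int[of "Legendre a (int p) - b" "int p"] by (cases "Legendre a (int p) = b") auto
  then show ?thesis by simp
qed

lemma Legendre_mult:
  assumes p: "prime p" "p > 2"
  shows "Legendre (a * b) (int p) = Legendre a (int p) * Legendre b (int p)"
proof (rule Legendre_eqI[OF p])
  let ?r = "(p - 1) div 2"
  have "[Legendre (a * b) (int p) = (a * b) ^ ?r] (mod int p)" by (rule euler_criterion[OF p])
  moreover have "[Legendre a (int p) * Legendre b (int p) = a ^ ?r * b ^ ?r] (mod int p)"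
    by (intro cong_mult euler_criterion p)
  ultimately show "[Legendre (a * b) (int p) = Legendre a (int p) * Legendre b (int p)] (mod int p)"
    by (simp add: power_mult_distrib cong_def)
qed (auto simp: Legendre_def)

lemma Legendre_minus_1:
  assumes p: "prime p" "p > 2"
  shows "Legendre (- 1) (int p) = (if p mod 4 = 1 then 1 else - 1)"
proof (rule Legendre_eqI[OF p])
  have "odd p" using p by (metis prime_odd_nat)
  then have "(p - 1) div 2 mod 2 = (if p mod 4 = 1 then 0 else 1)" by presburger
  then have "even ((p - 1) div 2) \<longleftrightarrow> p mod 4 = 1" by (auto split: if_splits)
  then have "(- 1 :: int) ^ ((p - 1) div 2) = (if p mod 4 = 1 then 1 else - 1)" by simp
  then show "[Legendre (- 1) (int p) = (if p mod 4 = 1 then 1 else - 1)] (mod int p)"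
    using euler_criterion[OF p, of "- 1"] by simp
qed auto

text \<open>If every residue were a square, squaring would be surjective and hence injective on
  residues; but 1 and \<open>p - 1\<close> have the same square.\<close>

lemma ex_nonresidue:
  assumes p: "prime p" "p > 2"
  shows "\<exists>a. Legendre a (int p) = - 1"
proof (rule ccontr)
  assume no: "\<not> ?thesis"
  have QR: "QuadRes (int p) a" for a
  proof (cases "[a = 0] (mod int p)")
    case True
    then show ?thesis unfolding QuadRes_def by (intro exI[of _ 0]) (simp add: cong_sym_eq)
  next
    case False
    then show ?thesis using no by (auto simp: Legendre_def split: if_splits)
  qed
  let ?A = "{0..<int p}" and ?s = "\<lambda>y. y\<^sup>2 mod int p"
  have "?A \<subseteq> ?s ` ?A"
  proof
    fix a assume a: "a \<in> ?A"
    obtain y where "[y\<^sup>2 = a] (mod int p)" using QR[of a] unfolding QuadRes_def by blast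
    then have "(y mod int p)\<^sup>2 mod int p = a" using a by (simp add: cong_def power_mod)
    moreover have "y mod int p \<in> ?A" using p by auto
    ultimately show "a \<in> ?s ` ?A" by (metis image_eqI)
  qed
  then have "inj_on ?s ?A" by (rule finite_surj_inj[rotated]) simp
  moreover have "?s 1 = ?s (int p - 1)"
  proof -
    have "(int p - 1)\<^sup>2 = 1 + int p * (int p - 2)" by (simp add: power2_eq_square algebra_simps)
    then have "(int p - 1)\<^sup>2 mod int p = 1 mod int p" by (metis mod_mult_self2)
    then show ?thesis by simp
  qed
  ultimately have "1 = int p - 1" by (rule inj_onD) (use p in auto)
  then show False using p by simp
qed

lemma coprime_prime_iff:
  assumes "prime p"
  shows "coprime k (int p) \<longleftrightarrow> \<not> int p dvd k"
proof
  assume "coprime k (int p)"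
  then show "\<not> int p dvd k"
    using assms coprime_absorb_right[of "int p" k] by auto
next
  assume "\<not> int p dvd k"
  then have "coprime (int p) k" using assms by (intro prime_imp_coprime) auto
  then show "coprime k (int p)" by (simp add: coprime_commute)
qed

lemma prim_char_Legendre:
  assumes p: "prime p" "p > 2"
  shows "prim_char p (\<lambda>a. Legendre a (int p))"
proof
  have cop: "coprime k (int p) \<longleftrightarrow> \<not> [k = 0] (mod int p)" for k
    using coprime_prime_iff[OF p(1)] by (simp add: cong_0_iff)
  show "p > 0" using p by simp
  show "Legendre j (int p) = Legendre k (int p)" if "[j = k] (mod int p)" for j k
    using that by (rule Legendre_cong)
  show "Legendre (j * k) (int p) = Legendre j (int p) * Legendre k (int p)" for j k
    by (rule Legendre_mult[OF p])
  show "Legendre k (int p) = 1 \<or> Legendre k (int p) = - 1" if "coprime k (int p)" for k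
    using that by (auto simp: cop Legendre_def)
  show "Legendre k (int p) = 0" if "\<not> coprime k (int p)" for k
    using that by (auto simp: cop Legendre_def)
  \<comment> \<open>A non-unit is 0 modulo \<open>p\<close> and is fixed by any non-residue.\<close>
  show "\<exists>a. Legendre a (int p) = - 1 \<and> [a * k = k] (mod int p)" if "\<not> coprime k (int p)" for k
  proof -
    obtain a where "Legendre a (int p) = - 1" using ex_nonresidue[OF p] by blast
    moreover have "[a * k = k] (mod int p)"
      using that by (auto simp: cop cong_0_iff cong_iff_dvd_diff)
    ultimately show ?thesis by blast
  qed
qed

section \<open>Products of primitive characters with coprime moduli\<close>

lemma prim_char_1: "prim_char 1 (\<lambda>_. 1)"
  by unfold_locales auto

text \<open>The Chinese remainder theorem combines the witness for \<open>m1\<close> with 1 modulo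
  \<open>m2\<close>, which leaves the second character and the second residue unchanged.\<close>

lemma prim_char_mult_primitive:
  assumes "prim_char m1 \<chi>1" "prim_char m2 \<chi>2" and cop: "coprime (int m1) (int m2)"
    and k: "\<not> coprime k (int m1)"
  shows "\<exists>a. \<chi>1 a * \<chi>2 a = - 1 \<and> [a * k = k] (mod int m1 * int m2)"
proof -
  interpret c1: prim_char m1 \<chi>1 by fact
  interpret c2: prim_char m2 \<chi>2 by fact
  obtain a where a: "\<chi>1 a = - 1" "[a * k = k] (mod int m1)" using c1.primitive[OF k] by blast
  obtain b where b: "[b = a] (mod int m1)" "[b = 1] (mod int m2)"
    using binary_chinese_remainder_int[OF cop] by blast
  have "\<chi>1 b * \<chi>2 b = - 1" using a(1) c1.cong[OF b(1)] c2.cong[OF b(2)] by simp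
  moreover have "[b * k = k] (mod int m1)"
    using cong_trans[OF cong_scalar_right[OF b(1)] a(2)] .
  moreover have "[b * k = k] (mod int m2)"
    using cong_scalar_right[OF b(2), of k] by simp
  ultimately show ?thesis using coprime_cong_mult[OF _ _ cop] by auto
qed

lemma prim_char_mult:
  assumes "prim_char m1 \<chi>1" "prim_char m2 \<chi>2" "coprime m1 m2"
  shows "prim_char (m1 * m2) (\<lambda>a. \<chi>1 a * \<chi>2 a)"
proof -
  interpret c1: prim_char m1 \<chi>1 by fact
  interpret c2: prim_char m2 \<chi>2 by fact
  have cop: "coprime (int m1) (int m2)" using assms(3) by simp
  show ?thesis
  proof
    show "m1 * m2 > 0" using c1.m_pos c2.m_pos by simp
    show "\<chi>1 j * \<chi>2 j = \<chi>1 k * \<chi>2 k" if "[j = k] (mod int (m1 * m2))" for j k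
    proof -
      have "[j = k] (mod int m1)" "[j = k] (mod int m2)"
        using that by (auto intro: cong_modulus_mult simp: mult.commute)
      then show ?thesis using c1.cong c2.cong by metis
    qed
    show "\<chi>1 (j * k) * \<chi>2 (j * k) = \<chi>1 j * \<chi>2 j * (\<chi>1 k * \<chi>2 k)" for j k
      by (simp add: c1.mult c2.mult)
    show "\<chi>1 k * \<chi>2 k = 1 \<or> \<chi>1 k * \<chi>2 k = - 1" if "coprime k (int (m1 * m2))" for k
      using that c1.unit[of k] c2.unit[of k] by auto
    show "\<chi>1 k * \<chi>2 k = 0" if "\<not> coprime k (int (m1 * m2))" for k
      using that c1.non_unit[of k] c2.non_unit[of k] by auto
    show "\<exists>a. \<chi>1 a * \<chi>2 a = - 1 \<and> [a * k = k] (mod int (m1 * m2))"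
      if "\<not> coprime k (int (m1 * m2))" for k
    proof (cases "coprime k (int m1)")
      case False
      then show ?thesis using prim_char_mult_primitive[OF assms(1,2) cop False] by simp
    next
      case True
      then have "\<not> coprime k (int m2)" using that by simp
      from prim_char_mult_primitive[OF assms(2,1) _ this] cop show ?thesis by (auto simp: mult.commute coprime_commute)
    qed
  qed
qed

section \<open>The characters modulo 4 and 8\<close>

definition chi4 :: "int \<Rightarrow> int" where
  "chi4 k = (if even k then 0 else if k mod 4 = 1 then 1 else - 1)"

text \<open>At odd positive \<open>k\<close> this is (2 | k), while \<open>chi4\<close> is (-1 | k);
  their product is (-2 | k).\<close>

definition chi8 :: "int \<Rightarrow> int" where
  "chi8 k = (if even k then 0 else if k mod 8 = 1 \<or> k mod 8 = 7 then 1 else - 1)"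

lemma chi4_mult: "chi4 (j * k) = chi4 j * chi4 k"
proof (cases "odd j \<and> odd k")
  case True
  have "(j * k) mod 4 = ((j mod 4) * (k mod 4)) mod 4" by (simp add: mod_mult_eq)
  moreover have "j mod 4 = 1 \<or> j mod 4 = 3" "k mod 4 = 1 \<or> k mod 4 = 3"
    using True by presburger+
  ultimately show ?thesis using True by (elim disjE) (simp_all add: chi4_def)
qed (auto simp: chi4_def)

lemma chi8_mult: "chi8 (j * k) = chi8 j * chi8 k"
proof (cases "odd j \<and> odd k")
  case True
  have "(j * k) mod 8 = ((j mod 8) * (k mod 8)) mod 8" by (simp add: mod_mult_eq)
  moreover have "j mod 8 = 1 \<or> j mod 8 = 3 \<or> j mod 8 = 5 \<or> j mod 8 = 7"
    "k mod 8 = 1 \<or> k mod 8 = 3 \<or> k mod 8 = 5 \<or> k mod 8 = 7"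
    using True by presburger+
  ultimately show ?thesis using True by (elim disjE) (simp_all add: chi8_def)
qed (auto simp: chi8_def)

lemma prim_char_chi4: "prim_char 4 chi4"
proof
  have cop: "coprime k (int 4) \<longleftrightarrow> odd k" for k
    using coprime_power_right_iff[of k 2 2] by simp
  show "chi4 j = chi4 k" if "[j = k] (mod int 4)" for j k
  proof -
    have "j mod 4 = k mod 4" using that by (simp add: cong_def)
    moreover from this have "even j \<longleftrightarrow> even k" by presburger
    ultimately show ?thesis by (simp add: chi4_def)
  qed
  \<comment> \<open>For even \<open>k\<close> the difference \<open>3 * k - k\<close> is divisible
    by 4.\<close>
  show "\<exists>a. chi4 a = - 1 \<and> [a * k = k] (mod int 4)" if "\<not> coprime k (int 4)" for k
    using that unfolding cop
    by (intro exI[of _ 3]) (auto simp: chi4_def cong_iff_dvd_diff elim!: evenE)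
  show "chi4 k = 0" if "\<not> coprime k (int 4)" for k
    using that unfolding cop by (simp add: chi4_def)
  show "chi4 k = 1 \<or> chi4 k = - 1" if "coprime k (int 4)" for k
    using that unfolding cop by (simp add: chi4_def)
qed (auto simp: chi4_mult)

lemma prim_char_mod_8:
  assumes "\<chi> = chi8 \<or> \<chi> = (\<lambda>k. chi4 k * chi8 k)"
  shows "prim_char 8 \<chi>"
proof
  have cop: "coprime k (int 8) \<longleftrightarrow> odd k" for k
    using coprime_power_right_iff[of k 2 3] by simp
  show "\<chi> j = \<chi> k" if "[j = k] (mod int 8)" for j k
  proof -
    have "j mod 8 = k mod 8" using that by (simp add: cong_def)
    moreover have "i mod 2 = (i mod 8) mod 2" "i mod 4 = (i mod 8) mod 4" for i :: int
      by (simp_all add: mod_mod_cancel)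
    then have "j mod 2 = k mod 2" "j mod 4 = k mod 4"
      using \<open>j mod 8 = k mod 8\<close> by metis+
    moreover from this have "even j \<longleftrightarrow> even k" by (simp add: even_iff_mod_2_eq_zero)
    ultimately show ?thesis using assms by (auto simp: chi4_def chi8_def)
  qed
  \<comment> \<open>The witness 5 serves both characters, since \<open>chi4 5 = 1\<close> and
    \<open>chi8 5 = - 1\<close>; and \<open>5 * k - k\<close> is divisible by 8 for even
    \<open>k\<close>.\<close>
  show "\<exists>a. \<chi> a = - 1 \<and> [a * k = k] (mod int 8)" if "\<not> coprime k (int 8)" for k
    using that assms unfolding cop
    by (intro exI[of _ 5]) (auto simp: chi4_def chi8_def cong_iff_dvd_diff elim!: evenE)
  show "\<chi> k = 0" if "\<not> coprime k (int 8)" for k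
    using that assms unfolding cop by (auto simp: chi8_def)
  show "\<chi> k = 1 \<or> \<chi> k = - 1" if "coprime k (int 8)" for k
  proof -
    have "chi4 k = 1 \<or> chi4 k = - 1" "chi8 k = 1 \<or> chi8 k = - 1"
      using that unfolding cop by (simp_all add: chi4_def chi8_def)
    then show ?thesis using assms by auto
  qed
  show "\<chi> (j * k) = \<chi> j * \<chi> k" for j k
    using assms by (auto simp: chi8_mult chi4_mult)
qed auto

lemma prim_char_chi8: "prim_char 8 chi8"
  by (simp add: prim_char_mod_8)

section \<open>The even primitive character attached to n\<close>

lemma squarefree_prime_mult:
  fixes p n :: nat
  assumes "prime p" "squarefree (p * n)"
  shows "coprime p n" "squarefree n"
proof -
  have "\<not> p dvd n"
  proof
    assume "p dvd n"
    then have "p\<^sup>2 dvd p * n" by (simp add: power2_eq_square)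
    then have "p dvd 1" using assms(2) squarefreeD by blast
    then show False using assms(1) by auto
  qed
  then show "coprime p n" using assms(1) prime_imp_coprime by blast
  show "squarefree n" using assms(2) by (rule squarefree_multD)
qed

text \<open>The product of the Legendre symbols at the primes dividing \<open>n\<close>. Since (-1 |
  p) p is 1 modulo 4 for each odd \<open>p\<close>, the congruence is inherited by products; it
  gives the parity of the character in terms of \<open>n\<close>.\<close>

lemma ex_prim_char_odd:
  assumes "odd n" "squarefree n"
  shows "\<exists>\<chi>. prim_char n \<chi> \<and> [\<chi> (- 1) * int n = 1] (mod 4)"
  using assms
proof (induction n rule: prime_divisors_induct)
  case (factor p n)
  then have p: "odd p" "odd n" "squarefree n" "coprime p n" "p > 2"
    using squarefree_prime_mult[of p n] prime_ge_2_nat[of p] by (auto simp: order_less_le)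
  obtain \<chi> where \<chi>: "prim_char n \<chi>" "[\<chi> (- 1) * int n = 1] (mod 4)" using factor p by blast
  let ?\<chi> = "\<lambda>a. Legendre a (int p) * \<chi> a"
  have "prim_char (p * n) ?\<chi>"
    by (rule prim_char_mult[OF prim_char_Legendre \<chi>(1)]) (use factor p in auto)
  moreover have "[?\<chi> (- 1) * int (p * n) = 1] (mod 4)"
  proof -
    have "[Legendre (- 1) (int p) * int p = 1] (mod 4)"
      unfolding Legendre_minus_1[OF factor(1) p(5)] cong_def using p(1) by auto presburger+
    from cong_mult[OF this \<chi>(2)] show ?thesis by (simp add: mult_ac)
  qed
  ultimately show ?case by (intro exI[of _ ?\<chi>]) simp
qed (use prim_char_1 in \<open>auto intro!: exI[of _ "\<lambda>_. 1"]\<close>)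

text \<open>If \<open>n\<close> is 3 modulo 4 the character of the odd part is odd, and
  \<open>chi4\<close> corrects its parity; for even \<open>n\<close> one of two characters modulo 8
  does. The last clause holds because \<open>2 * n\<close> is 2 modulo 4 or 4 modulo 8, where these
  factors change sign; it will fold sums modulo \<open>4 * n\<close> into sums modulo
  \<open>2 * n\<close>.\<close>

lemma ex_prim_char:
  assumes "squarefree n" "n > 0"
  shows "\<exists>\<chi>. prim_char (if n mod 4 = 1 then n else 4 * n) \<chi> \<and> \<chi> (- 1) = 1 \<and>
    (n mod 4 \<noteq> 1 \<longrightarrow> (\<forall>k. \<chi> (k + 2 * int n) = - \<chi> k))"
proof (cases "odd n")
  case True
  then obtain \<chi> where \<chi>: "prim_char n \<chi>" "[\<chi> (- 1) * int n = 1] (mod 4)"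
    using ex_prim_char_odd assms by blast
  interpret c: prim_char n \<chi> by fact
  have u: "\<chi> (- 1) = 1 \<or> \<chi> (- 1) = - 1" using c.unit[of "- 1"] by simp
  show ?thesis
  proof (cases "n mod 4 = 1")
    case n1: True
    have "int n mod 4 = 1" using n1 by presburger
    then have "\<chi> (- 1) = 1" using u \<chi>(2) by (auto simp: cong_def) presburger
    then show ?thesis using n1 \<chi>(1) by (intro exI[of _ \<chi>]) simp
  next
    case False
    have n3: "int n mod 4 = 3" using True False by presburger
    then have "\<chi> (- 1) = - 1" using u \<chi>(2) by (auto simp: cong_def)
    moreover have "prim_char (4 * n) (\<lambda>k. chi4 k * \<chi> k)"
      by (rule prim_char_mult[OF prim_char_chi4 \<chi>(1)]) (use True coprime_power_left_iff[of 2 2 n] in simp)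
    moreover have "chi4 (k + 2 * int n) * \<chi> (k + 2 * int n) = - (chi4 k * \<chi> k)" for k
    proof -
      have "\<chi> (k + 2 * int n) = \<chi> k" by (rule c.cong) (simp add: cong_iff_dvd_diff)
      moreover have "even (k + 2 * int n) \<longleftrightarrow> even k" by simp
      moreover have "odd k \<Longrightarrow> (k + 2 * int n) mod 4 = 1 \<longleftrightarrow> k mod 4 \<noteq> 1" using n3 by presburger
      ultimately show ?thesis by (simp add: chi4_def)
    qed
    ultimately show ?thesis using False by (intro exI[of _ "\<lambda>k. chi4 k * \<chi> k"]) (simp add: chi4_def)
  qed
next
  case False
  then obtain h where h: "n = 2 * h" by (auto elim: evenE)
  have h': "odd h" "squarefree h"
    using assms h squarefree_prime_mult[of 2 h] by auto
  then obtain \<chi> where \<chi>: "prim_char h \<chi>" "[\<chi> (- 1) * int h = 1] (mod 4)"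
    using ex_prim_char_odd by blast
  interpret c: prim_char h \<chi> by fact
  have u: "\<chi> (- 1) = 1 \<or> \<chi> (- 1) = - 1" using c.unit[of "- 1"] by simp
  \<comment> \<open>Both choices change sign under \<open>k + 4\<close>, so the choice is free to
    fix the parity.\<close>
  define \<psi> where "\<psi> = (if \<chi> (- 1) = 1 then chi8 else (\<lambda>k. chi4 k * chi8 k))"
  have "prim_char 8 \<psi>" by (rule prim_char_mod_8) (auto simp: \<psi>_def)
  then have "prim_char (8 * h) (\<lambda>k. \<psi> k * \<chi> k)"
    by (rule prim_char_mult[OF _ \<chi>(1)]) (use h' coprime_power_left_iff[of 2 3 h] in simp)
  moreover have "\<psi> (- 1) * \<chi> (- 1) = 1" using u by (auto simp: \<psi>_def chi4_def chi8_def)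
  moreover have "\<psi> (k + 2 * int n) * \<chi> (k + 2 * int n) = - (\<psi> k * \<chi> k)" for k
  proof -
    have "\<chi> (k + 2 * int n) = \<chi> k" by (rule c.cong) (simp add: cong_iff_dvd_diff h)
    moreover have "chi4 (k + 2 * int n) = chi4 k"
      by (rule prim_char.cong[OF prim_char_chi4]) (simp add: cong_iff_dvd_diff h)
    moreover have "chi8 (k + 2 * int n) = - chi8 k"
    proof -
      \<comment> \<open>As \<open>h\<close> is odd, \<open>2 * n = 4 * h\<close> is 4 modulo
        8.\<close>
      obtain t where "h = 2 * t + 1" using h'(1) by (auto elim: oddE)
      then have "chi8 (k + 2 * int n) = chi8 (k + 4)"
        by (intro prim_char.cong[OF prim_char_chi8]) (simp add: cong_iff_dvd_diff h)
      moreover have "odd k \<Longrightarrow> (k + 4) mod 8 = 1 \<or> (k + 4) mod 8 = 7 \<longleftrightarrow> \<not> (k mod 8 = 1 \<or> k mod 8 = 7)"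
        by presburger
      ultimately show ?thesis by (simp add: chi8_def)
    qed
    ultimately show ?thesis by (simp add: \<psi>_def)
  qed
  moreover have "n mod 4 \<noteq> 1" using False by presburger
  moreover have "8 * h = 4 * n" using h by simp
  ultimately show ?thesis by (intro exI[of _ "\<lambda>k. \<psi> k * \<chi> k"]) simp
qed

text \<open>Both sides are multiplicative in \<open>k\<close>, so primes decide: those dividing
  \<open>n\<close> give 0 on both sides, the others fall under \<open>chi_prime\<close>, where the
  square factor 4 of the conductor does not affect the Legendre symbol.\<close>

lemma jacobi_eq_prim_char:
  assumes pc: "prim_char (if n mod 4 = 1 then n else 4 * n) \<chi>" and \<chi>1: "\<chi> (- 1) = 1" and k: "odd k"
  shows "jacobi (int n) k = \<chi> (int k)"
  using k
proof (induction k rule: prime_divisors_induct)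
  interpret prim_char "if n mod 4 = 1 then n else 4 * n" \<chi> by fact
  have np: "n > 0" using m_pos by (auto split: if_splits)
  case (factor p k)
  then have p: "odd p" "odd k" "k > 0" by (auto intro!: Nat.gr0I)
  have p2: "p > 2" using factor(1) p(1) prime_ge_2_nat[of p] by (cases "p = 2") auto
  have p4: "\<not> p dvd 4"
  proof
    assume "p dvd 4"
    then have "p dvd 2 ^ 2" by simp
    then have "p dvd 2" by (rule prime_dvd_power[OF factor(1)])
    then show False using p2 by (auto dest: dvd_imp_le)
  qed
  have "Legendre (int n) (int p) = \<chi> (int p)"
  proof (cases "p dvd n")
    case True
    then have "int p dvd int (if n mod 4 = 1 then n else 4 * n)" by simp
    then have "\<not> coprime (int p) (int (if n mod 4 = 1 then n else 4 * n))"
      using coprime_prime_iff[OF factor(1)] by (simp only: coprime_commute[of "int p"] not_not)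
    then show ?thesis using non_unit True by (simp add: Legendre_def cong_0_iff)
  next
    case False
    then have "\<not> p dvd (if n mod 4 = 1 then n else 4 * n)"
      using prime_dvd_mult_iff[OF factor(1), of 4 n] p4 by auto
    from chi_prime[OF factor(1) p(1) this] have "\<chi> (int p) = Legendre (int (if n mod 4 = 1 then n else 4 * n)) (int p)"
      using \<chi>1 by simp
    also have "\<dots> = Legendre (int n) (int p)"
    proof -
      have "\<not> [4 = 0] (mod int p)"
        using p4 by (metis cong_0_iff int_dvd_int_iff of_nat_numeral)
      then have "Legendre 4 (int p) = 1"
        by (auto simp: Legendre_def QuadRes_def intro: exI[of _ 2])
      then show ?thesis using Legendre_mult[OF factor(1) p2, of 4 "int n"] by simp
    qed
    finally show ?thesis by simp
  qed
  moreover have "jacobi (int n) (p * k) = Legendre (int n) (int p) * jacobi (int n) k"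
    using factor(1) p(3) by (simp add: jacobi_def prime_factorization_mult prime_factorization_prime)
  ultimately show ?case using factor p by (simp add: mult)
next
  case (unit k)
  then have "k = 1" by simp
  then show ?case using prim_char.chi_1[OF pc] by (simp add: jacobi_def)
qed simp

section \<open>Ramanujan sums\<close>

definition ramanujan :: "nat \<Rightarrow> int \<Rightarrow> complex" where
  "ramanujan m k = (\<Sum>j\<in>totatives m. zeta m (int j * k))"

text \<open>Totatives are taken from 1 to \<open>m\<close> and residues from 0 to
  \<open>m - 1\<close>; this makes a difference only for \<open>m = 1\<close>, where the unit is 1
  on one side and 0 on the other.\<close>

lemma sum_totatives_eq:
  fixes f :: "int \<Rightarrow> 'a :: comm_monoid_add"
  assumes m: "m > 0" and f: "\<And>i j. [i = j] (mod int m) \<Longrightarrow> f i = f j"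
  shows "(\<Sum>j\<in>totatives m. f (int j)) = (\<Sum>j\<in>{0..<int m}. if coprime j (int m) then f j else 0)"
proof (cases "m = 1")
  case True
  have "{0..<1::int} = {0}" by auto
  moreover have "f 1 = f 0" using f[of 1 0] True by simp
  ultimately show ?thesis using True by simp
next
  case False
  then have m1: "m > 1" using m by simp
  have "(\<Sum>j\<in>{0..<int m}. if coprime j (int m) then f j else 0) =
      (\<Sum>j\<in>{j\<in>{0..<int m}. coprime j (int m)}. f j)"
    by (rule sum.inter_filter[symmetric]) simp
  also have "{j\<in>{0..<int m}. coprime j (int m)} = int ` totatives m"
  proof (intro equalityI subsetI)
    fix j assume "j \<in> {j\<in>{0..<int m}. coprime j (int m)}"
    then have j: "0 \<le> j" "j < int m" "coprime j (int m)" by auto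
    have "j \<noteq> 0" using j(3) m1 by (intro notI) simp
    then have "nat j \<in> totatives m" "j = int (nat j)"
      using j by (auto simp: in_totatives_iff simp flip: coprime_int_iff)
    then show "j \<in> int ` totatives m" by blast
  qed (auto simp: in_totatives_iff totatives_less[OF _ m1])
  finally show ?thesis by (simp add: sum.reindex)
qed

lemma ramanujan_unit:
  assumes m: "m > 0" and u: "coprime u (int m)"
  shows "ramanujan m (u * k) = ramanujan m k"
proof -
  let ?f = "\<lambda>j. if coprime j (int m) then zeta m (j * k) else 0"
  have f: "?f i = ?f j" if ij: "[i = j] (mod int m)" for i j
  proof -
    have "coprime i (int m) \<longleftrightarrow> coprime j (int m)" using ij by (metis cong_imp_coprime cong_sym)
    then show ?thesis using zeta_cong[OF cong_scalar_right[OF ij, of k]] by simp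
  qed
  have z: "zeta m (i * l) = zeta m (j * l)" if "[i = j] (mod int m)" for i j l
    using that by (intro zeta_cong cong_scalar_right)
  have "ramanujan m (u * k) = (\<Sum>j\<in>{0..<int m}. if coprime j (int m) then zeta m (j * (u * k)) else 0)"
    unfolding ramanujan_def by (rule sum_totatives_eq[OF m]) (rule z)
  also have "\<dots> = (\<Sum>j\<in>{0..<int m}. ?f (u * j))"
    using u by (intro sum.cong) (auto simp: mult_ac)
  also have "\<dots> = (\<Sum>j\<in>{0..<int m}. ?f j)"
    by (rule sum_residues_reindex[OF m f]) (use u in \<open>simp_all add: cong_mult_lcancel\<close>)
  also have "\<dots> = ramanujan m k"
    unfolding ramanujan_def by (rule sum_totatives_eq[OF m, symmetric]) (rule z)
  finally show ?thesis .
qed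

lemma ramanujan_1 [simp]: "ramanujan (Suc 0) k = 1"
  using zeta_eq_1_iff[of 1 k] by (simp add: ramanujan_def)

text \<open>With \<open>u * b + v * a = 1\<close> a root of unity of order \<open>a * b\<close>
  splits into one of order \<open>a\<close> and one of order \<open>b\<close>. The multipliers
  \<open>u\<close> and \<open>v\<close> are units for these moduli and disappear by
  \<open>ramanujan_unit\<close>.\<close>

lemma ramanujan_mult:
  assumes "a > 0" "b > 0" and cop: "coprime a b"
  shows "ramanujan (a * b) k = ramanujan a k * ramanujan b k"
proof (cases "a = 1 \<or> b = 1")
  case False
  then have a: "a > 1" and b: "b > 1" using assms by auto
  have "coprime (int a) (int b)" using cop by simp
  moreover obtain u v where "u * int b + v * int a = gcd (int b) (int a)"
    using bezout_int[of "int b" "int a"] by blast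
  ultimately have uv: "u * int b + v * int a = 1"
    by (simp only: coprime_iff_gcd_eq_1 gcd.commute)
  have u: "coprime u (int a)"
  proof (rule coprimeI)
    fix c assume "c dvd u" "c dvd int a"
    then have "c dvd u * int b + v * int a" by simp
    then show "is_unit c" by (simp only: uv)
  qed
  have v: "coprime v (int b)"
  proof (rule coprimeI)
    fix c assume "c dvd v" "c dvd int b"
    then have "c dvd u * int b + v * int a" by simp
    then show "is_unit c" by (simp only: uv)
  qed
  have z: "zeta (a * b) (int x * k) = zeta a (int (x mod a) * (u * k)) * zeta b (int (x mod b) * (v * k))" for x
  proof -
    have "int x * k = (int x * (u * k)) * int b + (int x * (v * k)) * int a"
      using arg_cong[OF uv, of "\<lambda>y. int x * k * y"] by (simp add: algebra_simps)
    then have "zeta (a * b) (int x * k) = zeta (a * b) ((int x * (u * k)) * int b) * zeta (b * a) ((int x * (v * k)) * int a)"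
      by (simp add: zeta_add mult.commute)
    also have "\<dots> = zeta a (int x * (u * k)) * zeta b (int x * (v * k))"
      using assms by (simp only: zeta_cancel)
    also have "zeta a (int x * (u * k)) = zeta a (int (x mod a) * (u * k))"
      by (intro zeta_cong cong_scalar_right) (simp add: cong_def zmod_int)
    also have "zeta b (int x * (v * k)) = zeta b (int (x mod b) * (v * k))"
      by (intro zeta_cong cong_scalar_right) (simp add: cong_def zmod_int)
    finally show ?thesis .
  qed
  let ?F = "\<lambda>(y, w). zeta a (int y * (u * k)) * zeta b (int w * (v * k))"
  have "ramanujan (a * b) k = (\<Sum>x\<in>totatives (a * b). ?F (x mod a, x mod b))"
    by (simp add: ramanujan_def z)
  also have "\<dots> = (\<Sum>p\<in>totatives a \<times> totatives b. ?F p)"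
    by (rule sum.reindex_bij_betw[OF bij_betw_totatives[OF a b cop]])
  also have "\<dots> = ramanujan a (u * k) * ramanujan b (v * k)"
    by (simp add: ramanujan_def sum_product sum.cartesian_product)
  finally show ?thesis using ramanujan_unit u v assms by simp
qed auto

lemma ramanujan_prime:
  assumes p: "prime p"
  shows "ramanujan p k = (if int p dvd k then of_nat (p - 1) else - 1)"
proof -
  have p1: "p > 1" using p prime_gt_1_nat by blast
  have "ramanujan p k = (\<Sum>j\<in>{0..<int p}. if coprime j (int p) then zeta p (j * k) else 0)"
    unfolding ramanujan_def by (rule sum_totatives_eq) (use p1 in \<open>auto intro!: zeta_cong cong_scalar_right\<close>)
  also have "\<dots> = (\<Sum>j\<in>{0..<int p}. zeta p (j * k) - (if j = 0 then 1 else 0))"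
  proof (rule sum.cong)
    fix j assume j: "j \<in> {0..<int p}"
    have "coprime j (int p) \<longleftrightarrow> j \<noteq> 0"
      using j coprime_prime_iff[OF p, of j] zdvd_not_zless[of j "int p"] by (cases "j = 0") auto
    then show "(if coprime j (int p) then zeta p (j * k) else 0) = zeta p (j * k) - (if j = 0 then 1 else 0)"
      by auto
  qed simp
  also have "\<dots> = (if int p dvd k then of_nat p else 0) - 1"
    using p1 sum_zeta[of p k] by (simp add: sum_subtractf)
  finally show ?thesis using p1 by (simp add: of_nat_diff)
qed

lemma moebius_1 [simp]: "moebius (Suc 0) = 1"
  by (simp add: moebius_def)

lemma moebius_prime_mult:
  assumes "prime p" "\<not> p dvd n" "n > 0"
  shows "moebius (p * n) = - moebius n"
proof -
  have cop: "coprime p n" using assms prime_imp_coprime by blast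
  have "squarefree (p * n) \<longleftrightarrow> squarefree n"
    using squarefree_mult_coprime[OF cop squarefree_prime[OF assms(1)]] squarefree_multD by blast
  moreover have "prime_factors (p * n) = insert p (prime_factors n)" "p \<notin> prime_factors n"
    using assms by (auto simp: prime_factors_product prime_prime_factors)
  ultimately show ?thesis by (simp add: moebius_def)
qed

text \<open>Hoelder's formula, simple here because each prime \<open>p\<close> of \<open>n\<close>
  contributes \<open>p - 1\<close> or \<open>- 1\<close> according to whether it divides
  \<open>k\<close>.\<close>

lemma ramanujan_squarefree:
  assumes "squarefree n" "n > 0"
  shows "ramanujan n (int k) = of_int (moebius (n div gcd k n)) * of_nat (totient (gcd k n))"
  using assms
proof (induction n rule: prime_divisors_induct)
  case (factor p n)
  then have n: "n > 0" "squarefree n" "coprime p n" using squarefree_prime_mult[of p n] by auto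
  have pn: "\<not> p dvd n" using n(3) factor(1) coprime_absorb_left[of p n] by auto
  have IH: "ramanujan n (int k) = of_int (moebius (n div gcd k n)) * of_nat (totient (gcd k n))"
    using factor n by blast
  have p0: "p > 0" using factor(1) prime_gt_0_nat by blast
  have eq: "ramanujan (p * n) (int k) = ramanujan p (int k) * ramanujan n (int k)"
    using p0 n by (intro ramanujan_mult)
  show ?case
  proof (cases "p dvd k")
    case True
    obtain k' where k': "k = p * k'" using True by (auto elim: dvdE)
    have "gcd k n = gcd k' n"
      using n(3) gcd_mult_left_left_cancel[of n p k'] by (simp add: k' coprime_commute)
    moreover have "gcd k (p * n) = p * gcd k' n" by (simp only: k' gcd_mult_distrib_nat)
    ultimately have "gcd k (p * n) = p * gcd k n" by simp
    moreover have "coprime p (gcd k n)" by (rule coprime_divisors[OF dvd_refl gcd_dvd2 n(3)])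
    ultimately show ?thesis using eq IH True ramanujan_prime[OF factor(1)] p0 factor(1)
      by (simp add: totient_mult_coprime totient_prime)
  next
    case False
    then have g: "gcd k (p * n) = gcd k n"
      using prime_imp_coprime[OF factor(1) False] gcd_mult_right_left_cancel[of k p n]
      by (simp add: coprime_commute)
    have "p * n div gcd k n = p * (n div gcd k n)" by (simp add: div_mult_swap)
    moreover have "moebius (p * (n div gcd k n)) = - moebius (n div gcd k n)"
    proof (rule moebius_prime_mult[OF factor(1)])
      have d: "n = (n div gcd k n) * gcd k n" by simp
      show "\<not> p dvd n div gcd k n" using pn d by (metis dvd_mult2)
      show "n div gcd k n > 0" using n(1) d by (metis mult_0 neq0_conv)
    qed
    ultimately show ?thesis using eq IH False ramanujan_prime[OF factor(1)] g by simp
  qed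
next
  case (unit n)
  then show ?case by simp
qed simp

section \<open>The cosine factor and power sums at even indices\<close>

definition cos_quarter :: "nat \<Rightarrow> int" where
  "cos_quarter t = (if t mod 4 = 0 then 1 else if t mod 4 = 2 then - 1 else 0)"

lemma cos_quarter_even: "cos_quarter (2 * s) = (- 1) ^ s"
proof (cases "even s")
  case True
  then obtain t where "s = 2 * t" by (auto elim: evenE)
  then show ?thesis by (simp add: cos_quarter_def)
next
  case False
  then obtain t where t: "s = 2 * t + 1" by (auto elim: oddE)
  have "(2 * s) mod 4 = 2" unfolding t by presburger
  then show ?thesis using False by (simp add: cos_quarter_def)
qed

lemma cos_quarter_odd: "odd t \<Longrightarrow> cos_quarter t = 0"
  unfolding cos_quarter_def by presburger

lemma cos_quarter: "cos (real t * pi / 2) = of_int (cos_quarter t)"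
proof (cases "even t")
  case True
  then obtain s where s: "t = 2 * s" by (auto elim: evenE)
  then show ?thesis by (simp add: cos_quarter_even)
next
  case False
  then obtain s where s: "t = 2 * s + 1" by (auto elim: oddE)
  have "cos (real t * pi / 2) = cos (real s * pi + pi / 2)" by (simp add: s field_simps)
  also have "\<dots> = 0" by (simp add: cos_add)
  finally show ?thesis using False by (simp add: cos_quarter_odd)
qed

text \<open>For even \<open>k\<close> the angle is a multiple of pi/2, so the value is an integer
  and the cosine depends only on a residue modulo 4, as \<open>cos_c\<close> exploits.\<close>

lemma aur_q_even:
  assumes "even k" "n \<ge> 1"
  shows "aur_q n k = of_int (moebius (aur_n' n div gcd k (aur_n' n)) *
    int (totient (gcd k (aur_n' n))) * cos_quarter ((n - 1) * (k div 2)))"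
proof -
  obtain l where l: "k = 2 * l" using assms(1) by (auto elim: evenE)
  have "(real n - 1) * real k * pi / 4 = real ((n - 1) * (k div 2)) * pi / 2"
    using assms(2) by (simp add: l of_nat_diff)
  then show ?thesis using assms(1) by (simp only: aur_q_def cos_quarter) (simp add: Let_def)
qed

text \<open>The factor 4 of \<open>2 * n\<close> for even \<open>n\<close> is not square-free, so it
  is evaluated directly; its two units give conjugate terms.\<close>

lemma ramanujan_4: "ramanujan 4 (int l) = of_int (2 * cos_quarter l)"
proof -
  have "totatives 4 = {1, 3}"
  proof -
    have "{0<..4::nat} = {1,2,3,4}" by auto
    moreover have "coprime (k::nat) 4 \<longleftrightarrow> odd k" for k
      using coprime_power_right_iff[of k 2 2] by simp
    ultimately show ?thesis by (auto simp: totatives_def)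
  qed
  then have "ramanujan 4 (int l) = zeta 4 (int l) + zeta 4 (3 * int l)" by (simp add: ramanujan_def)
  also have "zeta 4 (3 * int l) = zeta 4 (- int l)"
    by (rule zeta_cong) (simp add: cong_iff_dvd_diff)
  also have "zeta 4 (int l) + zeta 4 (- int l) = of_real (2 * cos (2 * pi * real l / 4))"
    by (simp add: zeta_def complex_eq_iff)
  also have "2 * pi * real l / 4 = real l * pi / 2" by simp
  finally show ?thesis by (simp add: cos_quarter)
qed

text \<open>The cosine is the contribution of the prime 2. For \<open>n\<close> equal to 3 modulo 4
  the modulus 2 gives the sign \<open>(- 1) ^ (k div 2)\<close>. For even \<open>n\<close> the
  modulus 4 gives 0 if \<open>k div 2\<close> is odd, and otherwise a sign times 2, where the 2 is
  the totient of the factor 4 of the gcd.\<close>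

lemma ramanujan_aur_q:
  assumes n: "squarefree n" "n > 1" and k: "even k"
  shows "(if n mod 4 = 1 then ramanujan n (int k) else ramanujan (2 * n) (int (k div 2))) =
    of_real (aur_q n k)"
proof -
  obtain l where l: "k = 2 * l" using k by (auto elim: evenE)
  have n0: "n > 0" "n \<ge> 1" using n by auto
  consider "n mod 4 = 1" | "odd n" "n mod 4 \<noteq> 1" | "even n" by blast
  then show ?thesis
  proof cases
    case 1
    then obtain t where t: "n = 4 * t + 1" by (metis mod_mult_div_eq mult.commute add.commute)
    have "cos_quarter ((n - 1) * (k div 2)) = 1" by (simp add: cos_quarter_def t)
    then show ?thesis using 1 aur_q_even[OF k n0(2)] ramanujan_squarefree[OF n(1) n0(1), of k]
      by (simp add: aur_n'_def)
  next
    case 2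
    then have "n mod 4 = 3" by presburger
    then obtain t where t: "n = 4 * t + 3" by (metis mod_mult_div_eq mult.commute add.commute)
    have "(n - 1) * (k div 2) = 2 * ((2 * t + 1) * l)" by (simp add: t l algebra_simps)
    then have "cos_quarter ((n - 1) * (k div 2)) = (- 1) ^ ((2 * t + 1) * l)"
      by (simp only: cos_quarter_even)
    also have "\<dots> = (- 1) ^ l" by (simp only: power_mult) simp
    finally have c: "cos_quarter ((n - 1) * (k div 2)) = (- 1) ^ l" .
    have "ramanujan (2 * n) (int l) = ramanujan 2 (int l) * ramanujan n (int l)"
      using 2 n0 by (intro ramanujan_mult) auto
    also have "ramanujan 2 (int l) = (- 1) ^ l" using ramanujan_prime[of 2 "int l"] by simp
    finally have r: "ramanujan (2 * n) (int l) = (- 1) ^ l * ramanujan n (int l)" .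
    have "coprime 2 (gcd l n)" using 2 by simp
    then have "totient (gcd k (2 * n)) = totient (gcd l n)"
      using totient_mult_coprime[of 2 "gcd l n"] by (simp add: l gcd_mult_distrib_nat[symmetric])
    moreover have "2 * n div gcd k (2 * n) = n div gcd l n"
      by (simp add: l gcd_mult_distrib_nat[symmetric])
    ultimately show ?thesis
      using 2 c r aur_q_even[OF k n0(2)] ramanujan_squarefree[OF n(1) n0(1), of l]
      by (simp add: aur_n'_def l)
  next
    case 3
    then obtain h where h: "n = 2 * h" by (auto elim: evenE)
    have h': "odd h" "squarefree h" "h > 0"
      using n h squarefree_prime_mult[of 2 h] by auto
    have n1: "n mod 4 \<noteq> 1" using 3 by presburger
    have "ramanujan (4 * h) (int l) = ramanujan 4 (int l) * ramanujan h (int l)"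
      using h' coprime_power_left_iff[of 2 2 h] by (intro ramanujan_mult) auto
    then have r: "ramanujan (2 * n) (int l) = of_int (2 * cos_quarter l) * ramanujan h (int l)"
      by (simp add: h ramanujan_4)
    show ?thesis
    proof (cases "even l")
      case False
      have "odd ((n - 1) * (k div 2))" using False 3 n0 by (simp add: l)
      then have "aur_q n k = 0" using aur_q_even[OF k n0(2)] by (simp add: cos_quarter_odd)
      then show ?thesis using r False n1 by (simp add: l cos_quarter_odd)
    next
      case True
      then obtain i where i: "l = 2 * i" by (auto elim: evenE)
      have "(n - 1) * (k div 2) = 2 * ((n - 1) * i)" by (simp add: l i)
      then have "cos_quarter ((n - 1) * (k div 2)) = (- 1) ^ ((n - 1) * i)"
        by (simp only: cos_quarter_even)
      also have "\<dots> = (- 1) ^ i" using 3 n0 by (simp only: power_mult) simp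
      finally have c: "cos_quarter ((n - 1) * (k div 2)) = (- 1) ^ i" .
      have "gcd k (4 * h) = 4 * gcd i h"
        unfolding l i using gcd_mult_distrib_nat[of 4 i h] by simp
      moreover have "coprime 4 (gcd i h)"
        using h'(1) coprime_power_left_iff[of 2 2 "gcd i h"] by simp
      ultimately have g: "totient (gcd k (4 * h)) = 2 * totient (gcd i h)"
        "4 * h div gcd k (4 * h) = h div gcd i h"
        by (simp_all add: totient_mult_coprime)
      have "ramanujan h (int l) = ramanujan h (int i)"
        using ramanujan_unit[of h 2 "int i"] h' by (simp add: i)
      then have "ramanujan h (int l) = of_int (moebius (h div gcd i h)) * of_nat (totient (gcd i h))"
        using ramanujan_squarefree[OF h'(2,3), of i] by simp
      moreover have "aur_n' n = 4 * h" using n1 by (simp add: aur_n'_def h)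
      ultimately show ?thesis
        using n1 c g r aur_q_even[OF k n0(2)] by (simp add: l i cos_quarter_even)
    qed
  qed
qed

section \<open>The cyclotomic polynomials\<close>

lemma prod_linear_monic:
  fixes r :: "'b \<Rightarrow> 'a :: idom"
  assumes "finite A"
  shows "degree (\<Prod>z\<in>A. [:- r z, 1:]) = card A" "lead_coeff (\<Prod>z\<in>A. [:- r z, 1:]) = 1"
proof -
  show "degree (\<Prod>z\<in>A. [:- r z, 1:]) = card A" using assms by (simp add: degree_prod_sum_eq)
  show "lead_coeff (\<Prod>z\<in>A. [:- r z, 1:]) = 1" by (simp only: lead_coeff_prod) simp
qed

lemma monic_eqI:
  fixes p q :: "'a :: idom poly"
  assumes "lead_coeff p = 1" "lead_coeff q = 1" "degree p = card A" "degree q = card A"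
    and "\<And>z. z \<in> A \<Longrightarrow> poly p z = 0" "\<And>z. z \<in> A \<Longrightarrow> poly q z = 0"
  shows "p = q"
  by (rule poly_eqI_degree_lead_coeff[where A = A and n = "card A"]) (use assms in auto)

lemma cyclotomic_monic: "degree (cyclotomic m) = totient m" "lead_coeff (cyclotomic m) = 1"
  unfolding cyclotomic_def using prod_linear_monic[of "totatives m" "\<lambda>k. cis (2 * pi * real k / real m)"]
  by (simp_all add: totient_def)

lemma coeff_cyclotomic_totient [simp]: "Polynomial.coeff (cyclotomic m) (totient m) = 1"
  using cyclotomic_monic[of m] by simp

lemma cyclotomic_altdef: "cyclotomic m = (\<Prod>j\<in>totatives m. [:- zeta m (int j), 1:])"
  by (simp add: cyclotomic_def zeta_def)

lemma ex_totative_cong: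
  assumes m: "m > 0" and i: "coprime i (int m)"
  obtains j where "j \<in> totatives m" "[i = int j] (mod int m)"
proof (cases "m = 1")
  case True
  then show ?thesis using that[of 1] by simp
next
  case False
  define j where "j = nat (i mod int m)"
  have ij: "[i = int j] (mod int m)" using m by (simp add: j_def cong_def)
  then have "coprime (int j) (int m)" using i cong_imp_coprime by blast
  then have c: "coprime j m" by simp
  have "j \<noteq> 0" using c False by (intro notI) simp
  moreover have "j < m" using m by (simp add: j_def nat_less_iff)
  ultimately have "j \<in> totatives m" using c by (simp add: in_totatives_iff)
  then show ?thesis using that ij by blast
qed

lemma cyclotomic_root:
  assumes m: "m > 0" and i: "coprime i (int m)"
  shows "poly (cyclotomic m) (zeta m i) = 0"
proof -
  obtain j where j: "j \<in> totatives m" "[i = int j] (mod int m)" using ex_totative_cong[OF assms] .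
  have "zeta m i = zeta m (int j)" using j(2) by (rule zeta_cong)
  then show ?thesis using j(1) by (auto simp: cyclotomic_altdef poly_prod intro!: prod_zero)
qed

definition prim_roots :: "nat \<Rightarrow> complex set" where
  "prim_roots m = (\<lambda>j. zeta m (int j)) ` totatives m"

lemma inj_on_zeta_totatives: "inj_on (\<lambda>j. zeta m (int j)) (totatives m)"
proof (rule inj_onI)
  fix i j assume ij: "i \<in> totatives m" "j \<in> totatives m" "zeta m (int i) = zeta m (int j)"
  then have m: "m > 0" by (auto simp: in_totatives_iff)
  then have c: "[i = j] (mod m)" using ij(3) by (simp add: zeta_eq_iff cong_int_iff)
  show "i = j"
  proof (cases "m = 1")
    case False
    then have "m > 1" using m by simp
    then show ?thesis using c totatives_less ij(1,2) cong_less_modulus_unique_nat by blast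
  qed (use ij in auto)
qed

lemma card_prim_roots: "card (prim_roots m) = totient m"
  by (simp add: prim_roots_def card_image inj_on_zeta_totatives totient_def)

lemma finite_prim_roots [simp]: "finite (prim_roots m)"
  by (simp add: prim_roots_def)

lemma zeta_in_prim_roots: "m > 0 \<Longrightarrow> coprime i (int m) \<Longrightarrow> zeta m i \<in> prim_roots m"
  by (erule (1) ex_totative_cong) (auto simp: prim_roots_def dest: zeta_cong)

lemma cyclotomic_prim_root: "z \<in> prim_roots m \<Longrightarrow> poly (cyclotomic m) z = 0"
  unfolding prim_roots_def cyclotomic_altdef by (auto simp: poly_prod intro!: prod_zero)

text \<open>Since -1 is the \<open>m\<close>-th power of the root of order \<open>2 * m\<close>, the
  exponent becomes \<open>j + m\<close>, which is even and can be halved.\<close>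

lemma uminus_zeta_double:
  assumes "odd m" "odd j"
  shows "- zeta (2 * m) j = zeta m ((j + int m) div 2)"
proof -
  have m: "m > 0" using assms by (auto intro!: Nat.gr0I)
  have "zeta m ((j + int m) div 2) = zeta (m * 2) ((j + int m) div 2 * int 2)"
    by (subst zeta_cancel) auto
  also have "(j + int m) div 2 * int 2 = j + int m" using assms by simp
  also have "zeta (m * 2) (j + int m) = zeta (2 * m) j * zeta (m * 2) (int m)"
    by (simp add: zeta_add mult.commute)
  also have "zeta (m * 2) (int m) = - 1" using m by (simp add: zeta_def)
  finally show ?thesis by simp
qed

lemma coprime_half:
  assumes "odd m" "odd j" "coprime j (int m)"
  shows "coprime ((j + int m) div 2) (int m)"
proof -
  have "coprime (2 * ((j + int m) div 2)) (int m)"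
    using assms by (simp add: coprime_iff_gcd_eq_1)
  then show ?thesis by (simp only: coprime_mult_left_iff)
qed

text \<open>Monic polynomials of the same degree with the same zeros. If z is a primitive root of
  order n', then -z has order \<open>n\<close> for \<open>n\<close> equal to 3 modulo 4, and -z^2
  has order \<open>n div 2\<close> for even \<open>n\<close>. The sign in front of
  \<open>aur_F\<close> makes the second case monic; in the first the totient is even.\<close>

lemma aur_F_eq_cyclotomic:
  assumes n: "squarefree n" "n > 1"
  shows "aur_F n = cyclotomic (aur_n' n)"
proof -
  have "n mod 4 = 1 \<or> odd n \<and> n mod 4 = 3 \<or> even n" by presburger
  then consider "n mod 4 = 1" | "odd n" "n mod 4 = 3" | "even n" by blast
  then show ?thesis
  proof cases
    case 1
    then have "odd n" by presburger
    then show ?thesis using 1 by (simp add: aur_F_def aur_n'_def)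
  next
    case 2
    have n': "aur_n' n = 2 * n" using 2 by (simp add: aur_n'_def)
    have n3: "n > 2" using 2 n by presburger
    have F: "aur_F n = pcompose (cyclotomic n) [:0, - 1:]" using 2 by (simp add: aur_F_def)
    have t: "totient (2 * n) = totient n" using 2 totient_mult_coprime[of 2 n] by simp
    show ?thesis unfolding n'
    proof (rule monic_eqI[where A = "prim_roots (2 * n)"])
      show "lead_coeff (aur_F n) = 1"
        using lead_coeff_comp[of "[:0, - 1:]" "cyclotomic n"] totient_even[OF n3]
        by (simp add: F cyclotomic_monic)
      show "degree (aur_F n) = card (prim_roots (2 * n))"
        by (simp add: F degree_pcompose cyclotomic_monic card_prim_roots t)
      fix z assume "z \<in> prim_roots (2 * n)"
      then obtain j where j: "j \<in> totatives (2 * n)" "z = zeta (2 * n) (int j)"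
        by (auto simp: prim_roots_def)
      have "coprime j (2 * n)" using j(1) by (simp add: in_totatives_iff)
      then have "odd (int j)" "coprime (int j) (int n)" by auto
      then have "poly (cyclotomic n) (- z) = 0"
        using 2 n j uminus_zeta_double[of n "int j"] coprime_half[of n "int j"]
        by (simp add: cyclotomic_root)
      then show "poly (aur_F n) z = 0" by (simp add: F poly_pcompose)
    qed (simp_all add: cyclotomic_monic card_prim_roots cyclotomic_prim_root)
  next
    case 3
    then obtain h where h: "n = 2 * h" by (auto elim: evenE)
    have h': "odd h" "h > 0" using n h squarefree_prime_mult[of 2 h] by auto
    have "n mod 4 \<noteq> 1" using 3 by presburger
    then have n': "aur_n' n = 4 * h" by (simp add: aur_n'_def h)
    have F: "aur_F n = Polynomial.smult ((- 1) ^ totient h) (pcompose (cyclotomic h) [:0, 0, - 1:])"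
      by (simp add: aur_F_def h)
    have t: "totient (4 * h) = 2 * totient h"
      using h' totient_mult_coprime[of 4 h] coprime_power_left_iff[of 2 2 h] by simp
    show ?thesis unfolding n'
    proof (rule monic_eqI[where A = "prim_roots (4 * h)"])
      have "lead_coeff (pcompose (cyclotomic h) [:0, 0, - 1:]) = (- 1) ^ totient h"
        using lead_coeff_comp[of "[:0, 0, - 1:]" "cyclotomic h"] by (simp add: cyclotomic_monic)
      then show "lead_coeff (aur_F n) = 1" by (simp add: F flip: power_mult_distrib)
      show "degree (aur_F n) = card (prim_roots (4 * h))"
        by (simp add: F degree_pcompose cyclotomic_monic card_prim_roots t)
      fix z assume "z \<in> prim_roots (4 * h)"
      then obtain j where j: "j \<in> totatives (4 * h)" "z = zeta (4 * h) (int j)"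
        by (auto simp: prim_roots_def)
      have "coprime j (2 * (2 * h))" using j(1) by (simp add: in_totatives_iff)
      then have jj: "odd (int j)" "coprime (int j) (int h)" by auto
      have "z * z = zeta (4 * h) (int j + int j)" by (simp only: j(2) zeta_add)
      also have "\<dots> = zeta (2 * h * 2) (int j * int 2)" by (rule arg_cong2[of _ _ _ _ zeta]) auto
      also have "\<dots> = zeta (2 * h) (int j)" by (rule zeta_cancel) simp
      finally have "poly (cyclotomic h) (- (z * z)) = 0"
        using h' jj uminus_zeta_double[of h "int j"] coprime_half[of h "int j"]
        by (simp add: cyclotomic_root)
      then show "poly (aur_F n) z = 0" by (simp add: F poly_pcompose)
    qed (simp_all add: cyclotomic_monic card_prim_roots cyclotomic_prim_root)
  qed
qed

section \<open>Newton's identities\<close>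

text \<open>Logarithmic derivative: a factor 1 - r X contributes -r / (1 - r X), a geometric series,
  and these add up to the generating function of the power sums.\<close>

lemma fps_deriv_prod_linear:
  fixes r :: "'b \<Rightarrow> 'a :: field_char_0"
  assumes "finite A"
  shows "fps_deriv (\<Prod>j\<in>A. 1 - fps_const (r j) * fps_X) =
    - ((\<Prod>j\<in>A. 1 - fps_const (r j) * fps_X) * Abs_fps (\<lambda>i. \<Sum>j\<in>A. r j ^ Suc i))"
  using assms
proof (induction A)
  case empty
  then show ?case by (simp add: fps_eq_iff)
next
  case (insert x A)
  define P where "P = (\<Prod>j\<in>A. 1 - fps_const (r j) * fps_X)"
  define S where "S = Abs_fps (\<lambda>i. \<Sum>j\<in>A. r j ^ Suc i)"
  define G where "G = Abs_fps (\<lambda>i. r x ^ Suc i)"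
  have SG: "Abs_fps (\<lambda>i. \<Sum>j\<in>insert x A. r j ^ Suc i) = G + S"
    using insert by (simp add: fps_eq_iff S_def G_def)
  have geo: "(1 - fps_const (r x) * fps_X) * G = fps_const (r x)"
  proof (rule fps_ext)
    fix k
    show "((1 - fps_const (r x) * fps_X) * G) $ k = fps_const (r x) $ k"
      by (cases k) (simp_all add: G_def left_diff_distrib mult.assoc)
  qed
  have "fps_deriv ((1 - fps_const (r x) * fps_X) * P) =
      - (fps_const (r x) * P) - (1 - fps_const (r x) * fps_X) * (P * S)"
    using insert.IH by (simp add: P_def S_def algebra_simps)
  also have "\<dots> = - ((1 - fps_const (r x) * fps_X) * G * P) - (1 - fps_const (r x) * fps_X) * (P * S)"
    by (simp only: geo)
  also have "\<dots> = - (((1 - fps_const (r x) * fps_X) * P) * (G + S))"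
  proof -
    have "- (L * G * P) - L * (P * S) = - ((L * P) * (G + S))" for L :: "'a fps"
      by (simp add: algebra_simps)
    then show ?thesis .
  qed
  also have "(1 - fps_const (r x) * fps_X) * P = (\<Prod>j\<in>insert x A. 1 - fps_const (r j) * fps_X)"
    using insert by (simp add: P_def)
  finally show ?case unfolding SG .
qed

lemma newton_identity:
  fixes r :: "'b \<Rightarrow> 'a :: field_char_0"
  assumes "finite A"
  defines "Q \<equiv> \<Prod>j\<in>A. [:1, - r j:]"
  shows "of_nat k * Polynomial.coeff Q k = - (\<Sum>i<k. Polynomial.coeff Q i * (\<Sum>j\<in>A. r j ^ (k - i)))"
proof (cases k)
  case (Suc l)
  have linear: "fps_of_poly [:1, - r j:] = 1 - fps_const (r j) * fps_X" for j
    by (simp flip: fps_const_neg)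
  have Q: "fps_of_poly Q = (\<Prod>j\<in>A. 1 - fps_const (r j) * fps_X)"
    unfolding Q_def fps_of_poly_prod linear ..
  have "fps_deriv (fps_of_poly Q) $ l = - ((fps_of_poly Q * Abs_fps (\<lambda>i. \<Sum>j\<in>A. r j ^ Suc i)) $ l)"
    unfolding Q using fps_deriv_prod_linear[OF assms(1), of r] by simp
  then have "of_nat k * Polynomial.coeff Q k =
     - (\<Sum>i=0..l. Polynomial.coeff Q i * (\<Sum>j\<in>A. r j ^ Suc (l - i)))"
    by (simp add: fps_mult_nth Suc)
  also have "{0..l} = {..<k}" using Suc by auto
  also have "(\<Sum>i<k. Polynomial.coeff Q i * (\<Sum>j\<in>A. r j ^ Suc (l - i))) =
     (\<Sum>i<k. Polynomial.coeff Q i * (\<Sum>j\<in>A. r j ^ (k - i)))"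
    by (intro sum.cong) (auto simp: Suc Suc_diff_le)
  finally show ?thesis .
qed simp

lemma sum_even_odd: "(\<Sum>i<2 * k. f i) = (\<Sum>j<k. f (2 * j) + f (2 * j + 1))"
  for f :: "nat \<Rightarrow> 'a :: comm_monoid_add"
  by (induction k) (simp_all add: add.assoc)

section \<open>A square root of each root of the polynomial\<close>

text \<open>\<open>r j\<close> is a square root of a root of \<^term>\<open>aur_F n\<close>, with the sign chosen such that the
  polynomial with roots \<open>r j\<close> is \<open>C(y\<^sup>2) - g y D(y\<^sup>2)\<close>, where \<open>g = \<plusminus>\<surd>n\<close>.\<close>

locale aur_roots =
  fixes n :: nat and r :: "nat \<Rightarrow> complex" and g :: complex
  assumes n_gt_1: "n > 1" and squarefree_n: "squarefree n"
    and g_sq: "g ^ 2 = of_nat n"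
    and odd_power_sum: "odd k \<Longrightarrow> (\<Sum>j\<in>totatives (aur_n' n). r j ^ k) = g * of_real (aur_q n k)"
    and even_power_sum: "even k \<Longrightarrow> (\<Sum>j\<in>totatives (aur_n' n). r j ^ k) = of_real (aur_q n k)"
    and root_sq: "j \<in> totatives (aur_n' n) \<Longrightarrow> r j ^ 2 \<in> prim_roots (aur_n' n)"
    and inj_root_sq: "inj_on (\<lambda>j. r j ^ 2) (totatives (aur_n' n))"
    and norm_root: "j \<in> totatives (aur_n' n) \<Longrightarrow> cmod (r j) = 1"
    and root_int: "j \<in> totatives (aur_n' n) \<Longrightarrow> \<exists>w. r j = ev w (zeta (4 * n) 1)"

lemma chi_power_zeta:
  assumes "c = 1 \<or> c = (- 1 :: int)"
  shows "odd k \<Longrightarrow> (of_int c * zeta m j) ^ k = of_int c * zeta m (j * int k)"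
    and "even k \<Longrightarrow> (of_int c * zeta m j) ^ k = zeta m (j * int k)"
  using assms by (auto simp: zeta_mult_nat power_mult_distrib)

lemma periodic_cong:
  fixes f :: "int \<Rightarrow> 'a"
  assumes f: "\<And>j. f (j + p) = f j" and ij: "[i = j] (mod p)"
  shows "f i = f j"
proof -
  have pos: "f (j + int t * p) = f j" for j :: int and t
  proof (induction t)
    case (Suc t)
    have "f (j + int (Suc t) * p) = f ((j + int t * p) + p)" by (simp add: algebra_simps)
    then show ?case using Suc f by simp
  qed simp
  obtain t where t: "i - j = p * t" using ij by (auto simp: cong_iff_dvd_diff elim: dvdE)
  show ?thesis
  proof (cases "t \<ge> 0")
    case True
    then have "i = j + int (nat t) * p" using t by (simp add: algebra_simps)
    then show ?thesis by (simp only: pos)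
  next
    case False
    then have "j = i + int (nat (- t)) * p" using t by (simp add: algebra_simps)
    then show ?thesis by (simp only: pos)
  qed
qed

lemma coprime_4_iff: "coprime (j :: int) 4 \<longleftrightarrow> odd j"
  using coprime_power_right_iff[of j 2 2] by simp

lemma ex_aur_roots:
  assumes n: "n > 1" "squarefree n"
  shows "\<exists>r g. aur_roots n r g"
proof -
  define m where "m = (if n mod 4 = 1 then n else 4 * n)"
  obtain \<chi> where \<chi>: "prim_char m \<chi>" "\<chi> (- 1) = 1" "n mod 4 \<noteq> 1 \<longrightarrow> (\<forall>k. \<chi> (k + 2 * int n) = - \<chi> k)"
    using ex_prim_char[of n] n by (auto simp: m_def)
  interpret prim_char m \<chi> by fact
  define r where "r = (\<lambda>j. of_int (\<chi> (int j)) * zeta m (int j))"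
  \<comment> \<open>For conductor \<open>4 * n\<close> only half of the Gauss sum is met, and its
    square is then \<open>4 * n / 4\<close>.\<close>
  define g where "g = (if n mod 4 = 1 then gauss_sum 1 else gauss_sum 1 / 2)"
  define T where "T = totatives (aur_n' n)"
  have n'0: "aur_n' n > 0" using n by (simp add: aur_n'_def)
  have cop: "coprime (int j) (int m)" if "j \<in> T" for j
    using that by (cases "n mod 4 = 1") (auto simp: T_def in_totatives_iff m_def aur_n'_def coprime_4_iff)
  have u: "\<chi> (int j) = 1 \<or> \<chi> (int j) = - 1" if "j \<in> T" for j
    using unit[OF cop[OF that]] .
  have r_odd: "r j ^ k = of_int (\<chi> (int j)) * zeta m (int j * int k)" if "j \<in> T" "odd k" for j k
    unfolding r_def using chi_power_zeta(1)[OF u[OF that(1)] that(2)] .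
  have r_even: "r j ^ k = zeta m (int j * int k)" if "j \<in> T" "even k" for j k
    unfolding r_def using chi_power_zeta(2)[OF u[OF that(1)] that(2)] .
  have q_odd: "of_real (aur_q n k) = complex_of_int (\<chi> (int k))" if "odd k" for k
    using jacobi_eq_prim_char[of n \<chi> k] \<chi>(1,2) that by (simp add: aur_q_def m_def)
  have g: "g ^ 2 = of_nat n"
    using gauss_sum_sq \<chi>(2) by (auto simp: g_def m_def power_divide)
  have per: "of_int (\<chi> i) * zeta m (i * k) = of_int (\<chi> j) * zeta m (j * k)"
    if "[i = j] (mod int m)" for i j k
    using cong[OF that] zeta_cong[OF cong_scalar_right[OF that, of k]] by simp
  have odd_sum: "(\<Sum>j\<in>T. r j ^ k) = g * of_real (aur_q n k)" if k: "odd k" for k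
  proof -
    define f where "f = (\<lambda>j. of_int (\<chi> j) * zeta m (j * int k))"
    have "(\<Sum>j\<in>T. r j ^ k) = (\<Sum>j\<in>T. f (int j))"
      using r_odd k by (simp add: f_def)
    also have "\<dots> = g * of_int (\<chi> (int k))"
    proof (cases "n mod 4 = 1")
      case True
      then have m: "m = n" "T = totatives m" by (simp_all add: m_def T_def aur_n'_def)
      have "(\<Sum>j\<in>T. f (int j)) = (\<Sum>j\<in>{0..<int m}. if coprime j (int m) then f j else 0)"
        unfolding m(2) by (rule sum_totatives_eq[OF m_pos]) (simp add: f_def per)
      also have "\<dots> = gauss_sum (int k)"
        unfolding gauss_sum_def by (rule sum.cong) (auto simp: f_def non_unit)
      finally show ?thesis using gauss_sum_eq[of "int k"] True by (simp add: g_def mult.commute)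
    next
      case False
      then have m: "m = 4 * n" "T = totatives (2 * n)" by (simp_all add: m_def T_def aur_n'_def)
      \<comment> \<open>For odd \<open>k\<close> the character and the root of unity both change
        sign, so their product is periodic modulo \<open>2 * n\<close>.\<close>
      have shift: "f (j + int (2 * n)) = f j" for j
      proof -
        have "zeta m (int (2 * n)) = - 1" using n by (simp add: m zeta_def)
        then have "zeta m (int (2 * n) * int k) = - 1" using k by (simp add: zeta_mult_nat)
        then have "zeta m ((j + int (2 * n)) * int k) = - zeta m (j * int k)"
          by (simp only: distrib_right zeta_add) simp
        then show ?thesis using \<chi>(3) False by (simp add: f_def)
      qed
      have fp: "f i = f j" if "[i = j] (mod int (2 * n))" for i j
        using periodic_cong[of f "int (2 * n)", OF shift that] .
      have "(\<Sum>j\<in>T. f (int j)) = (\<Sum>j\<in>{0..<int (2 * n)}. if coprime j (int (2 * n)) then f j else 0)"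
        unfolding m(2) using n by (intro sum_totatives_eq fp) auto
      also have "\<dots> = (\<Sum>j\<in>{0..<int (2 * n)}. f j)"
      proof (rule sum.cong)
        fix j :: int
        have iff: "coprime j (int (2 * n)) \<longleftrightarrow> coprime j (int m)"
          by (simp add: m coprime_4_iff)
        show "(if coprime j (int (2 * n)) then f j else 0) = f j"
          unfolding iff using non_unit[of j] by (simp add: f_def)
      qed simp
      finally have 1: "(\<Sum>j\<in>T. f (int j)) = (\<Sum>j\<in>{0..<int (2 * n)}. f j)" .
      have "gauss_sum (int k) = (\<Sum>j\<in>{0..<int m}. f j)"
        by (simp add: gauss_sum_def f_def)
      also have "int m = int (4 * n)" by (simp only: m)
      also have "{0..<int (4 * n)} = {0..<int (2 * n)} \<union> (\<lambda>j. j + int (2 * n)) ` {0..<int (2 * n)}"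
      proof -
        have "(\<lambda>j. j + int (2 * n)) ` {0..<int (2 * n)} = {int (2 * n)..<int (4 * n)}"
          by (simp add: image_add_atLeastLessThan')
        then show ?thesis by auto
      qed
      also have "sum f \<dots> = (\<Sum>j\<in>{0..<int (2 * n)}. f j) + sum f ((\<lambda>j. j + int (2 * n)) ` {0..<int (2 * n)})"
        by (rule sum.union_disjoint) auto
      also have "sum f ((\<lambda>j. j + int (2 * n)) ` {0..<int (2 * n)}) = (\<Sum>j\<in>{0..<int (2 * n)}. f j)"
        by (subst sum.reindex) (simp_all add: shift inj_on_def del: of_nat_mult)
      finally have "gauss_sum (int k) = 2 * (\<Sum>j\<in>T. f (int j))" using 1 by simp
      then show ?thesis using gauss_sum_eq[of "int k"] False by (simp add: g_def mult.commute)
    qed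
    finally show ?thesis using q_odd[OF k] by simp
  qed
  have even_sum: "(\<Sum>j\<in>T. r j ^ k) = of_real (aur_q n k)" if k: "even k" for k
  proof (cases "n mod 4 = 1")
    case True
    then have "(\<Sum>j\<in>T. r j ^ k) = ramanujan n (int k)"
      using r_even k by (simp add: ramanujan_def T_def aur_n'_def m_def)
    then show ?thesis using ramanujan_aur_q[OF n(2,1) k] True by simp
  next
    case False
    obtain l where l: "k = 2 * l" using k by (auto elim: evenE)
    have "zeta m (int j * int k) = zeta (2 * n) (int j * int l)" for j
      using zeta_cancel[of 2 "2 * n" "int j * int l"] False by (simp add: m_def l mult_ac)
    then have "(\<Sum>j\<in>T. r j ^ k) = ramanujan (2 * n) (int l)"
      using r_even k False by (simp add: ramanujan_def T_def aur_n'_def)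
    then show ?thesis using ramanujan_aur_q[OF n(2,1) k] False by (simp add: l)
  qed
  \<comment> \<open>Squaring doubles the index if \<open>n' = n\<close>; if
    \<open>n' = 2 * n\<close> it halves the order \<open>4 * n\<close> and keeps the index.\<close>
  define e where "e j = (if n mod 4 = 1 then 2 * int j else int j)" for j
  have sq: "r j ^ 2 = zeta (aur_n' n) (e j)" if "j \<in> T" for j
  proof (cases "n mod 4 = 1")
    case True
    then show ?thesis using r_even[OF that, of 2] by (simp add: m_def aur_n'_def e_def mult.commute)
  next
    case False
    then show ?thesis using r_even[OF that, of 2] zeta_cancel[of 2 "2 * n" "int j"]
      by (simp add: m_def aur_n'_def e_def mult_ac)
  qed
  have "coprime (e j) (int (aur_n' n))" if "j \<in> T" for j
  proof (cases "n mod 4 = 1")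
    case True
    then have "odd n" by presburger
    then show ?thesis using True that by (simp add: e_def aur_n'_def T_def in_totatives_iff)
  next
    case False
    then show ?thesis using that by (simp add: e_def aur_n'_def T_def in_totatives_iff)
  qed
  then have sq_in: "r j ^ 2 \<in> prim_roots (aur_n' n)" if "j \<in> T" for j
    using sq[OF that] that n'0 by (simp add: zeta_in_prim_roots)
  have inj: "inj_on (\<lambda>j. r j ^ 2) T"
  proof (rule inj_onI)
    fix i j assume ij: "i \<in> T" "j \<in> T" "r i ^ 2 = r j ^ 2"
    then have c: "[e i = e j] (mod int (aur_n' n))" by (simp add: sq zeta_eq_iff[OF n'0])
    have "[int i = int j] (mod int (aur_n' n))"
    proof (cases "n mod 4 = 1")
      case True
      then have "odd n" by presburger
      then show ?thesis using c True by (simp add: e_def aur_n'_def cong_mult_lcancel)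
    next
      case False
      then show ?thesis using c by (simp add: e_def)
    qed
    then have "zeta (aur_n' n) (int i) = zeta (aur_n' n) (int j)" by (rule zeta_cong)
    then show "i = j" using inj_on_zeta_totatives ij(1,2) unfolding T_def by (auto dest: inj_onD)
  qed
  have norm: "cmod (r j) = 1" if "j \<in> T" for j
    using u[OF that] by (auto simp: r_def norm_mult zeta_def)
  have int: "\<exists>w. r j = ev w (zeta (4 * n) 1)" for j
  proof -
    \<comment> \<open>Expressing everything by the root of order \<open>4 * n\<close> gives one ring
      Z[\<zeta>] for all cases.\<close>
    define s where "s = (if n mod 4 = 1 then 4 * j else j)"
    have "zeta m (int j) = zeta (4 * n) (1 * int s)"
      using zeta_cancel[of 4 n "int j"] by (simp add: m_def s_def mult.commute)
    then have "r j = ev (Polynomial.monom (\<chi> (int j)) s) (zeta (4 * n) 1)"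
      by (simp only: zeta_mult_nat r_def ev_monom)
    then show ?thesis by blast
  qed
  have "aur_roots n r g"
    by unfold_locales (use n g odd_sum even_sum sq_in inj norm int in \<open>auto simp: T_def\<close>)
  then show ?thesis by blast
qed

section \<open>The coefficients\<close>

lemma aur_n'_gt_2: "n > 1 \<Longrightarrow> aur_n' n > 2"
  by (cases "n = 2") (auto simp: aur_n'_def split: if_splits)

lemma aur_d: "n > 1 \<Longrightarrow> totient (aur_n' n) = 2 * aur_d n"
  using totient_even[OF aur_n'_gt_2] by (auto simp: aur_d_def)

lemma aur_d_pos: "n > 1 \<Longrightarrow> aur_d n > 0"
  using totient_gt_1[OF aur_n'_gt_2, of n] aur_d[of n] by simp

lemma aur_q_Ints:
  assumes "n \<ge> 1"
  shows "aur_q n k \<in> \<int>"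
proof (cases "odd k")
  case False
  then show ?thesis using aur_q_even[of k n] assms by (simp only: Ints_of_int even_iff_mod_2_eq_zero not_not)
qed (simp add: aur_q_def)

lemma aur_q_1 [simp]: "aur_q n (Suc 0) = 1"
  by (simp add: aur_q_def jacobi_def)

lemma one_notin_prim_roots:
  assumes "m > 1"
  shows "1 \<notin> prim_roots m"
proof
  assume "1 \<in> prim_roots m"
  then obtain j where j: "j \<in> totatives m" "zeta m (int j) = 1" by (auto simp: prim_roots_def)
  then have "int m dvd int j" using zeta_eq_1_iff[of m "int j"] assms by simp
  then show False using totatives_less[OF j(1) assms] j(1) by (auto dest: dvd_imp_le)
qed

lemma ev_coeff_prod_linear:
  assumes "finite A" "\<And>j. j \<in> A \<Longrightarrow> \<exists>w. r j = ev w z"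
  shows "\<exists>w. Polynomial.coeff (\<Prod>j\<in>A. [:1, - r j:]) k = ev w z"
  using assms
proof (induction A arbitrary: k)
  case empty
  show ?case by (rule exI[of _ "if k = 0 then 1 else 0"]) simp
next
  case (insert x A)
  obtain u where u: "r x = ev u z" using insert.prems by blast
  obtain w where w: "\<And>k. Polynomial.coeff (\<Prod>j\<in>A. [:1, - r j:]) k = ev (w k) z"
    using insert.IH insert.prems by (metis insertCI)
  have "Polynomial.coeff (\<Prod>j\<in>insert x A. [:1, - r j:]) k =
      ev (case k of 0 \<Rightarrow> w 0 | Suc l \<Rightarrow> w (Suc l) - u * w l) z"
    using insert.hyps u by (simp add: w split: nat.split)
  then show ?case by blast
qed

context aur_roots
begin

definition d :: nat where "d = aur_d n"

text \<open>The factors are \<open>1 - r y\<close> rather than \<open>y - r\<close>, so that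
  Newton's identities start from coefficient 1 and run in the order of the algorithm;
  \<open>reflect_Q\<close> shows that both forms agree.\<close>

definition Q :: "complex poly" where
  "Q = (\<Prod>j\<in>totatives (aur_n' n). [:1, - r j:])"

abbreviation a :: "nat \<Rightarrow> complex" where "a \<equiv> Polynomial.coeff Q"

lemma card_totatives: "card (totatives (aur_n' n)) = 2 * d"
  using aur_d[OF n_gt_1] by (simp add: d_def totient_def)

lemma r_nonzero: "j \<in> totatives (aur_n' n) \<Longrightarrow> r j \<noteq> 0"
  using norm_root by force

lemma degree_Q: "degree Q = 2 * d"
proof -
  have "degree Q = (\<Sum>j\<in>totatives (aur_n' n). degree [:1, - r j:])"
    unfolding Q_def by (rule degree_prod_sum_eq) simp
  also have "\<dots> = (\<Sum>j\<in>totatives (aur_n' n). 1)"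
    using r_nonzero by (intro sum.cong) auto
  finally show ?thesis by (simp add: card_totatives)
qed

lemma a_0 [simp]: "a 0 = 1"
proof -
  have "poly Q 0 = 1" by (simp add: Q_def poly_prod)
  then show ?thesis by (simp add: poly_0_coeff_0)
qed

lemma newton_Q: "of_nat k * a k = - (\<Sum>i<k. a i * (\<Sum>j\<in>totatives (aur_n' n). r j ^ (k - i)))"
  unfolding Q_def by (rule newton_identity) simp

lemma newton_even:
  "of_nat (2 * k) * a (2 * k) =
    - (\<Sum>j<k. a (2 * j) * of_real (aur_q n (2 * k - 2 * j)) +
        a (2 * j + 1) * (g * of_real (aur_q n (2 * k - 2 * j - 1))))"
  unfolding newton_Q sum_even_odd
  by (intro arg_cong[of _ _ uminus] sum.cong refl) (simp add: odd_power_sum even_power_sum)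

lemma newton_odd:
  "of_nat (2 * k + 1) * a (2 * k + 1) =
    - ((\<Sum>j<k. a (2 * j) * (g * of_real (aur_q n (2 * k + 1 - 2 * j))) +
        a (2 * j + 1) * of_real (aur_q n (2 * k - 2 * j))) + g * a (2 * k))"
proof -
  \<comment> \<open>An odd number of terms leaves \<open>i = 2 * k\<close> unpaired; its power sum
    is \<open>g\<close> because q at 1 is 1.\<close>
  have "(\<Sum>i<2 * k + 1. a i * (\<Sum>j\<in>totatives (aur_n' n). r j ^ (2 * k + 1 - i))) =
     (\<Sum>i<2 * k. a i * (\<Sum>j\<in>totatives (aur_n' n). r j ^ (2 * k + 1 - i))) + g * a (2 * k)"
    using odd_power_sum[of 1] by simp
  also have "(\<Sum>i<2 * k. a i * (\<Sum>j\<in>totatives (aur_n' n). r j ^ (2 * k + 1 - i))) =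
    (\<Sum>j<k. a (2 * j) * (g * of_real (aur_q n (2 * k + 1 - 2 * j))) +
        a (2 * j + 1) * of_real (aur_q n (2 * k - 2 * j)))"
    unfolding sum_even_odd by (intro sum.cong refl) (simp add: odd_power_sum even_power_sum)
  finally show ?thesis unfolding newton_Q[of "2 * k + 1"] by (simp only:)
qed

text \<open>Both square roots of \<open>n\<close> are real, so the sign can stay open. Reality
  passes to the coefficients of \<open>Q\<close> and from there to its palindromic symmetry.\<close>

lemma g_real: "g \<in> \<real>"
proof -
  have "(g - x) * (g + x) = g ^ 2 - x ^ 2" for x by (simp add: power2_eq_square algebra_simps)
  then have "(g - of_real (sqrt n)) * (g + of_real (sqrt n)) = g ^ 2 - of_real (sqrt n ^ 2)"
    by (simp only: of_real_power)
  also have "\<dots> = 0" by (simp add: g_sq del: of_real_power)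
  finally have "g = of_real (sqrt n) \<or> g = of_real (- sqrt n)"
    by (auto simp: eq_neg_iff_add_eq_0)
  then show ?thesis by (auto simp only: Reals_of_real)
qed

lemma power_sum_real: "(\<Sum>j\<in>totatives (aur_n' n). r j ^ k) \<in> \<real>"
  using odd_power_sum[of k] even_power_sum[of k] g_real by (cases "odd k") auto

lemma a_real: "a k \<in> \<real>"
proof (induction k rule: less_induct)
  case (less k)
  show ?case
  proof (cases "k = 0")
    case False
    have "of_nat k * a k \<in> \<real>"
    proof -
      have "a i * (\<Sum>j\<in>totatives (aur_n' n). r j ^ (k - i)) \<in> \<real>" if "i < k" for i
        by (intro Reals_mult less that power_sum_real)
      then have "(\<Sum>i<k. a i * (\<Sum>j\<in>totatives (aur_n' n). r j ^ (k - i))) \<in> \<real>"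
        by (intro sum_in_Reals) simp
      then show ?thesis by (simp only: newton_Q Reals_minus_iff)
    qed
    then have "of_nat k * a k / of_nat k \<in> \<real>" by (intro Reals_divide) auto
    then show ?thesis using False by simp
  qed simp
qed

lemma reflect_Q_eq: "reflect_poly Q = (\<Prod>j\<in>totatives (aur_n' n). [:- r j, 1:])"
  unfolding Q_def reflect_poly_prod
  by (intro prod.cong refl) (auto simp: reflect_poly_def r_nonzero)

text \<open>The roots lie on the unit circle, so inverting them is conjugating them, which does not
  change the real polynomial \<open>Q\<close>. The sign is fixed by \<open>Q(1) \<noteq> 0\<close>.\<close>

lemma reflect_Q: "reflect_poly Q = Q"
proof -
  define c where "c = (\<Prod>j\<in>totatives (aur_n' n). - r j)"
  have "map_poly cnj Q = Q"
    using a_real by (intro poly_eqI) (simp add: coeff_map_poly Reals_cnj_iff)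
  then have cnj_Q: "poly Q x = cnj (poly Q (cnj x))" for x
    by (metis poly_map_poly_cnj)
  have "poly (reflect_poly Q) x = c * poly Q x" for x
  proof -
    have "x - r j = - r j * cnj (1 - r j * cnj x)" if "j \<in> totatives (aur_n' n)" for j
    proof -
      have "r j * cnj (r j) = 1" using norm_root[OF that] complex_norm_square[of "r j"] by simp
      moreover have "- r j * cnj (1 - r j * cnj x) = r j * cnj (r j) * x - r j"
        by (simp add: algebra_simps)
      ultimately show ?thesis by simp
    qed
    then have "poly (reflect_poly Q) x = (\<Prod>j\<in>totatives (aur_n' n). - r j * cnj (1 - r j * cnj x))"
      unfolding reflect_Q_eq poly_prod by (intro prod.cong refl) simp
    also have "\<dots> = c * cnj (poly Q (cnj x))"
      unfolding prod.distrib c_def[symmetric] by (simp add: Q_def poly_prod mult.commute)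
    finally show ?thesis unfolding cnj_Q[of x, symmetric] .
  qed
  then have "poly (reflect_poly Q) = poly (Polynomial.smult c Q)"
    by (intro ext) simp
  then have eq: "reflect_poly Q = Polynomial.smult c Q"
    by (simp only: poly_eq_poly_eq_iff)
  have "poly (reflect_poly Q) 1 = poly Q 1"
    using poly_reflect_poly_nz[of 1 Q] by simp
  moreover have "poly Q 1 \<noteq> 0"
  proof -
    have "r j \<noteq> 1" if "j \<in> totatives (aur_n' n)" for j
    proof
      assume "r j = 1"
      then have "1 \<in> prim_roots (aur_n' n)" using root_sq[OF that] by simp
      then show False using one_notin_prim_roots aur_n'_gt_2[OF n_gt_1] by auto
    qed
    then show ?thesis by (auto simp: Q_def poly_prod)
  qed
  ultimately have "c = 1" using eq by simp
  then show ?thesis using eq by simp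
qed

lemma a_sym: "k \<le> 2 * d \<Longrightarrow> a (2 * d - k) = a k"
  using coeff_reflect_poly[of Q k] by (simp add: reflect_Q degree_Q)

lemma poly_Q: "poly Q y = (\<Prod>j\<in>totatives (aur_n' n). y - r j)"
proof -
  have "poly Q y = poly (\<Prod>j\<in>totatives (aur_n' n). [:- r j, 1:]) y"
    by (simp only: reflect_Q reflect_Q_eq[symmetric])
  then show ?thesis by (simp add: poly_prod)
qed

text \<open>Strong induction on the index in \<open>Q\<close>, which alternates between \<gamma> and
  \<delta> just as step 3 does. In each parity the cases are the initial value, the recurrence,
  which is Newton's identity, and the mirrored half.\<close>

lemma coeffs_Q:
  "(\<forall>k. K = 2 * k \<and> k \<le> d \<longrightarrow> a (2 * k) = of_real (aur_gamma n k)) \<and>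
   (\<forall>k. K = 2 * k + 1 \<and> k < d \<longrightarrow> a (2 * k + 1) = - g * of_real (aur_delta n k))"
proof (induction K rule: less_induct)
  case (less K)
  have IH1: "a (2 * k) = of_real (aur_gamma n k)" if "2 * k < K" "k \<le> d" for k
    using less that by blast
  have IH2: "a (Suc (2 * k)) = - g * of_real (aur_delta n k)" if "Suc (2 * k) < K" "k < d" for k
    using less[of "Suc (2 * k)"] that by simp
  have A: "a (2 * k) = of_real (aur_gamma n k)" if k: "K = 2 * k" "k \<le> d" for k
  proof -
    consider "k = 0" | "0 < k" "k \<le> d div 2" | "k > d div 2" by linarith
    then show ?thesis
    proof cases
      case 1
      then show ?thesis by (subst aur_gamma.simps) simp
    next
      case 2
      define A where "A j = a (2 * j) * of_real (aur_q n (2 * k - 2 * j)) +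
            a (2 * j + 1) * (g * of_real (aur_q n (2 * k - 2 * j - 1)))" for j
      define B where "B j = real n * aur_q n (2 * k - 2 * j - 1) * aur_delta n j
                   - aur_q n (2 * k - 2 * j) * aur_gamma n j" for j
      \<comment> \<open>The \<open>g\<close> of the odd power sum and the \<open>g\<close> of the
        odd coefficient multiply to \<open>n\<close>.\<close>
      have AB: "A j = - of_real (B j)" if "j < k" for j
        using that k IH1[of j] IH2[of j] g_sq by (simp add: A_def B_def power2_eq_square algebra_simps)
      have "of_nat (2 * k) * a (2 * k) = - (\<Sum>j<k. A j)" by (simp only: newton_even A_def)
      also have "\<dots> = of_real (\<Sum>j<k. B j)" using AB by (simp add: sum_negf)
      finally have "a (2 * k) = of_real (1 / (2 * real k) * (\<Sum>j<k. B j))"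
        using 2 by (simp add: field_simps)
      also have "\<dots> = of_real (aur_gamma n k)"
        using 2 by (subst (1) aur_gamma.simps) (simp add: d_def B_def)
      finally show ?thesis .
    next
      case 3
      \<comment> \<open>The degree \<open>2 * d\<close> is even, so the symmetry of \<open>Q\<close>
        preserves the parity of the index and mirrors \<gamma> within itself.\<close>
      then have "a (2 * (d - k)) = of_real (aur_gamma n (d - k))" using k by (intro IH1) auto
      moreover have "a (2 * (d - k)) = a (2 * k)" using a_sym[of "2 * k"] k by (simp add: diff_mult_distrib2)
      moreover have "aur_gamma n k = aur_gamma n (d - k)"
        using 3 k by (subst aur_gamma.simps) (simp add: d_def)
      ultimately show ?thesis by simp
    qed
  qed
  have B: "a (2 * k + 1) = - g * of_real (aur_delta n k)" if k: "K = 2 * k + 1" "k < d" for k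
  proof -
    consider "k = 0" | "0 < k" "k \<le> (d - 1) div 2" | "k > (d - 1) div 2" by linarith
    then show ?thesis
    proof cases
      case 1
      have "aur_delta n 0 = 1" by (subst aur_delta.simps) simp
      then show ?thesis using 1 newton_odd[of 0] by simp
    next
      case 2
      define A where "A j = a (2 * j) * (g * of_real (aur_q n (2 * k + 1 - 2 * j))) +
            a (2 * j + 1) * of_real (aur_q n (2 * k - 2 * j))" for j
      define B where "B j = aur_q n (2 * k + 1 - 2 * j) * aur_gamma n j
                    - aur_q n (2 * k - 2 * j) * aur_delta n j" for j
      \<comment> \<open>Each term carries exactly one \<open>g\<close>, either from the power sum or
        from the coefficient.\<close>
      have AB: "A j = g * of_real (B j)" if "j < k" for j
        using that k IH1[of j] IH2[of j] by (simp add: A_def B_def algebra_simps)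
      have "a (2 * k) = of_real (aur_gamma n k)" using k by (intro IH1) auto
      then have "of_nat (2 * k + 1) * a (2 * k + 1) = - ((\<Sum>j<k. A j) + g * of_real (aur_gamma n k))"
        by (simp only: newton_odd A_def)
      also have "\<dots> = - g * of_real (aur_gamma n k + (\<Sum>j<k. B j))"
        using AB by (simp add: sum_distrib_left sum_negf algebra_simps)
      finally have eq: "of_nat (2 * k + 1) * a (2 * k + 1) = - g * of_real (aur_gamma n k + (\<Sum>j<k. B j))" .
      have nz: "(of_nat (2 * k + 1) :: complex) \<noteq> 0" by (simp only: of_nat_eq_0_iff)
      have "a (2 * k + 1) = - g * of_real (aur_gamma n k + (\<Sum>j<k. B j)) / of_nat (2 * k + 1)"
        unfolding nonzero_eq_divide_eq[OF nz] using eq by (simp only: mult.commute[of "a (2 * k + 1)"])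
      also have "\<dots> = - g * of_real (1 / (2 * real k + 1) * (aur_gamma n k + (\<Sum>j<k. B j)))"
        by simp
      also have "1 / (2 * real k + 1) * (aur_gamma n k + (\<Sum>j<k. B j)) = aur_delta n k"
        using 2 by (subst (1) aur_delta.simps) (simp add: d_def B_def)
      finally show ?thesis .
    next
      case 3
      then have "a (Suc (2 * (d - 1 - k))) = - g * of_real (aur_delta n (d - 1 - k))" using k by (intro IH2) auto
      moreover have "2 * d - (2 * k + 1) = Suc (2 * (d - 1 - k))" using k by simp
      then have "a (Suc (2 * (d - 1 - k))) = a (2 * k + 1)" using a_sym[of "2 * k + 1"] k by simp
      moreover have "aur_delta n k = aur_delta n (d - 1 - k)"
        using 3 k by (subst aur_delta.simps) (simp add: d_def)
      ultimately show ?thesis by simp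
    qed
  qed
  show ?case using A B by blast
qed

lemma coeff_Q_even: "k \<le> d \<Longrightarrow> a (2 * k) = of_real (aur_gamma n k)"
  using coeffs_Q by blast

lemma coeff_Q_odd: "k < d \<Longrightarrow> a (2 * k + 1) = - g * of_real (aur_delta n k)"
  using coeffs_Q by blast

lemma a_ev: "\<exists>w. a k = ev w (zeta (4 * n) 1)"
  unfolding Q_def using root_int by (intro ev_coeff_prod_linear) auto

end

section \<open>Integrality of the computed coefficients\<close>

lemma rational_ev_imp_int:
  assumes z: "z ^ N = 1" "N > 0" and x: "x \<in> \<rat>" "of_real x = ev w z"
  shows "x \<in> \<int>"
proof -
  obtain a b :: int where ab: "b > 0" "coprime a b" "x = of_int a / of_int b"
    using x(1) by (rule Rats_cases')
  have "of_int b * ev w z = of_int a" using ab by (simp flip: x(2))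
  then have "b dvd a" by (rule root_of_unity_int_dvd[OF z])
  then show ?thesis using ab by (auto elim!: dvdE)
qed

lemma aur_gamma_delta_Rats:
  assumes "n \<ge> 1"
  shows "aur_gamma n k \<in> \<rat>" "aur_delta n k \<in> \<rat>"
proof -
  have q: "aur_q n i \<in> \<rat>" for i using aur_q_Ints[OF assms] Ints_subset_Rats by blast
  have "aur_gamma n k \<in> \<rat> \<and> aur_delta n k \<in> \<rat>"
  proof (induction k rule: less_induct)
    case (less k)
    have 1: "aur_gamma n k \<in> \<rat>"
      using less q by (subst aur_gamma.simps) (auto intro!: Rats_mult Rats_divide Rats_diff Rats_sum)
    then show ?case
      using less q by (subst aur_delta.simps) (auto intro!: Rats_mult Rats_divide Rats_diff Rats_add Rats_sum)
  qed
  then show "aur_gamma n k \<in> \<rat>" "aur_delta n k \<in> \<rat>" by auto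
qed

text \<open>In lowest terms the square of the denominator divides \<open>n\<close>.\<close>

lemma squarefree_rational_sq_int:
  assumes n: "squarefree n" and x: "x \<in> \<rat>" "real n * x ^ 2 \<in> \<int>"
  shows "x \<in> \<int>"
proof -
  obtain a b :: int where ab: "b > 0" "coprime a b" "x = of_int a / of_int b"
    using x(1) by (rule Rats_cases')
  obtain t where "real n * x ^ 2 = of_int t" using x(2) by (auto elim: Ints_cases)
  then have "real_of_int (int n * a ^ 2) = real_of_int (t * b ^ 2)"
    using ab by (simp add: field_simps)
  then have "int n * a ^ 2 = t * b ^ 2" by (simp only: of_int_eq_iff)
  then have "b ^ 2 dvd int n * a ^ 2" by simp
  moreover have "coprime (b ^ 2) (a ^ 2)" using ab(2) by (simp add: coprime_commute)
  ultimately have "b ^ 2 dvd int n" by (simp add: coprime_dvd_mult_left_iff)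
  then have "(nat b) ^ 2 dvd n" using ab(1)
    by (metis int_dvd_int_iff int_nat_eq less_imp_le of_nat_power)
  then have "nat b dvd 1" using n squarefreeD by blast
  then have "b = 1" using ab(1) by simp
  then show ?thesis using ab(3) by simp
qed

text \<open>Each \<gamma> is a rational number in Z[\<zeta>]. For \<delta> only its product with
  \<open>g\<close> is known to lie there; the square of this product is rational, hence an integer,
  and square-freeness of \<open>n\<close> removes the denominator.\<close>

lemma aur_gamma_delta_Ints:
  assumes n: "n > 1" "squarefree n"
  shows "k \<le> aur_d n \<Longrightarrow> aur_gamma n k \<in> \<int>" "k < aur_d n \<Longrightarrow> aur_delta n k \<in> \<int>"
proof -
  obtain r g where "aur_roots n r g" using ex_aur_roots[OF n] by blast
  then interpret aur_roots n r g .
  define z where "z = zeta (4 * n) 1"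
  have z: "z ^ (4 * n) = 1" "4 * n > 0"
  proof -
    have "zeta (4 * n) 1 ^ (4 * n) = zeta (4 * n) (1 * int (4 * n))" by (simp only: zeta_mult_nat)
    also have "\<dots> = 1" using n by (subst zeta_eq_1_iff) auto
    finally show "z ^ (4 * n) = 1" by (simp only: z_def)
  qed (use n in simp)
  show "aur_gamma n k \<in> \<int>" if "k \<le> aur_d n"
  proof -
    obtain w where "a (2 * k) = ev w z" using a_ev z_def by blast
    then have "of_real (aur_gamma n k) = ev w z" using coeff_Q_even[of k] that by (simp add: d_def)
    then show ?thesis using rational_ev_imp_int[OF z] aur_gamma_delta_Rats(1) n by auto
  qed
  show "aur_delta n k \<in> \<int>" if "k < aur_d n"
  proof -
    obtain w where "a (2 * k + 1) = ev w z" using a_ev z_def by blast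
    then have "- g * of_real (aur_delta n k) = ev w z" using coeff_Q_odd[of k] that by (simp add: d_def)
    note h = this
    have "ev (w * w) z = (- g * of_real (aur_delta n k)) * (- g * of_real (aur_delta n k))"
      by (simp only: ev_mult h)
    also have "\<dots> = (g ^ 2) * of_real (aur_delta n k ^ 2)" by (simp add: power2_eq_square)
    finally have "of_real (real n * aur_delta n k ^ 2) = ev (w * w) z" by (simp add: g_sq)
    moreover have "real n * aur_delta n k ^ 2 \<in> \<rat>" using aur_gamma_delta_Rats(2) n by auto
    ultimately have "real n * aur_delta n k ^ 2 \<in> \<int>" using rational_ev_imp_int[OF z] by blast
    moreover have "aur_delta n k \<in> \<rat>" using aur_gamma_delta_Rats(2) n by simp
    ultimately show ?thesis using squarefree_rational_sq_int[OF n(2)] by blast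
  qed
qed

section \<open>Existence of the Aurifeuillian factorisation\<close>

lemma lead_coeff_sum_monom_rev:
  fixes c :: "nat \<Rightarrow> 'a :: comm_ring_1"
  assumes "c 0 = 1"
  shows "lead_coeff (\<Sum>j\<le>e. Polynomial.monom (c j) (e - j)) = 1"
proof -
  let ?p = "\<Sum>j\<le>e. Polynomial.monom (c j) (e - j)"
  have "Polynomial.coeff ?p e = (\<Sum>j\<le>e. if j = 0 then c j else 0)"
    unfolding coeff_sum by (intro sum.cong) (auto simp: coeff_monom)
  then have 1: "Polynomial.coeff ?p e = 1" using assms by simp
  have "degree ?p \<le> e"
    by (intro degree_sum_le) (auto intro: order_trans[OF degree_monom_le])
  moreover have "e \<le> degree ?p" using 1 by (intro le_degree) simp
  ultimately show ?thesis using 1 by simp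
qed

text \<open>The floor only converts a real number known to be an integer.\<close>

definition gamma_poly :: "nat \<Rightarrow> int poly" where
  "gamma_poly n = (\<Sum>j\<le>aur_d n. Polynomial.monom \<lfloor>aur_gamma n j\<rfloor> (aur_d n - j))"

definition delta_poly :: "nat \<Rightarrow> int poly" where
  "delta_poly n = (\<Sum>j<aur_d n. Polynomial.monom \<lfloor>aur_delta n j\<rfloor> (aur_d n - 1 - j))"

context aur_roots
begin

lemma of_int_floor_gamma: "k \<le> d \<Longrightarrow> of_int \<lfloor>aur_gamma n k\<rfloor> = a (2 * k)"
  using aur_gamma_delta_Ints(1)[OF n_gt_1 squarefree_n, of k] coeff_Q_even[of k]
  by (auto simp: d_def elim!: Ints_cases)

lemma of_int_floor_delta: "k < d \<Longrightarrow> - g * of_int \<lfloor>aur_delta n k\<rfloor> = a (2 * k + 1)"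
  using aur_gamma_delta_Ints(2)[OF n_gt_1 squarefree_n, of k] coeff_Q_odd[of k]
  by (auto simp: d_def elim!: Ints_cases)

text \<open>The algorithm lists coefficients from the top and \<open>Q\<close> from the bottom;
  palindromic symmetry makes the orders interchangeable.\<close>

lemma ev_gamma_poly: "ev (gamma_poly n) x = (\<Sum>j\<le>d. a (2 * j) * x ^ j)"
proof -
  have "ev (gamma_poly n) x = (\<Sum>j\<le>d. of_int \<lfloor>aur_gamma n j\<rfloor> * x ^ (d - j))"
    by (simp add: gamma_poly_def d_def)
  also have "\<dots> = (\<Sum>j<Suc d. a (2 * (Suc d - Suc j)) * x ^ (Suc d - Suc j))"
  proof (rule sum.cong)
    fix j assume "j \<in> {..<Suc d}"
    then show "of_int \<lfloor>aur_gamma n j\<rfloor> * x ^ (d - j) = a (2 * (Suc d - Suc j)) * x ^ (Suc d - Suc j)"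
      using a_sym[of "2 * j"] of_int_floor_gamma[of j] by (simp add: diff_mult_distrib2)
  qed auto
  also have "\<dots> = (\<Sum>j<Suc d. a (2 * j) * x ^ j)"
    by (rule sum.nat_diff_reindex)
  finally show ?thesis by (simp add: lessThan_Suc_atMost)
qed

lemma ev_delta_poly: "- g * ev (delta_poly n) x = (\<Sum>j<d. a (2 * j + 1) * x ^ j)"
proof -
  have "- g * ev (delta_poly n) x = (\<Sum>j<d. - g * of_int \<lfloor>aur_delta n j\<rfloor> * x ^ (d - Suc j))"
    by (simp add: delta_poly_def d_def sum_distrib_left mult.assoc)
  also have "\<dots> = (\<Sum>j<d. a (2 * (d - Suc j) + 1) * x ^ (d - Suc j))"
  proof (rule sum.cong)
    fix j assume "j \<in> {..<d}"
    then have "j < d" by simp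
    then have "2 * d - (2 * j + 1) = 2 * (d - Suc j) + 1" by simp
    then have "a (2 * (d - Suc j) + 1) = a (2 * j + 1)" using a_sym[of "2 * j + 1"] \<open>j < d\<close> by simp
    then show "- g * of_int \<lfloor>aur_delta n j\<rfloor> * x ^ (d - Suc j) = a (2 * (d - Suc j) + 1) * x ^ (d - Suc j)"
      by (simp only: of_int_floor_delta[OF \<open>j < d\<close>])
  qed simp
  also have "\<dots> = (\<Sum>j<d. a (2 * j + 1) * x ^ j)"
    by (rule sum.nat_diff_reindex)
  finally show ?thesis .
qed

lemma poly_Q_split: "poly Q y = ev (gamma_poly n) (y ^ 2) - g * y * ev (delta_poly n) (y ^ 2)"
proof -
  have "poly Q y = (\<Sum>i<Suc (2 * d). a i * y ^ i)"
    by (simp add: poly_altdef degree_Q lessThan_Suc_atMost)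
  also have "\<dots> = (\<Sum>j<d. a (2 * j) * y ^ (2 * j) + a (2 * j + 1) * y ^ (2 * j + 1)) + a (2 * d) * y ^ (2 * d)"
    by (simp only: sum.lessThan_Suc sum_even_odd)
  also have "\<dots> = (\<Sum>j\<le>d. a (2 * j) * (y ^ 2) ^ j) + y * (\<Sum>j<d. a (2 * j + 1) * (y ^ 2) ^ j)"
  proof -
    have "y ^ (2 * j) = (y ^ 2) ^ j" for j by (simp only: power_mult)
    moreover from this have "y ^ (2 * j + 1) = y * (y ^ 2) ^ j" for j by simp
    ultimately show ?thesis
      by (simp only: sum.distrib sum_distrib_left mult_ac add_ac sum.lessThan_Suc flip: lessThan_Suc_atMost)
  qed
  also have "\<dots> = ev (gamma_poly n) (y ^ 2) - g * y * ev (delta_poly n) (y ^ 2)"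
    unfolding ev_gamma_poly ev_delta_poly[symmetric] by simp
  finally show ?thesis .
qed

text \<open>The squares of the \<open>r j\<close> are as many distinct primitive roots as there are
  in all.\<close>

lemma aur_F_prod: "aur_F n = (\<Prod>j\<in>totatives (aur_n' n). [:- (r j ^ 2), 1:])"
proof -
  let ?A = "(\<lambda>j. r j ^ 2) ` totatives (aur_n' n)"
  have card: "card ?A = totient (aur_n' n)"
    by (simp add: card_image inj_root_sq totient_def)
  have "cyclotomic (aur_n' n) = (\<Prod>j\<in>totatives (aur_n' n). [:- (r j ^ 2), 1:])"
  proof (rule monic_eqI[where A = ?A])
    show "lead_coeff (\<Prod>j\<in>totatives (aur_n' n). [:- (r j ^ 2), 1:]) = 1"
      "degree (\<Prod>j\<in>totatives (aur_n' n). [:- (r j ^ 2), 1:]) = card ?A"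
      using prod_linear_monic[of "totatives (aur_n' n)" "\<lambda>j. r j ^ 2"]
      unfolding card totient_def by simp_all
    show "poly (\<Prod>j\<in>totatives (aur_n' n). [:- (r j ^ 2), 1:]) z = 0" if "z \<in> ?A" for z
      using that by (auto simp: poly_prod intro!: prod_zero)
    show "poly (cyclotomic (aur_n' n)) z = 0" if "z \<in> ?A" for z
      using that root_sq by (auto intro: cyclotomic_prim_root)
  qed (simp_all add: cyclotomic_monic card)
  then show ?thesis using aur_F_eq_cyclotomic[OF squarefree_n n_gt_1] by simp
qed

lemma poly_aur_F_sq: "poly (aur_F n) (y ^ 2) = poly Q y * poly Q (- y)"
proof -
  have "poly Q (- y) = (\<Prod>j\<in>totatives (aur_n' n). - 1 * (y + r j))"
    unfolding poly_Q by (intro prod.cong refl) simp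
  \<comment> \<open>The signs cancel because there are \<open>2 * d\<close> factors.\<close>
  also have "\<dots> = (\<Prod>j\<in>totatives (aur_n' n). y + r j)"
    unfolding prod.distrib by (simp add: card_totatives)
  finally have "poly Q y * poly Q (- y) = (\<Prod>j\<in>totatives (aur_n' n). (y - r j) * (y + r j))"
    unfolding poly_Q by (simp only: prod.distrib)
  also have "\<dots> = poly (aur_F n) (y ^ 2)"
    unfolding aur_F_prod poly_prod by (intro prod.cong refl) (simp add: power2_eq_square algebra_simps)
  finally show ?thesis by simp
qed

lemma poly_aur_F:
  "poly (aur_F n) x = ev (gamma_poly n) x ^ 2 - of_nat n * x * ev (delta_poly n) x ^ 2"
proof -
  \<comment> \<open>Every complex number is a square, so the identity at \<open>y ^ 2\<close> holds
    everywhere.\<close>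
  define y where "y = csqrt x"
  define C where "C = ev (gamma_poly n) x"
  define D where "D = ev (delta_poly n) x"
  have x: "x = y ^ 2" by (simp add: y_def)
  have "poly (aur_F n) x = (C - g * y * D) * (C + g * y * D)"
    using poly_aur_F_sq[of y] poly_Q_split[of y] poly_Q_split[of "- y"] by (simp add: x C_def D_def)
  also have "\<dots> = C ^ 2 - g ^ 2 * y ^ 2 * D ^ 2"
    by (simp add: power2_eq_square algebra_simps)
  finally show ?thesis by (simp add: g_sq C_def D_def flip: x)
qed

end

lemma aur_gamma_0: "aur_gamma n 0 = 1"
  by (subst aur_gamma.simps) simp

lemma aur_delta_0: "aur_delta n 0 = 1"
  by (subst aur_delta.simps) simp

lemma aur_pair_iff:
  "aur_pair n C D \<longleftrightarrow> lead_coeff C = 1 \<and> lead_coeff D = 1 \<and>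
    (\<forall>x. poly (aur_F n) x = ev C x ^ 2 - of_nat n * x * ev D x ^ 2)"
  unfolding aur_pair_def by (simp add: poly_eq_poly_eq_iff[symmetric] fun_eq_iff ev_def mult_ac)

lemma aur_pair_exists:
  assumes n: "n > 1" "squarefree n"
  shows "aur_pair n (gamma_poly n) (delta_poly n)"
proof -
  obtain r g where "aur_roots n r g" using ex_aur_roots[OF n] by blast
  then interpret aur_roots n r g .
  have "lead_coeff (gamma_poly n) = 1"
    unfolding gamma_poly_def by (rule lead_coeff_sum_monom_rev) (simp add: aur_gamma_0)
  moreover have "{..<aur_d n} = {..aur_d n - 1}" using aur_d_pos[OF n(1)] by auto
  then have "lead_coeff (delta_poly n) = 1"
    unfolding delta_poly_def by (simp only:) (rule lead_coeff_sum_monom_rev, simp add: aur_delta_0)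
  ultimately show ?thesis using poly_aur_F by (simp add: aur_pair_iff)
qed

section \<open>Uniqueness\<close>

text \<open>Inverting the index of \<open>z\<close> modulo \<open>m\<close> writes \<open>w\<close>
  as a power of \<open>z\<close> with exponent coprime to \<open>m\<close>, to which conjugacy
  applies.\<close>

lemma ev_zero_on_prim_roots:
  assumes m: "m > 1" and B: "ev B z = 0" "z \<in> prim_roots m" and w: "w \<in> prim_roots m"
  shows "ev B w = 0"
proof -
  obtain i where i: "i \<in> totatives m" "z = zeta m (int i)" using B(2) by (auto simp: prim_roots_def)
  obtain j where j: "j \<in> totatives m" "w = zeta m (int j)" using w by (auto simp: prim_roots_def)
  have "coprime i m" "coprime j m" using i j by (auto simp: in_totatives_iff)
  obtain x where x: "[i * x = 1] (mod m)"
    using \<open>coprime i m\<close> by (auto simp: coprime_iff_invertible_nat)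
  define k where "k = x * j"
  have ik: "[i * k = j] (mod m)"
    using cong_scalar_right[OF x, of j] by (simp add: k_def mult.assoc)
  have "coprime (i * k) m" using ik \<open>coprime j m\<close> by (metis cong_imp_coprime cong_sym)
  then have k: "coprime k m" by simp
  then have "k > 0" using m by (intro Nat.gr0I) auto
  have "[int i * int k = int j] (mod int m)" using ik by (simp flip: of_nat_mult add: cong_int_iff)
  then have wz: "w = z ^ k" unfolding i j zeta_mult_nat[symmetric] by (intro zeta_cong) (rule cong_sym)
  have "z ^ m = 1"
    unfolding i zeta_mult_nat[symmetric] using m by (subst zeta_eq_1_iff) auto
  then show ?thesis unfolding wz using ev_root_coprime_power[of z m k B] k \<open>k > 0\<close> m B(1) by simp
qed

text \<open>The two terms have degrees of opposite parity, so nothing cancels at the top; as F has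
  even degree, the square of \<open>C\<close> dominates.\<close>

lemma aur_pair_degree:
  assumes n: "n > 1" "squarefree n" and p: "aur_pair n C D"
  shows "degree C = aur_d n" "degree D < aur_d n"
proof -
  let ?C = "map_poly (of_int :: int \<Rightarrow> complex) C" and ?D = "map_poly (of_int :: int \<Rightarrow> complex) D"
  have deg: "degree ?C = degree C" "degree ?D = degree D" by (auto intro: degree_map_poly)
  have nz: "?C \<noteq> 0" "?D \<noteq> 0"
    using p map_poly_of_int_inj[of C 0] map_poly_of_int_inj[of D 0] by (auto simp: aur_pair_def)
  have F: "aur_F n = ?C ^ 2 + - ([:0, of_nat n:] * ?D ^ 2)"
    using p by (simp add: aur_pair_def)
  have dF: "degree (aur_F n) = 2 * aur_d n"
    using aur_F_eq_cyclotomic[OF n(2,1)] cyclotomic_monic(1) aur_d[OF n(1)] by simp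
  have dC: "degree (?C ^ 2) = 2 * degree C" using nz deg by (simp add: degree_power_eq)
  have dD: "degree (- ([:0, of_nat n:] * ?D ^ 2)) = 2 * degree D + 1"
    using nz deg n(1) by (simp add: degree_mult_eq degree_power_eq del: mult_pCons_left)
  have "degree C = aur_d n \<and> degree D < aur_d n"
  proof (cases "2 * degree D + 1 < 2 * degree C")
    case True
    then have "degree (aur_F n) = 2 * degree C"
      unfolding F using degree_add_eq_left dC dD by metis
    then show ?thesis using dF True by simp
  next
    case False
    then have "2 * degree C < 2 * degree D + 1" by presburger
    then have "degree (aur_F n) = 2 * degree D + 1"
      unfolding F using degree_add_eq_right dC dD by metis
    then show ?thesis using dF by presburger
  qed
  then show "degree C = aur_d n" "degree D < aur_d n" by auto
qed

text \<open>At each root of \<open>F\<close> the polynomial \<open>A B\<close> vanishes, so \<open>A\<close> or \<open>B\<close> does; being conjugate, the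
  roots all agree on which one, and the degrees leave only \<open>A = 0\<close>.\<close>

lemma aur_pair_unique:
  assumes n: "n > 1" "squarefree n" and p: "aur_pair n C1 D1" "aur_pair n C2 D2"
  shows "C1 = C2 \<and> D1 = D2"
proof -
  define m where "m = aur_n' n"
  have m: "m > 1" using aur_n'_gt_2[OF n(1)] by (simp add: m_def)
  have deg: "degree C1 = aur_d n" "degree D1 < aur_d n" "degree C2 = aur_d n" "degree D2 < aur_d n"
    using aur_pair_degree[OF n p(1)] aur_pair_degree[OF n p(2)] by auto
  have lc: "lead_coeff C1 = 1" "lead_coeff D1 = 1" "lead_coeff C2 = 1" "lead_coeff D2 = 1"
    using p by (auto simp: aur_pair_def)
  have F: "poly (aur_F n) x = ev C1 x ^ 2 - of_nat n * x * ev D1 x ^ 2"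
    "poly (aur_F n) x = ev C2 x ^ 2 - of_nat n * x * ev D2 x ^ 2" for x
    using p by (auto simp: aur_pair_iff)
  \<comment> \<open>The product of \<open>A\<close> and \<open>B\<close> is
    \<open>C1^2 * D2^2 - C2^2 * D1^2\<close>, and at a root z of F each \<open>Ci^2\<close> equals
    \<open>n * z * Di^2\<close>.\<close>
  define A where "A = C1 * D2 - C2 * D1"
  define B where "B = C1 * D2 + C2 * D1"
  have small: "w = 0" if "degree w < 2 * aur_d n" "\<And>z. z \<in> prim_roots m \<Longrightarrow> ev w z = 0" for w
  proof (rule ccontr)
    assume w: "w \<noteq> 0"
    have "card (prim_roots m) \<le> card {z. ev w z = 0}"
      using that(2) ev_zero_finite(1)[OF w] by (intro card_mono) auto
    also have "\<dots> \<le> degree w" by (rule ev_zero_finite(2)[OF w])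
    finally show False using that(1) aur_d[OF n(1)] by (simp add: card_prim_roots m_def)
  qed
  have d12: "degree (C1 * D2) < 2 * aur_d n" "degree (C2 * D1) < 2 * aur_d n"
    using degree_mult_le[of C1 D2] degree_mult_le[of C2 D1] deg by linarith+
  have dA: "degree A < 2 * aur_d n" and dB: "degree B < 2 * aur_d n"
    unfolding A_def B_def using d12 by (auto intro: degree_diff_less degree_add_less)
  have AB: "ev A z = 0 \<or> ev B z = 0" if z: "z \<in> prim_roots m" for z
  proof -
    have "poly (aur_F n) z = 0"
      using cyclotomic_prim_root[OF z] aur_F_eq_cyclotomic[OF n(2,1)] by (simp add: m_def)
    then have e: "ev C1 z ^ 2 = of_nat n * z * ev D1 z ^ 2" "ev C2 z ^ 2 = of_nat n * z * ev D2 z ^ 2"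
      using F[of z] by auto
    have "ev A z * ev B z = ev C1 z ^ 2 * ev D2 z ^ 2 - ev C2 z ^ 2 * ev D1 z ^ 2"
      by (simp add: A_def B_def power2_eq_square algebra_simps)
    also have "\<dots> = 0" unfolding e by simp
    finally show ?thesis by simp
  qed
  have lcP: "lead_coeff (C1 * D2) = 1" "lead_coeff (C2 * D1) = 1" using lc by (simp_all add: lead_coeff_mult)
  have "A = 0"
  proof (rule small[OF dA])
    fix z assume z: "z \<in> prim_roots m"
    show "ev A z = 0"
    proof (rule ccontr)
      assume "ev A z \<noteq> 0"
      then have "ev B z = 0" using AB[OF z] by simp
      then have "B = 0" using ev_zero_on_prim_roots[OF m _ z] by (intro small[OF dB]) auto
      \<comment> \<open>Impossible, since both products are monic.\<close>
      then have "C1 * D2 = - (C2 * D1)" by (simp add: B_def eq_neg_iff_add_eq_0)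
      then have "lead_coeff (C1 * D2) = - lead_coeff (C2 * D1)" by (simp only: lead_coeff_minus)
      then show False using lcP by simp
    qed
  qed
  then have CD: "C1 * D2 = C2 * D1" by (simp add: A_def)
  \<comment> \<open>Multiplying each representation of F by the square of the other's
    \<open>D\<close> and subtracting leaves only terms that cancel by \<open>CD\<close>.\<close>
  have Dsq: "D1 ^ 2 = D2 ^ 2"
  proof -
    have "map_poly of_int (D1 ^ 2 - D2 ^ 2) * aur_F n = 0"
    proof (rule poly_ext)
      fix x
      have "ev C1 x * ev D2 x = ev C2 x * ev D1 x" using arg_cong[OF CD, of "\<lambda>w. ev w x"] by simp
      then have sq: "ev C1 x ^ 2 * ev D2 x ^ 2 = ev C2 x ^ 2 * ev D1 x ^ 2"
        by (simp only: power_mult_distrib[symmetric])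
      have "(ev D1 x ^ 2 - ev D2 x ^ 2) * poly (aur_F n) x =
          ev D1 x ^ 2 * poly (aur_F n) x - ev D2 x ^ 2 * poly (aur_F n) x"
        by (rule left_diff_distrib)
      also have "\<dots> = ev D1 x ^ 2 * (ev C2 x ^ 2 - of_nat n * x * ev D2 x ^ 2) -
          ev D2 x ^ 2 * (ev C1 x ^ 2 - of_nat n * x * ev D1 x ^ 2)"
        by (simp only: F(1)[of x, symmetric] F(2)[of x, symmetric])
      also have "\<dots> = ev C2 x ^ 2 * ev D1 x ^ 2 - ev C1 x ^ 2 * ev D2 x ^ 2"
        by (simp add: algebra_simps)
      finally have "(ev D1 x ^ 2 - ev D2 x ^ 2) * poly (aur_F n) x = 0" using sq by simp
      then show "poly (map_poly of_int (D1 ^ 2 - D2 ^ 2) * aur_F n) x = poly 0 x"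
        by (simp flip: ev_def)
    qed
    moreover have "aur_F n \<noteq> 0"
    proof
      assume "aur_F n = 0"
      then have "cyclotomic (aur_n' n) = 0" using aur_F_eq_cyclotomic[OF n(2,1)] by simp
      then show False using coeff_cyclotomic_totient[of "aur_n' n"] by simp
    qed
    ultimately have "map_poly (of_int :: int \<Rightarrow> complex) (D1 ^ 2 - D2 ^ 2) = map_poly of_int 0"
      by simp
    then have "D1 ^ 2 - D2 ^ 2 = 0" by (rule map_poly_of_int_inj)
    then show ?thesis by simp
  qed
  have "D1 = D2 \<or> D1 = - D2" using Dsq by (simp add: power2_eq_iff)
  moreover have "D1 \<noteq> - D2"
  proof
    assume "D1 = - D2"
    then have "lead_coeff D1 = - lead_coeff D2" by (simp only: lead_coeff_minus)
    then show False using lc by simp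
  qed
  ultimately have "D1 = D2" by blast
  moreover have "D2 \<noteq> 0" using lc by auto
  ultimately show ?thesis using CD by simp
qed

lemma aur_C_eq:
  assumes n: "n > 1" "squarefree n"
  shows "aur_C n = gamma_poly n"
  unfolding aur_C_def
  by (rule the_equality) (use aur_pair_exists[OF n] aur_pair_unique[OF n] in blast)+

lemma aur_D_eq:
  assumes n: "n > 1" "squarefree n"
  shows "aur_D n = delta_poly n"
  unfolding aur_D_def
  by (rule the_equality) (use aur_pair_exists[OF n] aur_pair_unique[OF n] in blast)+

lemma map_poly_sum_monom:
  assumes "\<And>j. j \<in> A \<Longrightarrow> c j \<in> \<int>"
  shows "map_poly of_int (\<Sum>j\<in>A. Polynomial.monom \<lfloor>c j\<rfloor> (f j)) =
    (\<Sum>j\<in>A. Polynomial.monom (c j :: real) (f j))"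
proof (rule poly_eqI)
  fix k
  have "of_int (\<Sum>j\<in>A. if f j = k then \<lfloor>c j\<rfloor> else 0) = (\<Sum>j\<in>A. if f j = k then c j else 0)"
    unfolding of_int_sum using assms by (intro sum.cong) (auto elim!: Ints_cases)
  then show "Polynomial.coeff (map_poly of_int (\<Sum>j\<in>A. Polynomial.monom \<lfloor>c j\<rfloor> (f j))) k =
    Polynomial.coeff (\<Sum>j\<in>A. Polynomial.monom (c j) (f j)) k"
    by (simp add: coeff_map_poly coeff_sum coeff_monom)
qed

lemma aur_C_coeffs:
  assumes n: "n > 1" "squarefree n"
  shows "map_poly of_int (aur_C n) = (\<Sum>j\<le>aur_d n. Polynomial.monom (aur_gamma n j) (aur_d n - j))"
  unfolding aur_C_eq[OF n] gamma_poly_def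
  by (rule map_poly_sum_monom) (use aur_gamma_delta_Ints(1)[OF n] in auto)

lemma aur_D_coeffs:
  assumes n: "n > 1" "squarefree n"
  shows "map_poly of_int (aur_D n) = (\<Sum>j<aur_d n. Polynomial.monom (aur_delta n j) (aur_d n - 1 - j))"
  unfolding aur_D_eq[OF n] delta_poly_def
  by (rule map_poly_sum_monom) (use aur_gamma_delta_Ints(2)[OF n] in auto)

section \<open>Counted computations\<close>

text \<open>A Hoare triple with a budget: quantifying over the initial counter makes the costs of
  consecutive computations add up.\<close>

definition runs :: "'a counted \<Rightarrow> nat \<Rightarrow> ('a \<Rightarrow> bool) \<Rightarrow> bool" where
  "runs c b P \<longleftrightarrow> (\<forall>s. P (fst (run_state c s)) \<and> snd (run_state c s) \<le> s + b)"

lemma runs_weaken: "runs c b P \<Longrightarrow> b \<le> b' \<Longrightarrow> (\<And>x. P x \<Longrightarrow> P' x) \<Longrightarrow> runs c b' P'"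
  by (auto simp: runs_def) (meson add_left_mono le_trans)

lemma runs_ret: "P x \<Longrightarrow> runs (ret x) b P"
  by (simp add: runs_def)

lemma runs_arith: "P (f x y) \<Longrightarrow> b \<ge> 1 \<Longrightarrow> runs (arith f x y) b P"
  by (simp add: runs_def arith_def)

lemma runs_bind:
  assumes "runs c b1 Q" "\<And>x. Q x \<Longrightarrow> runs (f x) b2 P" "b1 + b2 \<le> b"
  shows "runs (State_Monad.bind c f) b P"
  unfolding runs_def
proof
  fix s
  obtain x t where xt: "run_state c s = (x, t)" by force
  then have "Q x" "t \<le> s + b1" using assms(1) by (auto simp: runs_def dest: spec[of _ s])
  moreover from this have "P (fst (run_state (f x) t)) \<and> snd (run_state (f x) t) \<le> t + b2"
    using assms(2) by (auto simp: runs_def)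
  ultimately show "P (fst (run_state (State_Monad.bind c f) s)) \<and>
      snd (run_state (State_Monad.bind c f) s) \<le> s + b"
    using xt assms(3) by simp
qed

text \<open>Spending one unit of a given budget, instead of splitting it, lets chains of operations
  be handled by repeated use.\<close>

lemma runs_bind_arith:
  "b \<ge> 1 \<Longrightarrow> runs (k (f x y)) (b - 1) P \<Longrightarrow> runs (State_Monad.bind (arith f x y) k) b P"
  by (rule runs_bind[where ?b1.0 = 1 and ?b2.0 = "b - 1" and Q = "\<lambda>z. z = f x y"]) (auto intro: runs_arith)

text \<open>The cost may depend on the list entry; for Jacobi symbols it grows with the
  prime.\<close>

lemma runs_for_each:
  assumes "I 0 a"
    and "\<And>i a. i < length xs \<Longrightarrow> I i a \<Longrightarrow> runs (body (xs ! i) a) (b (xs ! i)) (I (Suc i))"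
  shows "runs (for_each xs body a) (\<Sum>x\<leftarrow>xs. b x) (I (length xs))"
  using assms
proof (induction xs arbitrary: I a)
  case Nil
  then show ?case by (simp add: runs_ret)
next
  case (Cons x xs)
  have 1: "runs (body x a) (b x) (I 1)" using Cons.prems(2)[of 0 a] Cons.prems(1) by simp
  have 2: "runs (for_each xs body a') (\<Sum>x\<leftarrow>xs. b x) (I (length (x # xs)))" if "I 1 a'" for a'
  proof -
    have "runs (for_each xs body a') (\<Sum>x\<leftarrow>xs. b x) (\<lambda>c. I (Suc (length xs)) c)"
    proof (rule Cons.IH[of "\<lambda>i. I (Suc i)"])
      fix i c assume "i < length xs" "I (Suc i) c"
      then show "runs (body (xs ! i) c) (b (xs ! i)) (I (Suc (Suc i)))"
        using Cons.prems(2)[of "Suc i" c] by simp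
    qed (use that in simp)
    then show ?thesis by simp
  qed
  show ?case using runs_bind[OF 1 2] by simp
qed

lemma runs_for_upt:
  assumes "m \<le> n" "I m a"
    and "\<And>i a. m \<le> i \<Longrightarrow> i < n \<Longrightarrow> I i a \<Longrightarrow> runs (body i a) b (I (Suc i))"
  shows "runs (for_each [m..<n] body a) ((n - m) * b) (I n)"
proof -
  have "runs (for_each [m..<n] body a) (\<Sum>x\<leftarrow>[m..<n]. b) ((\<lambda>i. I (m + i)) (length [m..<n]))"
    by (rule runs_for_each) (use assms in auto)
  then show ?thesis using assms(1) by (simp add: sum_list_triv)
qed

section \<open>Arithmetic functions\<close>

definition descending_primes :: "nat \<Rightarrow> nat list \<Rightarrow> bool" where
  "descending_primes m ps \<longleftrightarrow> sorted_wrt (\<ge>) ps \<and> (\<forall>p\<in>set ps. prime p) \<and> prod_list ps = m"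

lemma prime_if_least_factor:
  assumes "p \<ge> 2" "p dvd r" "\<And>q. prime q \<Longrightarrow> q dvd r \<Longrightarrow> p \<le> q"
  shows "prime (p :: nat)"
proof -
  obtain q where q: "prime q" "q dvd p" using assms(1) prime_factor_nat[of p] by auto
  then have "p \<le> q" using assms by (meson dvd_trans)
  moreover have "q \<le> p" using q assms(1) by (intro dvd_imp_le) auto
  ultimately show ?thesis using q by simp
qed

lemma runs_prime_factors:
  assumes "m > 0"
  shows "runs (prime_factors_c m) (3 * m) (descending_primes m)"
proof -
  \<comment> \<open>The last conjunct counts rounds: each one raises \<open>p\<close> or lowers
    \<open>r\<close> by at least 1. After \<open>m\<close> rounds, \<open>r > 1\<close> would give
    \<open>r + 2 \<le> p\<close>, although every prime factor of \<open>r\<close> is at least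
    \<open>p\<close>.\<close>
  define I :: "nat \<Rightarrow> nat \<times> nat \<times> nat list \<Rightarrow> bool" where
    "I i = (\<lambda>(p, r, ps). p \<ge> 2 \<and> r \<ge> 1 \<and> r * prod_list ps = m \<and>
      (\<forall>q. prime q \<longrightarrow> q dvd r \<longrightarrow> p \<le> q) \<and> (\<forall>q\<in>set ps. prime q \<and> q \<le> p) \<and>
      sorted_wrt (\<ge>) ps \<and> (r > 1 \<longrightarrow> r + i + 2 \<le> m + p))" for i
  have div: "I (Suc i) (p, r div p, p # ps)" if "I i (p, r, ps)" "r mod p = 0" for i p r ps
  proof -
    have d: "p dvd r" using that(2) by auto
    then obtain t where t: "r = p * t" by (auto elim: dvdE)
    have p: "prime p" by (rule prime_if_least_factor[OF _ d]) (use that(1) in \<open>auto simp: I_def\<close>)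
    have p2: "p \<ge> 2" and t1: "t \<ge> 1" using that(1) t by (auto simp: I_def Suc_le_eq)
    have tr: "t + 1 \<le> r"
    proof -
      have "2 * t \<le> p * t" using p2 by (rule mult_right_mono) simp
      then show ?thesis using t t1 by linarith
    qed
    then have "r > 1" using t1 by simp
    then have "r + i + 2 \<le> m + p" using that(1) by (auto simp: I_def)
    then show ?thesis using that(1) t t1 p p2 tr by (auto simp: I_def mult_ac)
  qed
  have inc: "I (Suc i) (p + 1, r, ps)" if "I i (p, r, ps)" "r mod p \<noteq> 0" for i p r ps
  proof -
    have "p + 1 \<le> q" if "prime q" "q dvd r" for q
    proof -
      have "p \<le> q" using \<open>I i (p, r, ps)\<close> that by (auto simp: I_def)
      moreover have "p \<noteq> q" using \<open>r mod p \<noteq> 0\<close> that(2) by auto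
      ultimately show ?thesis by simp
    qed
    then show ?thesis using that by (fastforce simp: I_def)
  qed
  have fin: "descending_primes m ps" if "I m (p, r, ps)" for p r ps
  proof -
    have "r = 1"
    proof (rule ccontr)
      assume "r \<noteq> 1"
      then have r: "r > 1" "r + m + 2 \<le> m + p" using that by (auto simp: I_def)
      obtain q where q: "prime q" "q dvd r" using prime_factor_nat[of r] r by auto
      then have "p \<le> q" "q \<le> r" using that r by (auto simp: I_def intro: dvd_imp_le)
      then show False using r by simp
    qed
    then show ?thesis using that by (auto simp: I_def descending_primes_def)
  qed
  have loop: "runs (for_each [0..<m] (\<lambda>_ (p, r, ps). do {
         t \<leftarrow> arith (mod) r p;
         b \<leftarrow> arith (=) t 0;
         if b then do { r' \<leftarrow> arith (div) r p; ret (p, r', p # ps) }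
         else do { p' \<leftarrow> arith (+) p 1; ret (p', r, ps) }
       }) (2, m, [])) ((m - 0) * 3) (I m)"
  proof (rule runs_for_upt)
    show "I 0 (2, m, [])" using assms by (auto simp: I_def dest: prime_ge_2_nat)
    fix i and x :: "nat \<times> nat \<times> nat list" assume I: "I i x"
    obtain p r ps where x: "x = (p, r, ps)" by (metis prod_cases3)
    show "runs (case x of (p, r, ps) \<Rightarrow> do {
         t \<leftarrow> arith (mod) r p;
         b \<leftarrow> arith (=) t 0;
         if b then do { r' \<leftarrow> arith (div) r p; ret (p, r', p # ps) }
         else do { p' \<leftarrow> arith (+) p 1; ret (p', r, ps) }
       }) 3 (I (Suc i))"
      using I div inc unfolding x prod.case
      by (intro runs_bind_arith) (auto intro!: runs_bind_arith runs_ret simp del: mod_eq_0_iff_dvd)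
  qed simp
  show ?thesis unfolding prime_factors_c_def
    by (rule runs_bind[OF loop, where ?b2.0 = 0]) (use fin in \<open>auto intro!: runs_ret split: prod.split\<close>)
qed

text \<open>Numbers that are at least 2 have a sum no larger than their product. The bound on the
  sum makes a Jacobi symbol cost linear time although each prime is searched exhaustively.\<close>

lemma descending_primes_length:
  assumes "descending_primes m ps"
  shows "length ps \<le> m" "sum_list ps \<le> m"
proof -
  have "(\<forall>p\<in>set ps. p \<ge> 2) \<Longrightarrow> length ps \<le> prod_list ps \<and> (sum_list ps \<le> prod_list ps) \<and> prod_list ps \<ge> 1" for ps :: "nat list"
  proof (induction ps)
    case (Cons p ps)
    then have IH: "length ps \<le> prod_list ps" "sum_list ps \<le> prod_list ps" "prod_list ps \<ge> 1" and p: "p \<ge> 2" by auto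
    show ?case
    proof (cases "prod_list ps = 1")
      case True
      have "ps = []"
        using True Cons.prems by (cases ps) auto
      then show ?thesis using p by simp
    next
      case False
      then have "prod_list ps \<ge> 2" using IH by simp
      then have "p + prod_list ps \<le> p * prod_list ps"
        using p by (metis add_le_mono le_add2 mult_2 mult_le_mono nat_le_linear mult.commute order_trans mult_le_mono1 mult_le_mono2)
      then show ?thesis using IH p by auto
    qed
  qed simp
  moreover have "\<forall>p\<in>set ps. p \<ge> 2" using assms by (auto simp: descending_primes_def dest: prime_ge_2_nat)
  ultimately show "length ps \<le> m" "sum_list ps \<le> m" using assms by (auto simp: descending_primes_def)
qed

lemma prime_dvd_prod_listD:
  "prime p \<Longrightarrow> p dvd prod_list xs \<Longrightarrow> \<exists>q\<in>set xs. p dvd q" for p :: nat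
  by (induction xs) (auto simp: prime_dvd_mult_iff)

text \<open>Equal entries of a sorted list are adjacent, so looking one place back decides whether a
  prime has occurred before.\<close>

lemma descending_primes_step:
  assumes ps: "descending_primes m ps" and i: "i < length ps"
  shows "if i > 0 \<and> ps ! i = ps ! (i - 1) then ps ! i dvd prod_list (take i ps)
    else \<not> ps ! i dvd prod_list (take i ps)"
proof (cases "i > 0 \<and> ps ! i = ps ! (i - 1)")
  case True
  then have "ps ! (i - 1) \<in> set (take i ps)" using i by (auto simp: in_set_conv_nth intro!: exI[of _ "i - 1"])
  then have "ps ! (i - 1) dvd prod_list (take i ps)" by (rule prod_list_dvd)
  then show ?thesis using True by simp
next
  case False
  have p: "prime (ps ! i)" using ps i by (simp add: descending_primes_def)
  have "\<not> ps ! i dvd prod_list (take i ps)"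
  proof
    assume "ps ! i dvd prod_list (take i ps)"
    then obtain q where q: "q \<in> set (take i ps)" "ps ! i dvd q"
      using prime_dvd_prod_listD[OF p] by blast
    then have "prime q" using ps by (auto simp: descending_primes_def dest: in_set_takeD)
    then have "q = ps ! i" using q(2) p primes_dvd_imp_eq by blast
    then obtain j where j: "j < i" "ps ! j = ps ! i" using q(1) i by (auto simp: in_set_conv_nth)
    have "ps ! j \<ge> ps ! (i - 1)" "ps ! (i - 1) \<ge> ps ! i"
      using ps i j(1) sorted_wrt_nth_less[of "(\<ge>)" ps] unfolding descending_primes_def
      by (cases "j = i - 1"; auto)+
    then show False using False j by simp
  qed
  then show ?thesis unfolding if_not_P[OF False] .
qed

lemma take_Suc_prod_list: "i < length ps \<Longrightarrow> prod_list (take (Suc i) ps) = ps ! i * prod_list (take i ps)"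
  for ps :: "nat list"
  by (simp add: take_Suc_conv_app_nth mult.commute)

lemma prod_list_take_pos:
  assumes "descending_primes m ps"
  shows "prod_list (take i ps) > 0"
proof -
  have "0 \<notin> set (take i ps)"
  proof
    assume "0 \<in> set (take i ps)"
    then have "0 \<in> set ps" by (rule in_set_takeD)
    then have "prime (0 :: nat)" using assms by (simp only: descending_primes_def)
    then show False by simp
  qed
  then show ?thesis by (simp add: prod_list_zero_iff neq0_conv[symmetric] del: neq0_conv)
qed

lemma totient_mult_prime_dvd:
  assumes "p dvd x" "p > 0"
  shows "totient (p * x) = p * totient x"
proof -
  have "totient p > 0" using assms by simp
  moreover have "gcd p x = p" using assms(1) by (simp add: gcd_nat.absorb1)
  ultimately show ?thesis by (simp add: totient_mult mult.assoc)
qed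

lemma moebius_prime_dvd:
  assumes "prime p" "p dvd x"
  shows "moebius (p * x) = 0"
proof -
  have "p\<^sup>2 dvd p * x" using assms(2) by (simp add: power2_eq_square)
  moreover have "\<not> p dvd 1" using assms(1) by auto
  ultimately have "\<not> squarefree (p * x)" by (rule not_squarefreeI)
  then show ?thesis by (simp add: moebius_def)
qed

lemma runs_totient:
  assumes "m > 0"
  shows "runs (totient_c m) (6 * m) (\<lambda>v. v = totient m)"
  unfolding totient_c_def
proof (rule runs_bind[OF runs_prime_factors[OF assms], where ?b2.0 = "3 * m"])
  fix ps assume ps: "descending_primes m ps"
  define I :: "nat \<Rightarrow> nat \<times> nat \<Rightarrow> bool" where
    "I i = (\<lambda>(prev, v). prev = (if i = 0 then 0 else ps ! (i - 1)) \<and> v = totient (prod_list (take i ps)))" for i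
  have loop: "runs (for_each ps (\<lambda>p (prev, v). do {
         b \<leftarrow> arith (=) p prev;
         if b then do { v' \<leftarrow> arith (*) v p; ret (p, v') }
         else do { t \<leftarrow> arith (-) p 1; v' \<leftarrow> arith (*) v t; ret (p, v') }
       }) (0, 1)) (\<Sum>p\<leftarrow>ps. 3) (I (length ps))"
  proof (rule runs_for_each)
    show "I 0 (0, 1)" by (simp add: I_def)
    fix i and x :: "nat \<times> nat" assume i: "i < length ps" and I: "I i x"
    define p where "p = ps ! i"
    have p: "prime p" using ps i by (simp add: descending_primes_def p_def)
    obtain prev v where x: "x = (prev, v)" by force
    have v: "v = totient (prod_list (take i ps))" using I x by (simp add: I_def)
    \<comment> \<open>The initial 0 is not a prime, so the first entry always counts as new.\<close>
    have eq: "p = prev \<longleftrightarrow> i > 0 \<and> ps ! i = ps ! (i - 1)"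
      using I x prime_gt_0_nat[OF p] by (auto simp: I_def p_def)
    have step1: "I (Suc i) (p, v * p)" if "p = prev"
      using that eq descending_primes_step[OF ps i] totient_mult_prime_dvd[of p] prime_gt_0_nat[OF p]
      unfolding I_def prod.case take_Suc_prod_list[OF i] v by (auto simp: p_def)
    have step2: "I (Suc i) (p, v * (p - 1))" if "p \<noteq> prev"
    proof -
      have "\<not> p dvd prod_list (take i ps)" using that eq descending_primes_step[OF ps i] by (auto simp: p_def split: if_splits)
      then have "coprime p (prod_list (take i ps))" using p prime_imp_coprime by blast
      then show ?thesis using p totient_prime[OF p]
        unfolding I_def prod.case take_Suc_prod_list[OF i] v by (simp add: p_def totient_mult_coprime)
    qed
    show "runs (case x of (prev, v) \<Rightarrow> do {
         b \<leftarrow> arith (=) (ps ! i) prev;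
         if b then do { v' \<leftarrow> arith (*) v (ps ! i); ret (ps ! i, v') }
         else do { t \<leftarrow> arith (-) (ps ! i) 1; v' \<leftarrow> arith (*) v t; ret (ps ! i, v') }
       }) 3 (I (Suc i))"
      unfolding x prod.case p_def[symmetric] using step1 step2
      by (intro runs_bind_arith) (auto intro!: runs_bind_arith runs_ret)
  qed
  have len: "(\<Sum>p\<leftarrow>ps. 3) \<le> 3 * m" using descending_primes_length(1)[OF ps] by (simp add: sum_list_triv)
  show "runs (State_Monad.bind (for_each ps (\<lambda>p (prev, v). do {
         b \<leftarrow> arith (=) p prev;
         if b then do { v' \<leftarrow> arith (*) v p; ret (p, v') }
         else do { t \<leftarrow> arith (-) p 1; v' \<leftarrow> arith (*) v t; ret (p, v') }
       }) (0, 1)) (\<lambda>(prev, v). ret v)) (3 * m) (\<lambda>v. v = totient m)"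
    by (rule runs_bind[OF loop, where ?b2.0 = 0])
      (use len ps in \<open>auto intro!: runs_ret simp: I_def descending_primes_def\<close>)
qed simp

lemma runs_moebius:
  assumes "m > 0"
  shows "runs (moebius_c m) (5 * m) (\<lambda>v. v = moebius m)"
  unfolding moebius_c_def
proof (rule runs_bind[OF runs_prime_factors[OF assms], where ?b2.0 = "2 * m"])
  fix ps assume ps: "descending_primes m ps"
  define I :: "nat \<Rightarrow> nat \<times> int \<Rightarrow> bool" where
    "I i = (\<lambda>(prev, v). prev = (if i = 0 then 0 else ps ! (i - 1)) \<and> v = moebius (prod_list (take i ps)))" for i
  have loop: "runs (for_each ps (\<lambda>p (prev, v). do {
         b \<leftarrow> arith (=) p prev;
         if b then ret (p, 0)
         else do { v' \<leftarrow> arith (-) 0 v; ret (p, v') }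
       }) (0, 1)) (\<Sum>p\<leftarrow>ps. 2) (I (length ps))"
  proof (rule runs_for_each)
    show "I 0 (0, 1)" by (simp add: I_def)
    fix i and x :: "nat \<times> int" assume i: "i < length ps" and I: "I i x"
    define p where "p = ps ! i"
    have p: "prime p" using ps i by (simp add: descending_primes_def p_def)
    obtain prev v where x: "x = (prev, v)" by force
    have v: "v = moebius (prod_list (take i ps))" using I x by (simp add: I_def)
    have eq: "p = prev \<longleftrightarrow> i > 0 \<and> ps ! i = ps ! (i - 1)"
      using I x prime_gt_0_nat[OF p] by (auto simp: I_def p_def)
    have step1: "I (Suc i) (p, 0)" if "p = prev"
      using that eq descending_primes_step[OF ps i] moebius_prime_dvd[OF p]
      unfolding I_def prod.case take_Suc_prod_list[OF i] v by (auto simp: p_def)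
    have step2: "I (Suc i) (p, 0 - v)" if "p \<noteq> prev"
      using that eq descending_primes_step[OF ps i] moebius_prime_mult[OF p] prod_list_take_pos[OF ps]
      unfolding I_def prod.case take_Suc_prod_list[OF i] v by (auto simp: p_def split: if_splits)
    show "runs (case x of (prev, v) \<Rightarrow> do {
         b \<leftarrow> arith (=) (ps ! i) prev;
         if b then ret (ps ! i, 0)
         else do { v' \<leftarrow> arith (-) 0 v; ret (ps ! i, v') }
       }) 2 (I (Suc i))"
      unfolding x prod.case p_def[symmetric] using step1 step2
      by (intro runs_bind_arith) (auto intro!: runs_bind_arith runs_ret)
  qed
  have len: "(\<Sum>p\<leftarrow>ps. 2) \<le> 2 * m" using descending_primes_length(1)[OF ps] by (simp add: sum_list_triv)
  show "runs (State_Monad.bind (for_each ps (\<lambda>p (prev, v). do {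
         b \<leftarrow> arith (=) p prev;
         if b then ret (p, 0)
         else do { v' \<leftarrow> arith (-) 0 v; ret (p, v') }
       }) (0, 1)) (\<lambda>(prev, v). ret v)) (2 * m) (\<lambda>v. v = moebius m)"
    by (rule runs_bind[OF loop, where ?b2.0 = 0])
      (use len ps in \<open>auto intro!: runs_ret simp: I_def descending_primes_def\<close>)
qed simp

lemma runs_gcd: "runs (gcd_c a b) (2 * b) (\<lambda>v. v = gcd a b)"
proof -
  \<comment> \<open>Until it reaches 0, \<open>y\<close> drops in every round, so
    \<open>y + i\<close> stays below the bound and \<open>y = 0\<close> after \<open>b\<close>
    rounds.\<close>
  define I :: "nat \<Rightarrow> nat \<times> nat \<Rightarrow> bool" where
    "I i = (\<lambda>(x, y). gcd x y = gcd a b \<and> (y = 0 \<or> y + i \<le> b))" for i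
  have loop: "runs (for_each [0..<b] (\<lambda>_ (x, y). do {
         z \<leftarrow> arith (=) y 0;
         if z then ret (x, y) else do { r \<leftarrow> arith (mod) x y; ret (y, r) }
       }) (a, b)) ((b - 0) * 2) (I b)"
  proof (rule runs_for_upt)
    show "I 0 (a, b)" by (simp add: I_def)
    fix i and w :: "nat \<times> nat" assume I: "I i w"
    obtain x y where w: "w = (x, y)" by force
    have step: "I (Suc i) (y, x mod y)" if "y \<noteq> 0"
    proof -
      have "x mod y < y" using that by simp
      moreover have "y + i \<le> b" using I that by (simp add: I_def w)
      ultimately have "x mod y + Suc i \<le> b" by linarith
      then show ?thesis using I that by (auto simp: I_def w gcd.commute[of y] gcd_mod_left)
    qed
    show "runs (case w of (x, y) \<Rightarrow> do {
         z \<leftarrow> arith (=) y 0;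
         if z then ret (x, y) else do { r \<leftarrow> arith (mod) x y; ret (y, r) }
       }) 2 (I (Suc i))"
      unfolding w prod.case using step I
      by (intro runs_bind_arith) (auto intro!: runs_bind_arith runs_ret simp: I_def w)
  qed simp
  show ?thesis unfolding gcd_c_def
    by (rule runs_bind[OF loop, where ?b2.0 = 0]) (auto intro!: runs_ret simp: I_def split: prod.splits)
qed

text \<open>A square root may be reduced modulo \<open>p\<close>, and it is nonzero when
  \<open>n\<close> is; so the search range of \<open>legendre_c\<close> is complete.\<close>

lemma Legendre_nat:
  assumes p: "prime p"
  shows "Legendre (int n) (int p) = (if n mod p = 0 then 0
    else if \<exists>x\<in>{1..<p}. x * x mod p = n mod p then 1 else - 1)"
proof -
  have p0: "p > 0" using p prime_gt_0_nat by blast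
  have "QuadRes (int p) (int n) \<longleftrightarrow> (\<exists>x\<in>{1..<p}. x * x mod p = n mod p)" if nz: "n mod p \<noteq> 0"
  proof
    assume "QuadRes (int p) (int n)"
    then obtain y where y: "[y\<^sup>2 = int n] (mod int p)" by (auto simp: QuadRes_def)
    define x where "x = nat (y mod int p)"
    have x: "int x = y mod int p" using p0 by (simp add: x_def)
    have "int (x * x) mod int p = y\<^sup>2 mod int p" by (simp add: x power2_eq_square mod_mult_eq)
    then have "int (x * x mod p) = int (n mod p)" using y by (simp add: cong_def zmod_int)
    then have xx: "x * x mod p = n mod p" by (simp only: of_nat_eq_iff)
    moreover have "x \<noteq> 0" using xx nz by (intro notI) simp
    moreover have "x < p" using p0 by (simp add: x_def nat_less_iff)
    ultimately show "\<exists>x\<in>{1..<p}. x * x mod p = n mod p" by force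
  next
    assume "\<exists>x\<in>{1..<p}. x * x mod p = n mod p"
    then obtain x where "x * x mod p = n mod p" by blast
    then have "int (x * x mod p) = int (n mod p)" by simp
    then have "[int x ^ 2 = int n] (mod int p)"
      by (simp add: cong_def zmod_int power2_eq_square)
    then show "QuadRes (int p) (int n)" by (auto simp: QuadRes_def)
  qed
  moreover have "[int n = 0] (mod int p) \<longleftrightarrow> n mod p = 0"
    by (simp add: cong_0_iff mod_eq_0_iff_dvd)
  ultimately show ?thesis by (auto simp: Legendre_def)
qed

lemma runs_legendre:
  assumes p: "prime p"
  shows "runs (legendre_c n p) (3 * p) (\<lambda>v. v = Legendre (int n) (int p))"
proof -
  have p2: "p \<ge> 2" using p prime_ge_2_nat by blast
  define a where "a = n mod p"
  define I :: "nat \<Rightarrow> int \<Rightarrow> bool" where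
    "I i v \<longleftrightarrow> v = (if \<exists>x\<in>{1..<i}. x * x mod p = a then 1 else - 1)" for i v
  have loop: "runs (for_each [1..<p] (\<lambda>x v. do {
         s \<leftarrow> arith (*) x x;
         t \<leftarrow> arith (mod) s p;
         b \<leftarrow> arith (=) t a;
         ret (if b then 1 else v)
       }) (- 1)) ((p - 1) * 3) (I p)"
  proof (rule runs_for_upt)
    show "I 1 (- 1)" by (simp add: I_def)
    fix x v assume x: "1 \<le> x" "x < p" "I x v"
    have "{1..<Suc x} = insert x {1..<x}" using x(1) by auto
    then have "I (Suc x) (if x * x mod p = a then 1 else v)" using x(3) by (simp add: I_def)
    then show "runs (do {
         s \<leftarrow> arith (*) x x;
         t \<leftarrow> arith (mod) s p;
         b \<leftarrow> arith (=) t a;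
         ret (if b then 1 else v)
       }) 3 (I (Suc x))"
      by (intro runs_bind_arith runs_ret) auto
  qed (use p2 in simp)
  show ?thesis
  proof (cases "a = 0")
    case True
    then show ?thesis unfolding legendre_c_def using p2 Legendre_nat[OF p, of n]
      by (intro runs_bind_arith) (auto simp: a_def intro!: runs_ret)
  next
    case False
    \<comment> \<open>Two operations precede the loop, and \<open>(p - 1) * 3 + 2\<close> is within
      \<open>3 * p\<close>.\<close>
    have "runs (for_each [1..<p] (\<lambda>x v. do {
         s \<leftarrow> arith (*) x x;
         t \<leftarrow> arith (mod) s p;
         b \<leftarrow> arith (=) t a;
         ret (if b then 1 else v)
       }) (- 1)) (3 * p - 1 - 1) (\<lambda>v. v = Legendre (int n) (int p))"
      by (rule runs_weaken[OF loop]) (use p2 False Legendre_nat[OF p, of n] in \<open>auto simp: I_def a_def\<close>)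
    then show ?thesis unfolding legendre_c_def a_def[symmetric] using p2 False
      by (intro runs_bind_arith) (auto simp: a_def[symmetric])
  qed
qed

lemma runs_jacobi:
  assumes k: "k > 0"
  shows "runs (jacobi_c n k) (7 * k) (\<lambda>v. v = jacobi (int n) k)"
  unfolding jacobi_c_def
proof (rule runs_bind[OF runs_prime_factors[OF k], where ?b2.0 = "4 * k"])
  fix ps assume ps: "descending_primes k ps"
  define I :: "nat \<Rightarrow> int \<Rightarrow> bool" where
    "I i v \<longleftrightarrow> v = (\<Prod>p\<leftarrow>take i ps. Legendre (int n) (int p))" for i v
  have loop: "runs (for_each ps (\<lambda>p v. do { l \<leftarrow> legendre_c n p; arith (*) v l }) 1)
    (\<Sum>p\<leftarrow>ps. 3 * p + 1) (I (length ps))"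
  proof (rule runs_for_each)
    show "I 0 1" by (simp add: I_def)
    fix i v assume i: "i < length ps" and I: "I i v"
    have p: "prime (ps ! i)" using ps i by (simp add: descending_primes_def)
    show "runs (do { l \<leftarrow> legendre_c n (ps ! i); arith (*) v l }) (3 * (ps ! i) + 1) (I (Suc i))"
      by (rule runs_bind[OF runs_legendre[OF p], where ?b2.0 = 1])
        (use I i in \<open>auto intro!: runs_arith simp: I_def take_Suc_conv_app_nth\<close>)
  qed
  have "mset ps = prime_factorization k"
    using ps prime_factorization_prod_mset_primes[of "mset ps"]
    by (auto simp: descending_primes_def prod_mset_prod_list)
  then have J: "jacobi (int n) k = (\<Prod>p\<leftarrow>ps. Legendre (int n) (int p))"
    by (simp only: jacobi_def mset_map[symmetric] prod_mset_prod_list flip: \<open>mset ps = _\<close>)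
  \<comment> \<open>Sum and length are each at most \<open>k\<close>, which gives the
    \<open>4 * k\<close> in the budget.\<close>
  have "(\<Sum>p\<leftarrow>ps. 3 * p + 1) = 3 * sum_list ps + length ps"
    by (induction ps) auto
  then show "runs (for_each ps (\<lambda>p v. do { l \<leftarrow> legendre_c n p; arith (*) v l }) 1) (4 * k)
      (\<lambda>v. v = jacobi (int n) k)"
    by (intro runs_weaken[OF loop]) (use descending_primes_length[OF ps] J in \<open>auto simp: I_def\<close>)
qed simp

lemma runs_cos: "runs (cos_c n k) 6 (\<lambda>c. c = cos_quarter ((n - 1) * (k div 2)))"
  unfolding cos_c_def cos_quarter_def by (intro runs_bind_arith runs_ret) auto

lemma runs_n': "runs (n'_c n) 3 (\<lambda>m. m = aur_n' n)"
  unfolding n'_c_def aur_n'_def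
  by (intro runs_bind_arith) (auto intro!: runs_ret runs_arith)

text \<open>Every subroutine is linear in an argument bounded by n'. The even case needs at most
  \<open>13 * n' + 11\<close> operations and the odd case fewer than \<open>30 * n'\<close> as well,
  so 30 absorbs the constants.\<close>

lemma runs_q:
  assumes n: "n > 1" and k: "1 \<le> k" "k \<le> aur_n' n"
  shows "runs (q_c n (aur_n' n) k) (30 * aur_n' n) (\<lambda>x. of_int x = aur_q n k)"
proof -
  define m where "m = aur_n' n"
  define g where "g = gcd m k"
  have m: "m > 0" "k \<le> m" using k by (auto simp: m_def)
  have g: "g > 0" "g \<le> m" "m div g > 0" "m div g \<le> m"
    using m k by (auto simp: g_def div_greater_zero_iff intro: gcd_le1_nat)
  show ?thesis
  proof (cases "odd k")
    case True
    then have "k mod 2 = 1" by presburger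
    moreover have "runs (jacobi_c n k) (30 * m - 1 - 1) (\<lambda>x. of_int x = aur_q n k)"
      by (rule runs_weaken[OF runs_jacobi]) (use k m True in \<open>auto simp: aur_q_def\<close>)
    ultimately show ?thesis unfolding q_c_def m_def[symmetric] using m
      by (intro runs_bind_arith) auto
  next
    case False
    have val: "of_int (moebius (m div g) * int (totient g) * cos_quarter ((n - 1) * (k div 2))) = aur_q n k"
      using aur_q_even[of k n] False n by (simp add: m_def g_def gcd.commute)
    have "runs (do {
       g \<leftarrow> gcd_c m k;
       h \<leftarrow> arith (div) m g;
       m \<leftarrow> moebius_c h;
       f \<leftarrow> totient_c g;
       c \<leftarrow> cos_c n k;
       x \<leftarrow> arith (*) m (int f);
       arith (*) x c
     }) (2 * k + (1 + (5 * m + (6 * m + (6 + 2))))) (\<lambda>x. of_int x = aur_q n k)"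
    proof (rule runs_bind[OF runs_gcd], unfold g_def[symmetric], simp only:)
      show "runs (do {
         h \<leftarrow> arith (div) m g;
         m \<leftarrow> moebius_c h;
         f \<leftarrow> totient_c g;
         c \<leftarrow> cos_c n k;
         x \<leftarrow> arith (*) m (int f);
         arith (*) x c
       }) (1 + (5 * m + (6 * m + (6 + 2)))) (\<lambda>x. of_int x = aur_q n k)"
      proof (rule runs_bind_arith)
        have 1: "runs (moebius_c (m div g)) (5 * m) (\<lambda>v. v = moebius (m div g))"
          by (rule runs_weaken[OF runs_moebius]) (use g in auto)
        have 2: "runs (totient_c g) (6 * m) (\<lambda>v. v = totient g)"
          by (rule runs_weaken[OF runs_totient]) (use g in auto)
        have 3: "runs (do { x \<leftarrow> arith (*) (moebius (m div g)) (int (totient g));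
            arith (*) x (cos_quarter ((n - 1) * (k div 2))) }) 2 (\<lambda>x. of_int x = aur_q n k)"
          by (intro runs_bind_arith runs_arith) (use val in auto)
        have 4: "runs (do { c \<leftarrow> cos_c n k; x \<leftarrow> arith (*) (moebius (m div g)) (int (totient g));
            arith (*) x c }) (6 + 2) (\<lambda>x. of_int x = aur_q n k)"
          by (rule runs_bind[OF runs_cos]) (use 3 in auto)
        have 5: "runs (do { f \<leftarrow> totient_c g; c \<leftarrow> cos_c n k; x \<leftarrow> arith (*) (moebius (m div g)) (int f);
            arith (*) x c }) (6 * m + (6 + 2)) (\<lambda>x. of_int x = aur_q n k)"
          by (rule runs_bind[OF 2]) (use 4 in auto)
        have "runs (do { m \<leftarrow> moebius_c (m div g); f \<leftarrow> totient_c g; c \<leftarrow> cos_c n k; x \<leftarrow> arith (*) m (int f);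
            arith (*) x c }) (5 * m + (6 * m + (6 + 2))) (\<lambda>x. of_int x = aur_q n k)"
          by (rule runs_bind[OF 1]) (use 5 in auto)
        then show "runs (do { m \<leftarrow> moebius_c (m div g); f \<leftarrow> totient_c g; c \<leftarrow> cos_c n k; x \<leftarrow> arith (*) m (int f);
            arith (*) x c }) (1 + (5 * m + (6 * m + (6 + 2))) - 1) (\<lambda>x. of_int x = aur_q n k)"
          by (rule runs_weaken) simp_all
      qed simp
    qed simp
    then have "runs (do {
       g \<leftarrow> gcd_c m k;
       h \<leftarrow> arith (div) m g;
       m \<leftarrow> moebius_c h;
       f \<leftarrow> totient_c g;
       c \<leftarrow> cos_c n k;
       x \<leftarrow> arith (*) m (int f);
       arith (*) x c
     }) (30 * m - 1 - 1) (\<lambda>x. of_int x = aur_q n k)"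
      by (rule runs_weaken) (use m in auto)
    moreover have "k mod 2 \<noteq> 1" using False by presburger
    ultimately show ?thesis unfolding q_c_def m_def[symmetric] using m
      by (intro runs_bind_arith) auto
  qed
qed

section \<open>The algorithm\<close>

lemma runs_gamma:
  "runs (gamma_c n q \<gamma> \<delta> k) (5 * k + 2) (\<lambda>x. x = (\<Sum>j<k. int n * q (2 * k - 2 * j - 1) * \<delta> j
    - q (2 * k - 2 * j) * \<gamma> j) div (2 * int k))"
proof -
  define I :: "nat \<Rightarrow> int \<Rightarrow> bool" where
    "I i s \<longleftrightarrow> s = (\<Sum>j<i. int n * q (2 * k - 2 * j - 1) * \<delta> j - q (2 * k - 2 * j) * \<gamma> j)" for i s
  have loop: "runs (for_each [0..<k] (\<lambda>j s. do {
         u \<leftarrow> arith (*) (int n) (q (2 * k - 2 * j - 1));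
         v \<leftarrow> arith (*) u (\<delta> j);
         w \<leftarrow> arith (*) (q (2 * k - 2 * j)) (\<gamma> j);
         t \<leftarrow> arith (-) v w;
         arith (+) s t
       }) 0) ((k - 0) * 5) (I k)"
    by (rule runs_for_upt) (auto intro!: runs_bind_arith runs_arith simp: I_def)
  show ?thesis unfolding gamma_c_def
    by (rule runs_bind[OF loop, where ?b2.0 = 2]) (auto intro!: runs_bind_arith runs_arith simp: I_def)
qed

lemma runs_delta:
  "runs (delta_c q \<gamma> \<delta> k) (4 * k + 4) (\<lambda>x. x = (\<gamma> k + (\<Sum>j<k. q (2 * k + 1 - 2 * j) * \<gamma> j
    - q (2 * k - 2 * j) * \<delta> j)) div (2 * int k + 1))"
proof -
  define I :: "nat \<Rightarrow> int \<Rightarrow> bool" where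
    "I i s \<longleftrightarrow> s = (\<Sum>j<i. q (2 * k + 1 - 2 * j) * \<gamma> j - q (2 * k - 2 * j) * \<delta> j)" for i s
  have loop: "runs (for_each [0..<k] (\<lambda>j s. do {
         v \<leftarrow> arith (*) (q (2 * k + 1 - 2 * j)) (\<gamma> j);
         w \<leftarrow> arith (*) (q (2 * k - 2 * j)) (\<delta> j);
         t \<leftarrow> arith (-) v w;
         arith (+) s t
       }) 0) ((k - 0) * 4) (I k)"
    by (rule runs_for_upt) (auto intro!: runs_bind_arith runs_arith simp: I_def)
  show ?thesis unfolding delta_c_def
    by (rule runs_bind[OF loop, where ?b2.0 = 4]) (auto intro!: runs_bind_arith runs_arith simp: I_def)
qed

text \<open>The real quotient is already known to be an integer, so \<open>div\<close> loses
  nothing.\<close>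

lemma exact_div:
  fixes x :: real
  assumes "x \<in> \<int>" "x = 1 / of_int m * of_int s" "m > 0"
  shows "of_int (s div m) = x"
proof -
  obtain t where t: "x = of_int t" using assms(1) by (auto elim: Ints_cases)
  have "real_of_int s = of_int (m * t)" using assms(2,3) t by (simp add: field_simps)
  then have "s = m * t" by (simp only: of_int_eq_iff)
  then show ?thesis using assms(3) t by simp
qed

text \<open>The recurrence reads q only at indices from 1 to \<open>2 * k \<le> d\<close> and the
  other arrays only below \<open>k\<close>, so partially filled arrays suffice.\<close>

lemma aur_gamma_exact:
  assumes n: "n > 1" "squarefree n" and k: "1 \<le> k" "k \<le> aur_d n div 2"
    and q: "\<And>i. 1 \<le> i \<Longrightarrow> i \<le> aur_d n \<Longrightarrow> of_int (q i) = aur_q n i"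
    and g: "\<And>i. i < k \<Longrightarrow> of_int (\<gamma> i) = aur_gamma n i"
    and d: "\<And>i. i < k \<Longrightarrow> of_int (\<delta> i) = aur_delta n i"
  shows "of_int ((\<Sum>j<k. int n * q (2 * k - 2 * j - 1) * \<delta> j - q (2 * k - 2 * j) * \<gamma> j) div (2 * int k))
    = aur_gamma n k"
proof (rule exact_div)
  show "aur_gamma n k \<in> \<int>" using aur_gamma_delta_Ints(1)[OF n] k by simp
  have "aur_gamma n k = 1 / (2 * real k) *
      (\<Sum>j<k. real n * aur_q n (2 * k - 2 * j - 1) * aur_delta n j - aur_q n (2 * k - 2 * j) * aur_gamma n j)"
    using k by (subst aur_gamma.simps) simp
  also have "(\<Sum>j<k. real n * aur_q n (2 * k - 2 * j - 1) * aur_delta n j - aur_q n (2 * k - 2 * j) * aur_gamma n j)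
    = of_int (\<Sum>j<k. int n * q (2 * k - 2 * j - 1) * \<delta> j - q (2 * k - 2 * j) * \<gamma> j)"
    unfolding of_int_sum using k by (intro sum.cong) (simp_all add: q g d)
  finally show "aur_gamma n k = 1 / of_int (2 * int k) *
    of_int (\<Sum>j<k. int n * q (2 * k - 2 * j - 1) * \<delta> j - q (2 * k - 2 * j) * \<gamma> j)" by simp
qed (use k in simp)

lemma aur_delta_exact:
  assumes n: "n > 1" "squarefree n" and k: "1 \<le> k" "k \<le> (aur_d n - 1) div 2"
    and q: "\<And>i. 1 \<le> i \<Longrightarrow> i \<le> aur_d n \<Longrightarrow> of_int (q i) = aur_q n i"
    and g: "\<And>i. i \<le> k \<Longrightarrow> of_int (\<gamma> i) = aur_gamma n i"
    and d: "\<And>i. i < k \<Longrightarrow> of_int (\<delta> i) = aur_delta n i"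
  shows "of_int ((\<gamma> k + (\<Sum>j<k. q (2 * k + 1 - 2 * j) * \<gamma> j - q (2 * k - 2 * j) * \<delta> j)) div (2 * int k + 1))
    = aur_delta n k"
proof (rule exact_div)
  have kd: "2 * k + 1 \<le> aur_d n" using k by linarith
  show "aur_delta n k \<in> \<int>" using aur_gamma_delta_Ints(2)[OF n] kd by simp
  have "aur_delta n k = 1 / (2 * real k + 1) * (aur_gamma n k +
      (\<Sum>j<k. aur_q n (2 * k + 1 - 2 * j) * aur_gamma n j - aur_q n (2 * k - 2 * j) * aur_delta n j))"
    using k by (subst aur_delta.simps) simp
  also have "(\<Sum>j<k. aur_q n (2 * k + 1 - 2 * j) * aur_gamma n j - aur_q n (2 * k - 2 * j) * aur_delta n j)
    = of_int (\<Sum>j<k. q (2 * k + 1 - 2 * j) * \<gamma> j - q (2 * k - 2 * j) * \<delta> j)"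
    unfolding of_int_sum using kd by (intro sum.cong) (simp_all add: q g d)
  finally show "aur_delta n k = 1 / of_int (2 * int k + 1) *
    of_int (\<gamma> k + (\<Sum>j<k. q (2 * k + 1 - 2 * j) * \<gamma> j - q (2 * k - 2 * j) * \<delta> j))"
    by (simp add: g)
qed (use k in simp)

definition aur_correct :: "nat \<Rightarrow> nat \<times> (nat \<Rightarrow> int) \<times> (nat \<Rightarrow> int) \<times> (nat \<Rightarrow> int) \<Rightarrow> bool" where
  "aur_correct n = (\<lambda>(d, q, \<gamma>, \<delta>). d = aur_d n \<and>
           (\<forall>k\<in>{1..d}. of_int (q k) = aur_q n k) \<and>
           (\<forall>k\<le>d. of_int (\<gamma> k) = aur_gamma n k) \<and>
           (\<forall>k<d. of_int (\<delta> k) = aur_delta n k))"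

lemma runs_aur_algorithm:
  assumes n: "n > 1" "squarefree n"
  shows "runs (aur_algorithm n) (100 * n ^ 2) (aur_correct n)"
proof -
  define N where "N = aur_n' n"
  define d where "d = aur_d n"
  have d1: "d \<ge> 1" using aur_d_pos[OF n(1)] by (simp add: d_def)
  have N0: "N > 0" using aur_n'_gt_2[OF n(1)] by (simp add: N_def)
  have dN: "2 * d \<le> N" using aur_d[OF n(1)] totient_le[of N] by (simp add: d_def N_def)
  have Nn: "N \<le> 2 * n" by (simp add: N_def aur_n'_def)
  define qI where "qI k q \<longleftrightarrow> (\<forall>i. 1 \<le> i \<longrightarrow> i < k \<longrightarrow> real_of_int (q i) = aur_q n i)" for k q
  define gI where "gI k \<gamma> \<longleftrightarrow> (\<forall>i<k. real_of_int (\<gamma> i) = aur_gamma n i)" for k \<gamma>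
  define dI where "dI k \<delta> \<longleftrightarrow> (\<forall>i<k. real_of_int (\<delta> i) = aur_delta n i)" for k \<delta>
  \<comment> \<open>For even \<open>d\<close> the last round computes \<gamma> alone, so the filled
    part of \<delta> stops growing; hence the minimum.\<close>
  define J where "J k = (\<lambda>(\<gamma>, \<delta>). gI k \<gamma> \<and> dI (min k (Suc ((d - 1) div 2))) \<delta>)" for k
  have q_loop: "runs (for_each [1..<Suc d] (\<lambda>k q. do { x \<leftarrow> q_c n N k; ret (q(k := x)) }) (\<lambda>_. 0))
      ((Suc d - 1) * (30 * N)) (qI (Suc d))"
  proof (rule runs_for_upt)
    fix k q assume k: "1 \<le> k" "k < Suc d" "qI k q"
    show "runs (do { x \<leftarrow> q_c n N k; ret (q(k := x)) }) (30 * N) (qI (Suc k))"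
      unfolding N_def
      by (rule runs_bind[OF runs_q[OF n(1)], where ?b2.0 = 0])
        (use k dN N_def in \<open>auto intro!: runs_ret simp: qI_def less_Suc_eq\<close>)
  qed (simp_all add: qI_def)
  have main_loop: "runs (for_each [1..<Suc (d div 2)] (\<lambda>k (\<gamma>, \<delta>). do {
         x \<leftarrow> gamma_c n q \<gamma> \<delta> k;
         let \<gamma>' = \<gamma>(k := x);
         if k \<le> (d - 1) div 2 then do { y \<leftarrow> delta_c q \<gamma>' \<delta> k; ret (\<gamma>', \<delta>(k := y)) }
         else ret (\<gamma>', \<delta>)
       }) ((\<lambda>_. 0)(0 := 1), (\<lambda>_. 0)(0 := 1))) ((Suc (d div 2) - 1) * (9 * d + 6)) (J (Suc (d div 2)))"
    if q: "qI (Suc d) q" for q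
  proof (rule runs_for_upt)
    show "J 1 ((\<lambda>_. 0)(0 := 1), (\<lambda>_. 0)(0 := 1))"
      by (simp add: J_def gI_def dI_def aur_gamma_0 aur_delta_0)
    have q': "real_of_int (q i) = aur_q n i" if "1 \<le> i" "i \<le> aur_d n" for i
      using q that by (simp add: qI_def d_def)
    fix k and x :: "(nat \<Rightarrow> int) \<times> (nat \<Rightarrow> int)" assume k: "1 \<le> k" "k < Suc (d div 2)" "J k x"
    obtain \<gamma> \<delta> where x: "x = (\<gamma>, \<delta>)" by force
    \<comment> \<open>By \<open>kle\<close> all \<delta> below \<open>k\<close> are present in every
      round, including one that computes \<gamma> alone.\<close>
    have k2: "k \<le> aur_d n div 2" and kle: "k \<le> Suc ((d - 1) div 2)" using k by (auto simp: d_def)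
    have g: "real_of_int (\<gamma> i) = aur_gamma n i" if "i < k" for i
      using k(3) that by (simp add: J_def x gI_def)
    have dl: "real_of_int (\<delta> i) = aur_delta n i" if "i < k" for i
      using k(3) kle that by (simp add: J_def x dI_def)
    note gx = aur_gamma_exact[OF n k(1) k2 q' g dl]
    let ?x = "(\<Sum>j<k. int n * q (2 * k - 2 * j - 1) * \<delta> j - q (2 * k - 2 * j) * \<gamma> j) div (2 * int k)"
    define \<gamma>' where "\<gamma>' = \<gamma>(k := ?x)"
    have g': "real_of_int (\<gamma>' i) = aur_gamma n i" if "i \<le> k" for i
      using g[of i] gx that by (cases "i = k") (simp_all add: \<gamma>'_def)
    have g'I: "gI (Suc k) \<gamma>'" using g' by (simp add: gI_def)
    have rest: "runs (if k \<le> (d - 1) div 2 then do { y \<leftarrow> delta_c q \<gamma>' \<delta> k; ret (\<gamma>', \<delta>(k := y)) }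
         else ret (\<gamma>', \<delta>)) (4 * k + 4) (J (Suc k))"
    proof (cases "k \<le> (d - 1) div 2")
      case True
      note dx = aur_delta_exact[OF n k(1) True[unfolded d_def] q' g' dl]
      have "runs (do { y \<leftarrow> delta_c q \<gamma>' \<delta> k; ret (\<gamma>', \<delta>(k := y)) }) (4 * k + 4) (J (Suc k))"
      proof (rule runs_bind[OF runs_delta, where ?b2.0 = 0])
        fix y assume "y = (\<gamma>' k + (\<Sum>j<k. q (2 * k + 1 - 2 * j) * \<gamma>' j - q (2 * k - 2 * j) * \<delta> j)) div (2 * int k + 1)"
        then have "real_of_int y = aur_delta n k" using dx by simp
        then have "dI (Suc k) (\<delta>(k := y))" using dl by (simp add: dI_def less_Suc_eq)
        moreover have "min (Suc k) (Suc ((d - 1) div 2)) = Suc k" using True by simp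
        ultimately have "J (Suc k) (\<gamma>', \<delta>(k := y))" using g'I unfolding J_def prod.case by simp
        then show "runs (ret (\<gamma>', \<delta>(k := y))) 0 (J (Suc k))" by (rule runs_ret)
      qed simp
      then show ?thesis using True by simp
    next
      case False
      then have "min (Suc k) (Suc ((d - 1) div 2)) = min k (Suc ((d - 1) div 2))" by simp
      then have "J (Suc k) (\<gamma>', \<delta>)" using g'I k(3) by (simp add: J_def x)
      then show ?thesis using False by (simp add: runs_ret)
    qed
    show "runs (case x of (\<gamma>, \<delta>) \<Rightarrow> do {
         x \<leftarrow> gamma_c n q \<gamma> \<delta> k;
         let \<gamma>' = \<gamma>(k := x);
         if k \<le> (d - 1) div 2 then do { y \<leftarrow> delta_c q \<gamma>' \<delta> k; ret (\<gamma>', \<delta>(k := y)) }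
         else ret (\<gamma>', \<delta>)
       }) (9 * d + 6) (J (Suc k))"
      unfolding x prod.case Let_def
    proof (rule runs_bind[OF runs_gamma, where ?b2.0 = "4 * k + 4"])
      fix y assume y: "y = ?x"
      show "runs (if k \<le> (d - 1) div 2 then do { z \<leftarrow> delta_c q (\<gamma>(k := y)) \<delta> k; ret (\<gamma>(k := y), \<delta>(k := z)) }
         else ret (\<gamma>(k := y), \<delta>)) (4 * k + 4) (J (Suc k))"
        unfolding y by (rule rest[unfolded \<gamma>'_def])
    qed (use k in linarith)
  qed simp
  \<comment> \<open>Mirroring only copies entries, which costs nothing; each source index is smaller
    than its target.\<close>
  have gamma_loop: "runs (for_each [d div 2 + 1..<Suc d] (\<lambda>k \<gamma>. ret (\<gamma>(k := \<gamma> (d - k)))) \<gamma>)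
      ((Suc d - (d div 2 + 1)) * 0) (gI (Suc d))" if "gI (d div 2 + 1) \<gamma>" for \<gamma>
  proof (rule runs_for_upt[where I = gI, OF _ that])
    fix k and \<gamma> :: "nat \<Rightarrow> int" assume k: "d div 2 + 1 \<le> k" "k < Suc d" "gI k \<gamma>"
    have "d - k < k" using k by linarith
    moreover have "aur_gamma n k = aur_gamma n (d - k)"
      using k by (subst aur_gamma.simps) (simp add: d_def)
    ultimately show "runs (ret (\<gamma>(k := \<gamma> (d - k)))) 0 (gI (Suc k))"
      using k(3) by (intro runs_ret) (simp add: gI_def less_Suc_eq)
  qed simp
  have delta_loop: "runs (for_each [(d + 1) div 2..<d] (\<lambda>k \<delta>. ret (\<delta>(k := \<delta> (d - 1 - k)))) \<delta>)
      ((d - (d + 1) div 2) * 0) (dI d)" if "dI ((d + 1) div 2) \<delta>" for \<delta>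
  proof (rule runs_for_upt[where I = dI, OF _ that])
    fix k and \<delta> :: "nat \<Rightarrow> int" assume k: "(d + 1) div 2 \<le> k" "k < d" "dI k \<delta>"
    have "d - 1 - k < k" using k by linarith
    moreover have "k > (d - 1) div 2" using k by linarith
    then have "aur_delta n k = aur_delta n (d - 1 - k)"
      using k by (subst aur_delta.simps) (simp add: d_def)
    ultimately show "runs (ret (\<delta>(k := \<delta> (d - 1 - k)))) 0 (dI (Suc k))"
      using k(3) by (intro runs_ret) (simp add: dI_def less_Suc_eq)
  qed (use d1 in simp)
  have fin: "aur_correct n (d, q, \<gamma>, \<delta>)" if "qI (Suc d) q" "gI (Suc d) \<gamma>" "dI d \<delta>" for q \<gamma> \<delta>
    using that by (auto simp: aur_correct_def d_def qI_def gI_def dI_def)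
  have fin_delta: "runs (do {
        \<delta> \<leftarrow> for_each [(d + 1) div 2..<d] (\<lambda>k \<delta>. ret (\<delta>(k := \<delta> (d - 1 - k)))) \<delta>;
        ret (d, q, \<gamma>, \<delta>) }) 0 (aur_correct n)"
    if "qI (Suc d) q" "gI (Suc d) \<gamma>" "dI ((d + 1) div 2) \<delta>" for q \<gamma> \<delta>
    by (rule runs_bind[OF delta_loop[OF that(3)], where ?b2.0 = 0]) (use fin that in \<open>auto intro: runs_ret\<close>)
  have fin_gamma: "runs (do {
        \<gamma> \<leftarrow> for_each [d div 2 + 1..<Suc d] (\<lambda>k \<gamma>. ret (\<gamma>(k := \<gamma> (d - k)))) \<gamma>;
        \<delta> \<leftarrow> for_each [(d + 1) div 2..<d] (\<lambda>k \<delta>. ret (\<delta>(k := \<delta> (d - 1 - k)))) \<delta>;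
        ret (d, q, \<gamma>, \<delta>) }) 0 (aur_correct n)"
    if "qI (Suc d) q" "J (Suc (d div 2)) (\<gamma>, \<delta>)" for q \<gamma> \<delta>
  proof -
    have g: "gI (d div 2 + 1) \<gamma>" using that(2) by (simp add: J_def)
    \<comment> \<open>Mirroring of \<delta> starts no later than the filled part ends.\<close>
    have "(d + 1) div 2 \<le> min (Suc (d div 2)) (Suc ((d - 1) div 2))" by (auto; linarith)
    then have "dI ((d + 1) div 2) \<delta>" using that(2) by (auto simp: J_def dI_def)
    then show ?thesis
      by (intro runs_bind[OF gamma_loop[OF g], where ?b2.0 = 0]) (use fin_delta that(1) in auto)
  qed
  have loops: "runs (do {
     q \<leftarrow> for_each [1..<Suc d] (\<lambda>k q. do { x \<leftarrow> q_c n N k; ret (q(k := x)) }) (\<lambda>_. 0);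
     (\<gamma>, \<delta>) \<leftarrow> for_each [1..<Suc (d div 2)] (\<lambda>k (\<gamma>, \<delta>). do {
         x \<leftarrow> gamma_c n q \<gamma> \<delta> k;
         let \<gamma>' = \<gamma>(k := x);
         if k \<le> (d - 1) div 2 then do { y \<leftarrow> delta_c q \<gamma>' \<delta> k; ret (\<gamma>', \<delta>(k := y)) }
         else ret (\<gamma>', \<delta>)
       }) ((\<lambda>_. 0)(0 := 1), (\<lambda>_. 0)(0 := 1));
     \<gamma> \<leftarrow> for_each [d div 2 + 1..<Suc d] (\<lambda>k \<gamma>. ret (\<gamma>(k := \<gamma> (d - k)))) \<gamma>;
     \<delta> \<leftarrow> for_each [(d + 1) div 2..<d] (\<lambda>k \<delta>. ret (\<delta>(k := \<delta> (d - 1 - k)))) \<delta>;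
     ret (d, q, \<gamma>, \<delta>)
   }) (d * (30 * N) + d div 2 * (9 * d + 6)) (aur_correct n)"
  proof (rule runs_bind[OF q_loop, where ?b2.0 = "d div 2 * (9 * d + 6)"])
    fix q assume q: "qI (Suc d) q"
    show "runs (do {
     (\<gamma>, \<delta>) \<leftarrow> for_each [1..<Suc (d div 2)] (\<lambda>k (\<gamma>, \<delta>). do {
         x \<leftarrow> gamma_c n q \<gamma> \<delta> k;
         let \<gamma>' = \<gamma>(k := x);
         if k \<le> (d - 1) div 2 then do { y \<leftarrow> delta_c q \<gamma>' \<delta> k; ret (\<gamma>', \<delta>(k := y)) }
         else ret (\<gamma>', \<delta>)
       }) ((\<lambda>_. 0)(0 := 1), (\<lambda>_. 0)(0 := 1));
     \<gamma> \<leftarrow> for_each [d div 2 + 1..<Suc d] (\<lambda>k \<gamma>. ret (\<gamma>(k := \<gamma> (d - k)))) \<gamma>;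
     \<delta> \<leftarrow> for_each [(d + 1) div 2..<d] (\<lambda>k \<delta>. ret (\<delta>(k := \<delta> (d - 1 - k)))) \<delta>;
     ret (d, q, \<gamma>, \<delta>)
   }) (d div 2 * (9 * d + 6)) (aur_correct n)"
    proof (rule runs_bind[OF main_loop[OF q], where ?b2.0 = 0])
      fix x assume J: "J (Suc (d div 2)) x"
      obtain \<gamma> \<delta> where x: "x = (\<gamma>, \<delta>)" by force
      show "runs (case x of (\<gamma>, \<delta>) \<Rightarrow> do {
          \<gamma> \<leftarrow> for_each [d div 2 + 1..<Suc d] (\<lambda>k \<gamma>. ret (\<gamma>(k := \<gamma> (d - k)))) \<gamma>;
          \<delta> \<leftarrow> for_each [(d + 1) div 2..<d] (\<lambda>k \<delta>. ret (\<delta>(k := \<delta> (d - 1 - k)))) \<delta>;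
          ret (d, q, \<gamma>, \<delta>) }) 0 (aur_correct n)"
        unfolding x prod.case using fin_gamma[OF q] J by (simp only: x)
    qed simp
  qed simp
  have "runs (aur_algorithm n) (3 + (6 * N + (1 + (d * (30 * N) + d div 2 * (9 * d + 6))))) (aur_correct n)"
    unfolding aur_algorithm_def
  proof (rule runs_bind[OF runs_n'], unfold N_def[symmetric], simp only:)
    have tot: "runs (totient_c N) (6 * N) (\<lambda>t. t = 2 * d)"
      using runs_totient[OF N0] aur_d[OF n(1)] by (simp add: N_def d_def)
    show "runs (do {
       t \<leftarrow> totient_c N;
       d \<leftarrow> arith (div) t 2;
       q \<leftarrow> for_each [1..<Suc d] (\<lambda>k q. do { x \<leftarrow> q_c n N k; ret (q(k := x)) }) (\<lambda>_. 0);
       (\<gamma>, \<delta>) \<leftarrow> for_each [1..<Suc (d div 2)] (\<lambda>k (\<gamma>, \<delta>). do {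
           x \<leftarrow> gamma_c n q \<gamma> \<delta> k;
           let \<gamma>' = \<gamma>(k := x);
           if k \<le> (d - 1) div 2 then do { y \<leftarrow> delta_c q \<gamma>' \<delta> k; ret (\<gamma>', \<delta>(k := y)) }
           else ret (\<gamma>', \<delta>)
         }) ((\<lambda>_. 0)(0 := 1), (\<lambda>_. 0)(0 := 1));
       \<gamma> \<leftarrow> for_each [d div 2 + 1..<Suc d] (\<lambda>k \<gamma>. ret (\<gamma>(k := \<gamma> (d - k)))) \<gamma>;
       \<delta> \<leftarrow> for_each [(d + 1) div 2..<d] (\<lambda>k \<delta>. ret (\<delta>(k := \<delta> (d - 1 - k)))) \<delta>;
       ret (d, q, \<gamma>, \<delta>)
     }) (6 * N + (1 + (d * (30 * N) + d div 2 * (9 * d + 6)))) (aur_correct n)"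
    proof (rule runs_bind[OF tot])
      have dd: "2 * d div 2 = d" by simp
      fix t assume t: "t = 2 * d"
      show "runs (do {
         d \<leftarrow> arith (div) t 2;
         q \<leftarrow> for_each [1..<Suc d] (\<lambda>k q. do { x \<leftarrow> q_c n N k; ret (q(k := x)) }) (\<lambda>_. 0);
         (\<gamma>, \<delta>) \<leftarrow> for_each [1..<Suc (d div 2)] (\<lambda>k (\<gamma>, \<delta>). do {
             x \<leftarrow> gamma_c n q \<gamma> \<delta> k;
             let \<gamma>' = \<gamma>(k := x);
             if k \<le> (d - 1) div 2 then do { y \<leftarrow> delta_c q \<gamma>' \<delta> k; ret (\<gamma>', \<delta>(k := y)) }
             else ret (\<gamma>', \<delta>)
           }) ((\<lambda>_. 0)(0 := 1), (\<lambda>_. 0)(0 := 1));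
         \<gamma> \<leftarrow> for_each [d div 2 + 1..<Suc d] (\<lambda>k \<gamma>. ret (\<gamma>(k := \<gamma> (d - k)))) \<gamma>;
         \<delta> \<leftarrow> for_each [(d + 1) div 2..<d] (\<lambda>k \<delta>. ret (\<delta>(k := \<delta> (d - 1 - k)))) \<delta>;
         ret (d, q, \<gamma>, \<delta>)
       }) (1 + (d * (30 * N) + d div 2 * (9 * d + 6))) (aur_correct n)"
        unfolding t by (rule runs_bind_arith, simp, unfold dd, rule runs_weaken[OF loops]) simp_all
    qed simp
  qed simp
  \<comment> \<open>With \<open>d \<le> n\<close> and \<open>N \<le> 2 * n\<close> the total is at
    most \<open>69 * n^2 + 18 * n + 4\<close>, hence at most \<open>91 * n^2\<close>.\<close>
  moreover have "3 + (6 * N + (1 + (d * (30 * N) + d div 2 * (9 * d + 6)))) \<le> 100 * n ^ 2"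
  proof -
    have dn: "d \<le> n" using dN Nn by simp
    have "d * (30 * N) \<le> n * (30 * (2 * n))" using dn Nn by (intro mult_le_mono) auto
    moreover have "d div 2 * (9 * d + 6) \<le> n * (9 * n + 6)" using dn by (intro mult_le_mono) auto
    moreover have "n \<le> n * n" by simp
    moreover have "1 \<le> n * n" using n by simp
    moreover have "100 * n ^ 2 = 100 * (n * n)" "n * (30 * (2 * n)) = 60 * (n * n)"
      "n * (9 * n + 6) = 9 * (n * n) + 6 * n" by (simp_all add: power2_eq_square algebra_simps)
    ultimately show ?thesis using Nn by linarith
  qed
  ultimately show ?thesis by (rule runs_weaken)
qed

theorem mainTheorem1:
  shows
    "(\<forall>n. n > 1 \<longrightarrow> squarefree n \<longrightarrow>
        (\<forall>k\<in>{1..aur_d n}. aur_q n k \<in> \<int>) \<and>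
        (\<forall>k\<le>aur_d n. aur_gamma n k \<in> \<int>) \<and>
        (\<forall>k<aur_d n. aur_delta n k \<in> \<int>) \<and>
        map_poly of_int (aur_C n) = (\<Sum>j\<le>aur_d n. Polynomial.monom (aur_gamma n j) (aur_d n - j)) \<and>
        map_poly of_int (aur_D n) = (\<Sum>j<aur_d n. Polynomial.monom (aur_delta n j) (aur_d n - 1 - j)) \<and>
        (case aur_output n of (d, q, \<gamma>, \<delta>) \<Rightarrow>
           d = aur_d n \<and>
           (\<forall>k\<in>{1..d}. of_int (q k) = aur_q n k) \<and>
           (\<forall>k\<le>d. of_int (\<gamma> k) = aur_gamma n k) \<and>
           (\<forall>k<d. of_int (\<delta> k) = aur_delta n k))) \<and>
     (\<lambda>n. real (aur_ops n)) \<in> O[inf at_top (principal {n. n > 1 \<and> squarefree n})](\<lambda>n. real n ^ 2)"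
proof (intro conjI allI impI)
  fix n :: nat assume n: "n > 1" "squarefree n"
  show "\<forall>k\<in>{1..aur_d n}. aur_q n k \<in> \<int>" using aur_q_Ints n by simp
  show "aur_gamma n k \<in> \<int>" if "k \<le> aur_d n" for k using aur_gamma_delta_Ints(1)[OF n that] .
  show "aur_delta n k \<in> \<int>" if "k < aur_d n" for k using aur_gamma_delta_Ints(2)[OF n that] .
  show "map_poly of_int (aur_C n) = (\<Sum>j\<le>aur_d n. Polynomial.monom (aur_gamma n j) (aur_d n - j))"
    by (rule aur_C_coeffs[OF n])
  show "map_poly of_int (aur_D n) = (\<Sum>j<aur_d n. Polynomial.monom (aur_delta n j) (aur_d n - 1 - j))"
    by (rule aur_D_coeffs[OF n])
  have "aur_correct n (aur_output n)"
    using runs_aur_algorithm[OF n] by (simp add: runs_def aur_output_def)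
  then show "case aur_output n of (d, q, \<gamma>, \<delta>) \<Rightarrow>
           d = aur_d n \<and>
           (\<forall>k\<in>{1..d}. of_int (q k) = aur_q n k) \<and>
           (\<forall>k\<le>d. of_int (\<gamma> k) = aur_gamma n k) \<and>
           (\<forall>k<d. of_int (\<delta> k) = aur_delta n k)"
    by (simp only: aur_correct_def)
next
  \<comment> \<open>The bound holds at every square-free \<open>n > 1\<close>, not just eventually,
    so 100 is a valid constant on the restricted filter.\<close>
  have "aur_ops n \<le> 100 * n ^ 2" if "n > 1" "squarefree n" for n
    using runs_aur_algorithm[OF that] by (auto simp: runs_def aur_ops_def dest: spec[of _ 0])
  then have "real (aur_ops n) \<le> 100 * real n ^ 2" if "n > 1" "squarefree n" for n
    using that by (metis (mono_tags) of_nat_le_iff of_nat_mult of_nat_numeral of_nat_power)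
  then show "(\<lambda>n. real (aur_ops n)) \<in> O[inf at_top (principal {n. n > 1 \<and> squarefree n})](\<lambda>n. real n ^ 2)"
    by (intro bigoI[where c = 100]) (auto simp: eventually_inf_principal)
qed

end
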